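(* Let $\mathbb{F}_q$ be a finite field, let $d>1$, and let $\alpha_1,\ldots,\alpha_d\in\mathbb{F}_q[t]$ be distinct polynomials. Set \[ f_t(z)=(z-\alpha_1)\cdots(z-\alpha_d)\in \mathbb{F}_q(t)[z]. \] Assume that for each $i\neq j$, \[ \deg(\alpha_i-\alpha_j)+\sum_{\ell\neq j}\deg(\alpha_\ell-\alpha_j)>\max_\ell \deg(\alpha_\ell). \] Then for any field extension $k/\mathbb{F}_q$ and any function field $K$ over $k$, the Strong Uniform Boundedness Principle over $K$ holds for the family $f_t$.
   Context: A function field over a field $k$ is any finite extension of the rational function field $k(t)$. For a field $L$ and a rational function $f$, $\mathrm{PrePer}(f,L)$ denotes the set of points $x\in\mathbb{P}^1(L)$ having finite forward orbit under $f$. A set $\mathcal{F}\subset \bar K(z)$ of rational functions of degree $d>1$ satisfies the Strong Uniform Boundedness Principle (SUBP) over $K$ if for every $D\ge1$ there is a bound $B=B(\mathcal{F},D)$ such that $\#\mathrm{PrePer}(f,L)\le B$ for every extension $L/K$ of degree $D$ and every $f\in\mathcal{F}$ with coefficients in $L$. For a family $f_t\in\mathbb{F}_q(t)(z)$ and a field $k\supseteq \mathbb{F}_q$ with function field $K$ over $k$, "the SUBP over $K$ holds for the family $f_t$" means that the SUBP over $K$ holds for the set $\mathcal{F}=\{f_s : s\in\bar K,\ f_s \text{ is not } \bar K\text{-conjugate (by an element of } \mathrm{PGL}_2(\bar K)) \text{ to an element of } \bar k(z)\}$, where $f_s$ is obtained by specializing $t=s$. *)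

theory Defs
  imports "HOL-Algebra.Algebraic_Closure_Type" "HOL-Algebra.Generated_Fields"
begin

text \<open>
  Throughout, the type \<open>'a\<close> is the algebraic closure of the function field under consideration,
  and all fields that occur are subfields of it, given as sets. The algebra library speaks about
  subfields, degrees and algebraic elements relative to a ring record, which is \<open>\<K>\<close> here.
  Polynomials and rational functions over \<open>'a\<close> are those of the types \<open>'a poly\<close> and
  \<open>'a poly fract\<close>.
\<close>

hide_const (open) Polynomials.degree

abbreviation ambient_field :: "'a::field ring" (\<open>\<K>\<close>)
  where "\<K> \<equiv> ring_of_type_algebra"


subsection \<open>Subfields\<close>

definition poly_over :: "'a::field set \<Rightarrow> 'a poly \<Rightarrow> bool"
  where "poly_over L p \<longleftrightarrow> set (coeffs p) \<subseteq> L"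

definition extension_of_degree :: "nat \<Rightarrow> 'a::field set \<Rightarrow> 'a set \<Rightarrow> bool"
  where "extension_of_degree D K L \<longleftrightarrow>
    subfield K \<K> \<and> subfield L \<K> \<and> K \<subseteq> L \<and> ring.dimension \<K> D K L"

definition function_field_over :: "'a::field set \<Rightarrow> 'a set \<Rightarrow> bool"
  where "function_field_over k K \<longleftrightarrow>
    subfield k \<K> \<and> subfield K \<K> \<and> k \<subseteq> K \<and>
    (\<exists>t\<in>K. ring.transcendental \<K> k t \<and>
           (\<exists>n. extension_of_degree n (generate_field \<K> (insert t k)) K))"

definition algebraic_elements :: "'a::field set \<Rightarrow> 'a set"
  where "algebraic_elements k = {x. \<not> ring.transcendental \<K> k x}"


subsection \<open>Rational functions and the projective line\<close>

datatype 'a proj_line = Affine 'a | Infinity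

definition proj_points :: "'a set \<Rightarrow> 'a proj_line set"
  where "proj_points L = insert Infinity (Affine ` L)"

definition rat_const :: "'a::field \<Rightarrow> 'a poly fract"
  where "rat_const c = Fract [:c:] 1"

definition rat_over :: "'a::field set \<Rightarrow> 'a poly fract \<Rightarrow> bool"
  where "rat_over L f \<longleftrightarrow> (\<exists>p q. poly_over L p \<and> poly_over L q \<and> q \<noteq> 0 \<and> f = Fract p q)"

definition lowest_terms :: "'a::field poly fract \<Rightarrow> 'a poly \<times> 'a poly \<Rightarrow> bool"
  where "lowest_terms f = (\<lambda>(p, q). q \<noteq> 0 \<and> coprime p q \<and> f = Fract p q)"

text \<open>A representation in lowest terms exists and is unique up to a common constant factor;
  everything below is independent of that factor.\<close>

lemma lowest_terms_exists: "\<exists>pq. lowest_terms f pq"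
proof -
  define P where "P = (\<lambda>q. q \<noteq> 0 \<and> (\<exists>p. f = Fract p q))"
  have "\<exists>q. P q"
    unfolding P_def by (cases f) auto
  then obtain q where q: "P q" "\<And>r. P r \<Longrightarrow> degree q \<le> degree r"
    using ex_has_least_nat[of P _ degree] by blast
  then obtain p where p: "f = Fract p q" and q0: "q \<noteq> 0"
    unfolding P_def by blast
  have "is_unit c" if c: "c dvd p" "c dvd q" for c
  proof -
    obtain a b where ab: "p = c * a" "q = c * b"
      using c unfolding dvd_def by blast
    then have nz: "c \<noteq> 0" "b \<noteq> 0"
      using q0 by auto
    have "f = Fract a b"
      using p ab nz by (simp add: eq_fract algebra_simps)
    then have "degree q \<le> degree b"
      using q(2)[of b] nz unfolding P_def by blast
    then have "degree c = 0"
      using ab nz by (simp add: degree_mult_eq)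
    then show ?thesis
      using nz by (simp add: is_unit_iff_degree)
  qed
  then have "lowest_terms f (p, q)"
    using p q0 by (auto simp: lowest_terms_def coprime_def)
  then show ?thesis ..
qed

definition rat_num :: "'a::field poly fract \<Rightarrow> 'a poly"
  where "rat_num f = fst (SOME pq. lowest_terms f pq)"

definition rat_den :: "'a::field poly fract \<Rightarrow> 'a poly"
  where "rat_den f = snd (SOME pq. lowest_terms f pq)"

definition rat_degree :: "'a::field poly fract \<Rightarrow> nat"
  where "rat_degree f = max (degree (rat_num f)) (degree (rat_den f))"

fun rat_map :: "'a::field poly fract \<Rightarrow> 'a proj_line \<Rightarrow> 'a proj_line"
  where
    "rat_map f (Affine x) =
      (if poly (rat_den f) x = 0 then Infinity
       else Affine (poly (rat_num f) x / poly (rat_den f) x))"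
  | "rat_map f Infinity =
      (if coeff (rat_den f) (rat_degree f) = 0 then Infinity
       else Affine (coeff (rat_num f) (rat_degree f) / coeff (rat_den f) (rat_degree f)))"

definition PrePer :: "'a::field poly fract \<Rightarrow> 'a set \<Rightarrow> 'a proj_line set"
  where "PrePer f L = {x \<in> proj_points L. finite (range (\<lambda>n. (rat_map f ^^ n) x))}"

text \<open>Composition \<open>f(g(z))\<close> in the field of rational functions; it is meaningful unless \<open>g\<close> is a
  constant equal to a pole of \<open>f\<close>.\<close>

definition rat_comp :: "'a::field poly fract \<Rightarrow> 'a poly fract \<Rightarrow> 'a poly fract"
  where "rat_comp f g =
    poly (map_poly rat_const (rat_num f)) g / poly (map_poly rat_const (rat_den f)) g"

definition moebius :: "'a::field \<Rightarrow> 'a \<Rightarrow> 'a \<Rightarrow> 'a \<Rightarrow> 'a poly fract"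
  where "moebius a b c d = Fract [:b, a:] [:d, c:]"

text \<open>The relation \<open>f = \<mu> \<circ> g \<circ> \<mu>\<inverse>\<close> with \<open>\<mu>(z) = (az + b) / (cz + d)\<close>, stated as
  \<open>f \<circ> \<mu> = \<mu> \<circ> g\<close>. It is used for nonconstant \<open>f\<close> only; then it forces \<open>g\<close> to be nonconstant,
  so that both compositions are meaningful.\<close>

definition PGL2_conjugate :: "'a::field poly fract \<Rightarrow> 'a poly fract \<Rightarrow> bool"
  where "PGL2_conjugate f g \<longleftrightarrow>
    (\<exists>a b c d. a * d - b * c \<noteq> 0 \<and>
       rat_comp f (moebius a b c d) = rat_comp (moebius a b c d) g)"


subsection \<open>The Strong Uniform Boundedness Principle\<close>

definition SUBP :: "'a::field set \<Rightarrow> 'a poly fract set \<Rightarrow> bool"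
  where "SUBP K F \<longleftrightarrow>
    (\<exists>d>1. \<forall>f\<in>F. rat_degree f = d) \<and>
    (\<forall>D\<ge>1. \<exists>B::nat. \<forall>L f. extension_of_degree D K L \<longrightarrow> f \<in> F \<longrightarrow> rat_over L f \<longrightarrow>
       finite (PrePer f L) \<and> card (PrePer f L) \<le> B)"

text \<open>A family with polynomial coefficients in \<open>t\<close> is an element of \<open>'a poly poly\<close>: the outer
  variable is \<open>z\<close>, the inner one is \<open>t\<close>. Such a family can be specialized at every \<open>s\<close>.\<close>

definition specialize :: "'a::field poly poly \<Rightarrow> 'a \<Rightarrow> 'a poly fract"
  where "specialize f s = Fract (map_poly (\<lambda>c. poly c s) f) 1"

definition SUBP_family :: "'a::field set \<Rightarrow> 'a set \<Rightarrow> 'a poly poly \<Rightarrow> bool"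
  where "SUBP_family k K f \<longleftrightarrow>
    SUBP K {specialize f s |s.
      \<not> (\<exists>g. rat_over (algebraic_elements k) g \<and> PGL2_conjugate (specialize f s) g)}"

end

theory Submission
  imports Defs
begin

text \<open>
  Let \<open>s\<close> be transcendental over the field \<open>k\<close>, which may be assumed algebraically closed, and let
  \<open>x \<in> L\<close> be preperiodic for \<open>f\<^sub>s\<close>. At every pole of \<open>s\<close>, the inequality on the degrees forces \<open>x\<close> to
  lie close to exactly one of the roots \<open>\<alpha>\<^sub>j(s)\<close>, and \<open>f\<^sub>s\<close> is expanding there. The inverse branches
  are defined over \<open>F\<^sub>q(s)\<close>, hence \<open>x\<close> and all its conjugates lie in the completion
  \<open>F\<^sub>q((1/s))\<close>. So the minimal polynomial \<open>P\<close> of \<open>x\<close> over \<open>k(s)\<close> has coefficients in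
  \<open>F\<^sub>q[s]\<close>, of degree at most \<open>max\<^sub>l deg \<alpha>\<^sub>l\<close> times its own degree \<open>N\<close>, and the curve \<open>C\<close> over
  \<open>F\<^sub>q\<close> with function field \<open>F\<^sub>q(s, x)\<close> has \<open>N\<close> rational points at infinity.

  A function \<open>u\<close> on \<open>C\<close> with constants in \<open>k\<close> and its composition with the Frobenius map of \<open>C\<close> agree
  at these points, and they are different unless \<open>u\<close> is constant. As their difference has degree at
  most \<open>(q + 1) deg u\<close>, the gonality of \<open>C\<close> over \<open>k\<close> is at least \<open>N / (q + 1)\<close>. On the other hand,
  \<open>k(s, x)\<close> is contained in an extension of \<open>k(t)\<close> whose degree \<open>G\<close> is bounded in terms of \<open>D\<close>, and
  the norm of \<open>c - t\<close>, for a suitable \<open>c \<in> k\<close>, is a nonconstant function of degree at most \<open>G\<close>.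
  Therefore \<open>N \<le> (q + 1) G\<close>, which leaves finitely many possibilities for \<open>P\<close> as a polynomial in two
  variables over \<open>F\<^sub>q\<close>, independently of \<open>s\<close>.

  Places are represented by valuation rings of the algebraic closure, and the degree of a function
  on \<open>C\<close> by the degree in \<open>s\<close> of a polynomial that the conjugates of the function satisfy.
\<close>

subsection \<open>Subrings and subfields\<close>

text \<open>The gonality argument needs a Frobenius map that fixes the constants in
  \<open>k\<close>. It is the \<open>k\<close>-linear substitution of \<open>s ^ q\<close> for
  \<open>s\<close> on \<open>k(s)\<close>, together with \<open>x \<mapsto> x ^ q\<close>. On
  \<open>Fq(s)\<close> this substitution is the \<open>q\<close>-th power, so it respects the
  equation of \<open>x\<close> and approximation by elements of \<open>Fq(s)\<close>; hence the
  places at infinity, where \<open>x\<close> lies in the completion of \<open>Fq(s)\<close>, are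
  fixed. It multiplies degrees of functions by \<open>q\<close>, and the two terms of the difference
  contribute \<open>q\<close> and \<open>1\<close> to the factor \<open>q + 1\<close>. That
  \<open>G\<close> is independent of \<open>s\<close> is not automatic, since \<open>L\<close> need
  not contain \<open>s\<close>. But \<open>f\<^sub>s\<close> has its coefficients in
  \<open>L\<close>, and one of them is a fixed nonconstant polynomial in \<open>s\<close>; so
  \<open>s\<close> has bounded degree over \<open>L\<close>. Curves, divisors and completions are
  never constructed. Norms are products over lists of roots with multiplicity, which is correct in
  the inseparable case too. Counting zeros and poles becomes one estimate for a product
  \<open>B\<close> of differences: it is a polynomial in \<open>s\<close> by integrality at the
  finite places, and each zero at infinity lowers the bound for its degree by one.\<close>

definition is_subring :: "'a::field set \<Rightarrow> bool"
  where "is_subring A \<longleftrightarrow> 1 \<in> A \<and> (\<forall>x\<in>A. \<forall>y\<in>A. x - y \<in> A \<and> x * y \<in> A)"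

text \<open>As \<open>inverse 0 = 0\<close>, the condition can range over all of \<open>F\<close>.
  These predicates on sets replace the ring record; \<open>is_subfield_if_subfield\<close> makes the
  passage.\<close>

definition is_subfield :: "'a::field set \<Rightarrow> bool"
  where "is_subfield F \<longleftrightarrow> is_subring F \<and> (\<forall>x\<in>F. inverse x \<in> F)"

context
  fixes A :: "'a::field set"
  assumes A: "is_subring A"
begin

lemma subring_one: "1 \<in> A"
  and subring_diff: "x \<in> A \<Longrightarrow> y \<in> A \<Longrightarrow> x - y \<in> A"
  and subring_mult: "x \<in> A \<Longrightarrow> y \<in> A \<Longrightarrow> x * y \<in> A"
  using A by (auto simp: is_subring_def)

lemma subring_zero: "0 \<in> A"
  using subring_diff[OF subring_one subring_one] by simp

lemma subring_uminus: "x \<in> A \<Longrightarrow> - x \<in> A"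
  using subring_diff[OF subring_zero] by force

lemma subring_add: "x \<in> A \<Longrightarrow> y \<in> A \<Longrightarrow> x + y \<in> A"
  using subring_diff[OF _ subring_uminus] by force

lemma subring_power: "x \<in> A \<Longrightarrow> x ^ n \<in> A"
  by (induction n) (auto intro: subring_one subring_mult)

lemma subring_sum: "(\<And>i. i \<in> I \<Longrightarrow> f i \<in> A) \<Longrightarrow> sum f I \<in> A"
  by (induction I rule: infinite_finite_induct) (auto intro: subring_zero subring_add)

lemma subring_prod: "(\<And>i. i \<in> I \<Longrightarrow> f i \<in> A) \<Longrightarrow> prod f I \<in> A"
  by (induction I rule: infinite_finite_induct) (auto intro: subring_one subring_mult)

lemma subring_prod_list: "(\<And>x. x \<in> set xs \<Longrightarrow> x \<in> A) \<Longrightarrow> prod_list xs \<in> A"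
  by (induction xs) (auto intro: subring_one subring_mult)

lemma poly_over_iff: "poly_over A p \<longleftrightarrow> (\<forall>i. coeff p i \<in> A)"
proof
  assume p: "poly_over A p"
  show "\<forall>i. coeff p i \<in> A"
  proof
    fix i
    show "coeff p i \<in> A"
    proof (cases "p \<noteq> 0 \<and> i \<le> degree p")
      case True
      then have "coeff p i \<in> set (coeffs p)"
        by (intro coeff_in_coeffs) auto
      then show ?thesis
        using p by (auto simp: poly_over_def)
    next
      case False
      then have "coeff p i = 0"
        by (auto intro: coeff_eq_0)
      then show ?thesis
        using subring_zero by simp
    qed
  qed
next
  assume p: "\<forall>i. coeff p i \<in> A"
  then show "poly_over A p"
    by (cases "p = 0") (auto simp: poly_over_def coeffs_def)
qed

lemma poly_over_0: "poly_over A 0"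
  and poly_over_1: "poly_over A 1"
  and poly_over_pCons: "x \<in> A \<Longrightarrow> poly_over A p \<Longrightarrow> poly_over A (pCons x p)"
  and poly_over_add: "poly_over A p \<Longrightarrow> poly_over A q \<Longrightarrow> poly_over A (p + q)"
  and poly_over_diff: "poly_over A p \<Longrightarrow> poly_over A q \<Longrightarrow> poly_over A (p - q)"
  and poly_over_uminus: "poly_over A p \<Longrightarrow> poly_over A (- p)"
  and poly_over_smult: "x \<in> A \<Longrightarrow> poly_over A p \<Longrightarrow> poly_over A (smult x p)"
  and poly_over_monom: "x \<in> A \<Longrightarrow> poly_over A (monom x n)"
  unfolding poly_over_iff
  by (auto simp: coeff_pCons coeff_1 split: nat.splits
      intro: subring_zero subring_one subring_add subring_diff subring_uminus subring_mult)

lemma poly_over_const: "x \<in> A \<Longrightarrow> poly_over A [:x:]"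
  and poly_over_linear: "x \<in> A \<Longrightarrow> poly_over A [:- x, 1:]"
  by (auto intro!: poly_over_pCons poly_over_0 poly_over_1 subring_uminus subring_one)

lemma poly_over_mult: "poly_over A p \<Longrightarrow> poly_over A q \<Longrightarrow> poly_over A (p * q)"
  unfolding poly_over_iff by (auto simp: coeff_mult intro!: subring_sum subring_mult)

lemma poly_over_power: "poly_over A p \<Longrightarrow> poly_over A (p ^ n)"
  by (induction n) (auto intro: poly_over_1 poly_over_mult)

lemma poly_over_sum: "(\<And>i. i \<in> I \<Longrightarrow> poly_over A (f i)) \<Longrightarrow> poly_over A (sum f I)"
  by (induction I rule: infinite_finite_induct) (auto intro: poly_over_0 poly_over_add)

lemma poly_over_prod: "(\<And>i. i \<in> I \<Longrightarrow> poly_over A (f i)) \<Longrightarrow> poly_over A (prod f I)"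
  by (induction I rule: infinite_finite_induct) (auto intro: poly_over_1 poly_over_mult)

lemma poly_over_prod_list: "(\<And>p. p \<in> set ps \<Longrightarrow> poly_over A p) \<Longrightarrow> poly_over A (prod_list ps)"
  by (induction ps) (auto intro: poly_over_1 poly_over_mult)

lemma poly_in_subring: "poly_over A p \<Longrightarrow> x \<in> A \<Longrightarrow> poly p x \<in> A"
  unfolding poly_over_iff poly_altdef by (auto intro!: subring_sum subring_mult subring_power)

lemma poly_over_pcompose: "poly_over A p \<Longrightarrow> poly_over A q \<Longrightarrow> poly_over A (pcompose p q)"
proof (induction p)
  case (pCons a p)
  have "poly_over A p" "a \<in> A"
    using pCons.prems(1) unfolding poly_over_iff
    by (metis coeff_pCons_Suc, metis coeff_pCons_0)
  then show ?case
    using pCons by (auto simp: pcompose_pCons intro!: poly_over_add poly_over_mult poly_over_const)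
qed (auto intro: poly_over_0)

end

lemma poly_over_mono: "A \<subseteq> B \<Longrightarrow> poly_over A p \<Longrightarrow> poly_over B p"
  by (auto simp: poly_over_def)

lemma poly_over_coeff: "is_subring A \<Longrightarrow> poly_over A p \<Longrightarrow> coeff p i \<in> A"
  by (simp add: poly_over_iff)

lemma subfield_subring: "is_subfield F \<Longrightarrow> is_subring F"
  by (simp add: is_subfield_def)

lemma subfield_inverse: "is_subfield F \<Longrightarrow> x \<in> F \<Longrightarrow> inverse x \<in> F"
  by (simp add: is_subfield_def)

lemma subfield_divide: "is_subfield F \<Longrightarrow> x \<in> F \<Longrightarrow> y \<in> F \<Longrightarrow> x / y \<in> F"
  by (simp add: divide_inverse subfield_inverse subfield_subring subring_mult)

lemma poly_over_pCons_iff: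
  "is_subring A \<Longrightarrow> poly_over A (pCons a p) \<longleftrightarrow> a \<in> A \<and> poly_over A p"
  by (metis coeff_pCons_0 coeff_pCons_Suc poly_over_iff poly_over_pCons)


subsection \<open>Linear dependence over a subfield\<close>

text \<open>Gaussian elimination by induction on the equations: an unknown with nonzero coefficient
  in equation \<open>j\<close> is the pivot and is eliminated from the other equations, with all
  coefficients staying in \<open>F\<close>.\<close>

lemma homogeneous_system:
  fixes A :: "'i \<Rightarrow> 'j \<Rightarrow> 'a::field"
  assumes F: "is_subfield F" and "finite J" "finite I" "card J < card I"
    and "\<And>i j. i \<in> I \<Longrightarrow> j \<in> J \<Longrightarrow> A i j \<in> F"
  shows "\<exists>c. (\<forall>i\<in>I. c i \<in> F) \<and> (\<exists>i\<in>I. c i \<noteq> 0) \<and> (\<forall>j\<in>J. (\<Sum>i\<in>I. c i * A i j) = 0)"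
  using assms(2-)
proof (induction J arbitrary: I A rule: finite_induct)
  case empty
  then obtain i where "i \<in> I"
    by fastforce
  then show ?case
    using subring_one[OF subfield_subring[OF F]] by (intro exI[of _ "\<lambda>_. 1"]) auto
next
  case (insert j J)
  note R = subfield_subring[OF F]
  show ?case
  proof (cases "\<forall>i\<in>I. A i j = 0")
    case True
    have "card J < card I"
      using insert by simp
    then obtain c where "\<forall>i\<in>I. c i \<in> F" "\<exists>i\<in>I. c i \<noteq> 0" "\<forall>j\<in>J. (\<Sum>i\<in>I. c i * A i j) = 0"
      using insert.IH[of I A] insert.prems by blast
    then show ?thesis
      using True by (intro exI[of _ c]) auto
  next
    case False
    then obtain i0 where i0: "i0 \<in> I" "A i0 j \<noteq> 0"
      by blast
    define I' where "I' = I - {i0}"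
    define A' where "A' = (\<lambda>i l. A i l - A i j / A i0 j * A i0 l)"
    have I: "I = insert i0 I'" "i0 \<notin> I'" "finite I'"
      using i0 insert.prems by (auto simp: I'_def)
    have "card J < card I'"
      using insert I by simp
    moreover have "A' i l \<in> F" if "i \<in> I'" "l \<in> J" for i l
      using that i0 insert.prems(3) unfolding A'_def I'_def
      by (auto intro!: subring_diff[OF R] subring_mult[OF R] subfield_divide[OF F])
    ultimately obtain c where c: "\<forall>i\<in>I'. c i \<in> F" "\<exists>i\<in>I'. c i \<noteq> 0"
      "\<forall>l\<in>J. (\<Sum>i\<in>I'. c i * A' i l) = 0"
      using insert.IH[of I' A'] I by blast
    \<comment> \<open>The value of the pivot unknown that equation \<open>j\<close> forces.\<close>
    define c0 where "c0 = - (\<Sum>i\<in>I'. c i * (A i j / A i0 j))"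
    define d where "d = (\<lambda>i. if i = i0 then c0 else c i)"
    have dsum: "(\<Sum>i\<in>I. d i * A i l) = c0 * A i0 l + (\<Sum>i\<in>I'. c i * A i l)" for l
    proof -
      have "(\<Sum>i\<in>I'. d i * A i l) = (\<Sum>i\<in>I'. c i * A i l)"
        using I by (intro sum.cong) (auto simp: d_def)
      then show ?thesis
        using I by (simp add: d_def)
    qed
    have "(\<Sum>i\<in>I. d i * A i j) = 0"
      unfolding dsum c0_def using i0 by (simp add: sum_distrib_right)
    moreover have "(\<Sum>i\<in>I. d i * A i l) = 0" if "l \<in> J" for l
    proof -
      have "(\<Sum>i\<in>I'. c i * A' i l) = (\<Sum>i\<in>I'. c i * A i l) + c0 * A i0 l"
        unfolding A'_def c0_def
        by (simp add: algebra_simps sum_subtractf sum_distrib_left sum_distrib_right)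
      then show ?thesis
        using c(3) that unfolding dsum by (simp add: add.commute)
    qed
    moreover have "d i \<in> F" if "i \<in> I" for i
    proof (cases "i = i0")
      case True
      have "c0 \<in> F"
        unfolding c0_def using c(1) i0 insert.prems(3) I
        by (intro subring_uminus[OF R] subring_sum[OF R] subring_mult[OF R] subfield_divide[OF F]) auto
      then show ?thesis
        using True by (simp add: d_def)
    next
      case False
      then show ?thesis
        using c(1) that I by (auto simp: d_def)
    qed
    moreover have "\<exists>i\<in>I. d i \<noteq> 0"
      using c(2) I by (force simp: d_def)
    ultimately show ?thesis
      by (intro exI[of _ d]) auto
  qed
qed

definition lin_indep_on :: "'a::field set \<Rightarrow> 'i set \<Rightarrow> ('i \<Rightarrow> 'a) \<Rightarrow> bool"
  where "lin_indep_on F I v \<longleftrightarrow>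
    (\<forall>c. (\<forall>i\<in>I. c i \<in> F) \<longrightarrow> (\<Sum>i\<in>I. c i * v i) = 0 \<longrightarrow> (\<forall>i\<in>I. c i = 0))"

definition lin_span :: "'a::field set \<Rightarrow> 'i set \<Rightarrow> ('i \<Rightarrow> 'a) \<Rightarrow> 'a set"
  where "lin_span F I v = {\<Sum>i\<in>I. c i * v i |c. \<forall>i\<in>I. c i \<in> F}"

lemma lin_spanI: "(\<And>i. i \<in> I \<Longrightarrow> c i \<in> F) \<Longrightarrow> y = (\<Sum>i\<in>I. c i * v i) \<Longrightarrow> y \<in> lin_span F I v"
  by (auto simp: lin_span_def)

lemma lin_spanE:
  assumes "y \<in> lin_span F I v"
  obtains c where "\<And>i. i \<in> I \<Longrightarrow> c i \<in> F" "y = (\<Sum>i\<in>I. c i * v i)"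
  using assms unfolding lin_span_def by blast

lemma lin_span_mono: "F \<subseteq> G \<Longrightarrow> lin_span F I v \<subseteq> lin_span G I v"
  by (auto simp: lin_span_def)

text \<open>If \<open>J\<close> were smaller, expressing \<open>v\<close> through \<open>w\<close>
  would give a homogeneous system with more unknowns than equations. All comparisons of degrees of
  field extensions below go through this bound.\<close>

lemma card_indep_le_card_span:
  assumes F: "is_subfield F" and "finite I" "finite J"
    and indep: "lin_indep_on F I v" and span: "\<And>i. i \<in> I \<Longrightarrow> v i \<in> lin_span F J w"
  shows "card I \<le> card J"
proof (rule ccontr)
  assume less: "\<not> ?thesis"
  have "\<exists>A. (\<forall>j\<in>J. A j \<in> F) \<and> v i = (\<Sum>j\<in>J. A j * w j)" if "i \<in> I" for i
    using span[OF that] by (auto simp: lin_span_def)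
  then obtain A where A: "\<And>i j. i \<in> I \<Longrightarrow> j \<in> J \<Longrightarrow> A i j \<in> F"
    "\<And>i. i \<in> I \<Longrightarrow> v i = (\<Sum>j\<in>J. A i j * w j)"
    by metis
  obtain c where c: "\<forall>i\<in>I. c i \<in> F" "\<exists>i\<in>I. c i \<noteq> 0" "\<forall>j\<in>J. (\<Sum>i\<in>I. c i * A i j) = 0"
    using homogeneous_system[OF F assms(3,2), of A] A(1) less by auto
  have "(\<Sum>i\<in>I. c i * v i) = (\<Sum>i\<in>I. \<Sum>j\<in>J. c i * A i j * w j)"
    by (intro sum.cong) (auto simp: A(2) sum_distrib_left mult.assoc)
  also have "\<dots> = (\<Sum>j\<in>J. (\<Sum>i\<in>I. c i * A i j) * w j)"
    by (subst sum.swap) (simp add: sum_distrib_right)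
  also have "\<dots> = 0"
    using c(3) by simp
  finally show False
    using indep c unfolding lin_indep_on_def by blast
qed

lemma lin_span_add:
  assumes "is_subring F" "x \<in> lin_span F I v" "y \<in> lin_span F I v"
  shows "x + y \<in> lin_span F I v"
proof -
  obtain c where c: "\<And>i. i \<in> I \<Longrightarrow> c i \<in> F" "x = (\<Sum>i\<in>I. c i * v i)"
    using assms(2) by (blast elim: lin_spanE)
  obtain d where d: "\<And>i. i \<in> I \<Longrightarrow> d i \<in> F" "y = (\<Sum>i\<in>I. d i * v i)"
    using assms(3) by (blast elim: lin_spanE)
  show ?thesis
    using c d assms(1)
    by (intro lin_spanI[of _ "\<lambda>i. c i + d i"]) (simp_all add: sum.distrib distrib_right subring_add)
qed

lemma lin_span_scale:
  assumes "is_subring F" "a \<in> F" "x \<in> lin_span F I v"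
  shows "a * x \<in> lin_span F I v"
proof -
  obtain c where "\<And>i. i \<in> I \<Longrightarrow> c i \<in> F" "x = (\<Sum>i\<in>I. c i * v i)"
    using assms(3) by (blast elim: lin_spanE)
  then show ?thesis
    using assms(1,2)
    by (intro lin_spanI[of _ "\<lambda>i. a * c i"]) (auto simp: sum_distrib_left mult.assoc intro: subring_mult)
qed

lemma lin_span_zero: "is_subring F \<Longrightarrow> 0 \<in> lin_span F I v"
  by (rule lin_spanI[of _ "\<lambda>_. 0"]) (auto intro: subring_zero)

lemma lin_span_sum: "is_subring F \<Longrightarrow> (\<And>j. j \<in> J \<Longrightarrow> f j \<in> lin_span F I v) \<Longrightarrow>
    sum f J \<in> lin_span F I v"
  by (induction J rule: infinite_finite_induct) (auto intro: lin_span_zero lin_span_add)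

lemma lin_span_base:
  assumes "is_subring F" "finite I" "i \<in> I"
  shows "v i \<in> lin_span F I v"
proof (rule lin_spanI[of _ "\<lambda>j. if j = i then 1 else 0"])
  show "v i = (\<Sum>j\<in>I. (if j = i then 1 else 0) * v j)"
    using assms by (simp add: if_distrib[of "\<lambda>x. x * _"] cong: if_cong)
qed (auto intro: subring_one subring_zero assms)

lemma lin_span_trans:
  assumes "is_subring F" "\<And>i. i \<in> I \<Longrightarrow> v i \<in> lin_span F J w" "x \<in> lin_span F I v"
  shows "x \<in> lin_span F J w"
proof -
  obtain c where "\<And>i. i \<in> I \<Longrightarrow> c i \<in> F" "x = (\<Sum>i\<in>I. c i * v i)"
    using assms(3) by (blast elim: lin_spanE)
  then show ?thesis
    using assms(1,2) by (auto intro!: lin_span_sum lin_span_scale)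
qed

text \<open>The upper half of the multiplicativity of degrees; \<open>lin_indep_on_tower\<close> is
  the lower half. Kept apart, they give inequalities between degrees without a notion of
  dimension.\<close>

lemma lin_span_tower:
  assumes F: "is_subring F" and v: "\<And>i. i \<in> I \<Longrightarrow> finite J"
    and E: "E \<subseteq> lin_span F J w" and x: "x \<in> lin_span E I v"
  shows "x \<in> lin_span F (I \<times> J) (\<lambda>(i, j). w j * v i)"
proof -
  obtain c where c: "\<And>i. i \<in> I \<Longrightarrow> c i \<in> E" "x = (\<Sum>i\<in>I. c i * v i)"
    using x by (blast elim: lin_spanE)
  have "\<exists>d. (\<forall>j\<in>J. d j \<in> F) \<and> c i = (\<Sum>j\<in>J. d j * w j)" if "i \<in> I" for i
    using c(1)[OF that] E by (fastforce simp: lin_span_def)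
  then obtain d where d: "\<And>i j. i \<in> I \<Longrightarrow> j \<in> J \<Longrightarrow> d i j \<in> F"
    "\<And>i. i \<in> I \<Longrightarrow> c i = (\<Sum>j\<in>J. d i j * w j)"
    by metis
  show ?thesis
  proof (rule lin_spanI[of _ "\<lambda>(i, j). d i j"])
    have "x = (\<Sum>i\<in>I. \<Sum>j\<in>J. d i j * (w j * v i))"
      unfolding c(2) by (intro sum.cong) (simp_all add: d(2) sum_distrib_right mult.assoc)
    then show "x = (\<Sum>p\<in>I \<times> J. (case p of (i, j) \<Rightarrow> d i j) * (case p of (i, j) \<Rightarrow> w j * v i))"
      by (simp only: sum.cartesian_product split_def fst_conv snd_conv)
  qed (auto intro: d)
qed

lemma lin_indep_on_tower:
  assumes F: "is_subring F" and E: "is_subring E" "F \<subseteq> E" and fin: "finite I" "finite J"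
    and w: "lin_indep_on F J w" "\<And>j. j \<in> J \<Longrightarrow> w j \<in> E" and v: "lin_indep_on E I v"
  shows "lin_indep_on F (I \<times> J) (\<lambda>(i, j). w j * v i)"
  unfolding lin_indep_on_def
proof (intro allI impI)
  fix c
  assume c: "\<forall>p\<in>I \<times> J. c p \<in> F" "(\<Sum>p\<in>I \<times> J. c p * (case p of (i, j) \<Rightarrow> w j * v i)) = 0"
  have "(\<Sum>i\<in>I. (\<Sum>j\<in>J. c (i, j) * w j) * v i) = (\<Sum>i\<in>I. \<Sum>j\<in>J. c (i, j) * (w j * v i))"
    by (intro sum.cong) (simp_all add: sum_distrib_right mult.assoc)
  also have "\<dots> = 0"
    using c(2) by (simp only: sum.cartesian_product split_def fst_conv snd_conv prod.collapse)
  finally have "(\<Sum>i\<in>I. (\<Sum>j\<in>J. c (i, j) * w j) * v i) = 0" .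
  moreover have "(\<Sum>j\<in>J. c (i, j) * w j) \<in> E" if "i \<in> I" for i
    using that c(1) w(2) E by (auto intro!: subring_sum subring_mult)
  ultimately have "(\<Sum>j\<in>J. c (i, j) * w j) = 0" if "i \<in> I" for i
    using v[unfolded lin_indep_on_def, rule_format, of "\<lambda>i. \<Sum>j\<in>J. c (i, j) * w j"] that by blast
  then have "c (i, j) = 0" if "i \<in> I" "j \<in> J" for i j
    using w(1)[unfolded lin_indep_on_def, rule_format, of "\<lambda>j. c (i, j)"] that c(1) by auto
  then show "\<forall>p\<in>I \<times> J. c p = 0"
    by auto
qed

subsection \<open>Minimal polynomials\<close>

text \<open>Long division only divides by the leading coefficient of \<open>g\<close>, so quotient
  and remainder stay over the subfield.\<close>

lemma poly_over_division:
  assumes F: "is_subfield F" and g: "poly_over F g" "g \<noteq> 0" and p: "poly_over F p"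
  shows "\<exists>h r. poly_over F h \<and> poly_over F r \<and> p = g * h + r \<and> (r = 0 \<or> degree r < degree g)"
  using p
proof (induction "degree p" arbitrary: p rule: less_induct)
  case less
  note R = subfield_subring[OF F]
  show ?case
  proof (cases "p = 0 \<or> degree p < degree g")
    case True
    then show ?thesis
      using less.prems R by (intro exI[of _ 0] exI[of _ p]) (auto intro: poly_over_0)
  next
    case False
    define c where "c = lead_coeff p / lead_coeff g"
    define m where "m = monom c (degree p - degree g)"
    have c: "c \<in> F" "c \<noteq> 0"
      using False g less.prems R unfolding c_def
      by (auto intro!: subfield_divide[OF F] poly_over_coeff)
    have m: "poly_over F m" "m \<noteq> 0" "degree m = degree p - degree g"
      using c R by (auto simp: m_def poly_over_monom degree_monom_eq monom_eq_0_iff)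
    define p' where "p' = p - g * m"
    have p': "poly_over F p'"
      unfolding p'_def using less.prems g m R by (intro poly_over_diff poly_over_mult) auto
    have deg: "degree (g * m) = degree p"
      using False g m by (simp add: degree_mult_eq)
    have lead: "lead_coeff (g * m) = lead_coeff p"
      using g m by (simp add: lead_coeff_mult m_def lead_coeff_monom c_def)
    have "p' = 0 \<or> degree p' < degree p"
    proof (cases "degree p = 0")
      case True
      then have "degree p' = 0" "coeff p' 0 = 0"
        using deg lead degree_diff_le[of p 0 "g * m"] by (auto simp: p'_def)
      then show ?thesis
        by (metis leading_coeff_0_iff)
    next
      case False
      then show ?thesis
        using deg lead unfolding p'_def
        by (metis coeff_diff degree_diff_le diff_self eq_zero_or_degree_less le_refl)
    qed
    then have "\<exists>h r. poly_over F h \<and> poly_over F r \<and> p' = g * h + r \<and> (r = 0 \<or> degree r < degree g)"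
    proof
      assume "p' = 0"
      then show ?thesis
        using R by (intro exI[of _ 0]) (auto intro: poly_over_0)
    qed (use less.hyps p' in blast)
    then obtain h r where "poly_over F h" "poly_over F r" "p' = g * h + r" "r = 0 \<or> degree r < degree g"
      by blast
    then show ?thesis
      using m R by (intro exI[of _ "h + m"] exI[of _ r])
        (auto simp: p'_def algebra_simps intro: poly_over_add)
  qed
qed

definition algebraic_over :: "'a::field set \<Rightarrow> 'a \<Rightarrow> bool"
  where "algebraic_over F y \<longleftrightarrow> (\<exists>g. poly_over F g \<and> g \<noteq> 0 \<and> poly g y = 0)"

definition min_poly :: "'a::field set \<Rightarrow> 'a \<Rightarrow> 'a poly \<Rightarrow> bool"
  where "min_poly F y p \<longleftrightarrow> poly_over F p \<and> lead_coeff p = 1 \<and> poly p y = 0 \<and>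
    (\<forall>g. poly_over F g \<longrightarrow> poly g y = 0 \<longrightarrow> g \<noteq> 0 \<longrightarrow> degree p \<le> degree g)"

lemma algebraic_over_mono: "F \<subseteq> G \<Longrightarrow> algebraic_over F y \<Longrightarrow> algebraic_over G y"
  by (auto simp: algebraic_over_def intro: poly_over_mono)

lemma min_poly_exists:
  assumes F: "is_subfield F" and "algebraic_over F y"
  obtains p where "min_poly F y p"
proof -
  define Q where "Q = (\<lambda>g. poly_over F g \<and> g \<noteq> 0 \<and> poly g y = 0)"
  have "\<exists>g. Q g"
    using assms(2) by (auto simp: algebraic_over_def Q_def)
  then obtain g where g: "Q g" "\<And>h. Q h \<Longrightarrow> degree g \<le> degree h"
    using ex_has_least_nat[of Q _ degree] by blast
  have "min_poly F y (smult (inverse (lead_coeff g)) g)"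
    using g subfield_subring[OF F] unfolding min_poly_def Q_def
    by (auto intro!: poly_over_smult subfield_inverse[OF F] poly_over_coeff)
  then show ?thesis
    by (rule that)
qed

context
  fixes F :: "'a::field set" and y :: 'a and p :: "'a poly"
  assumes F: "is_subfield F" and p: "min_poly F y p"
begin

lemma min_poly_over: "poly_over F p"
  and min_poly_monic: "lead_coeff p = 1"
  and min_poly_root: "poly p y = 0"
  and min_poly_least: "poly_over F g \<Longrightarrow> poly g y = 0 \<Longrightarrow> g \<noteq> 0 \<Longrightarrow> degree p \<le> degree g"
  using p by (auto simp: min_poly_def)

lemma min_poly_nonzero: "p \<noteq> 0"
  using min_poly_monic by auto

lemma min_poly_degree_pos: "degree p > 0"
proof (rule ccontr)
  assume "\<not> ?thesis"
  then have "p = [:lead_coeff p:]"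
    by (metis degree_eq_zeroE neq0_conv lead_coeff_pCons(2))
  then show False
    using min_poly_monic min_poly_root by (metis poly_const_conv zero_neq_one)
qed

lemma min_poly_dvd:
  assumes "poly_over F g" "poly g y = 0"
  obtains h where "poly_over F h" "g = p * h"
proof -
  obtain h r where hr: "poly_over F h" "poly_over F r" "g = p * h + r" "r = 0 \<or> degree r < degree p"
    using poly_over_division[OF F min_poly_over min_poly_nonzero assms(1)] by blast
  have "poly r y = 0"
    using assms(2) hr(3) min_poly_root by simp
  then have "r = 0"
    using hr min_poly_least by fastforce
  then show ?thesis
    using that hr by auto
qed

text \<open>This is irreducibility in disguise: in \<open>p = p' * h\<close> with \<open>p'\<close>
  minimal for \<open>z\<close>, the degree of \<open>h\<close> is too small for \<open>h\<close> to
  vanish at \<open>y\<close>. So \<open>p'\<close> vanishes there and has degree at least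
  \<open>degree p\<close>.\<close>

lemma min_poly_conjugate:
  assumes z: "poly p z = 0"
  shows "min_poly F z p"
proof -
  have "algebraic_over F z"
    using min_poly_over min_poly_nonzero z by (auto simp: algebraic_over_def)
  then obtain p' where p': "min_poly F z p'"
    using min_poly_exists[OF F] by blast
  have *: "poly_over F p'" "lead_coeff p' = 1" "poly p' z = 0"
    "\<And>g. poly_over F g \<Longrightarrow> poly g z = 0 \<Longrightarrow> g \<noteq> 0 \<Longrightarrow> degree p' \<le> degree g"
    using p' by (auto simp: min_poly_def)
  obtain h r where hr: "poly_over F h" "poly_over F r" "p = p' * h + r" "r = 0 \<or> degree r < degree p'"
    using poly_over_division[OF F *(1) _ min_poly_over] *(2) by fastforce
  have "poly r z = 0"
    using z hr(3) *(3) by simp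
  then have "r = 0"
    using hr *(4) by fastforce
  then have ph: "p = p' * h"
    using hr by simp
  have nz: "p' \<noteq> 0" "h \<noteq> 0"
    using ph min_poly_nonzero by auto
  then have deg: "degree p = degree p' + degree h"
    using ph by (simp add: degree_mult_eq)
  have "degree p' > 0"
    using *(2,3) by (metis degree_eq_zeroE lead_coeff_pCons(2) neq0_conv poly_const_conv zero_neq_one)
  then have "poly h y \<noteq> 0"
    using min_poly_least[OF hr(1)] nz deg by auto
  then have "poly p' y = 0"
    using min_poly_root ph by simp
  then have "degree p \<le> degree p'"
    using min_poly_least * nz by blast
  then show ?thesis
    using * z min_poly_over min_poly_monic unfolding min_poly_def by (meson order_trans)
qed

lemma lin_indep_on_powers: "n \<le> degree p \<Longrightarrow> lin_indep_on F {..<n} (\<lambda>i. y ^ i)"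
  unfolding lin_indep_on_def
proof (intro allI impI)
  fix c
  assume n: "n \<le> degree p" and c: "\<forall>i\<in>{..<n}. c i \<in> F" "(\<Sum>i<n. c i * y ^ i) = 0"
  define g where "g = (\<Sum>i<n. monom (c i) i)"
  have coeff: "coeff g i = (if i < n then c i else 0)" for i
    by (simp add: g_def coeff_sum)
  have "poly_over F g"
    unfolding g_def using c(1) subfield_subring[OF F] by (intro poly_over_sum poly_over_monom) auto
  moreover have "poly g y = 0"
    using c(2) by (simp add: g_def poly_sum poly_monom)
  ultimately have "g = 0 \<or> degree p \<le> degree g"
    using min_poly_least by blast
  moreover have "g = 0 \<or> degree g < n"
    by (metis coeff leading_coeff_0_iff)
  ultimately have "g = 0"
    using n by auto
  then show "\<forall>i\<in>{..<n}. c i = 0"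
    using coeff by (metis coeff_0 lessThan_iff)
qed

end

definition adjoin :: "'a::field set \<Rightarrow> 'a \<Rightarrow> 'a set"
  where "adjoin F x = {poly g x |g. poly_over F g}"

lemma adjoinI: "poly_over F g \<Longrightarrow> poly g x \<in> adjoin F x"
  by (auto simp: adjoin_def)

lemma subset_adjoin: "is_subring F \<Longrightarrow> F \<subseteq> adjoin F x"
  using adjoinI[of F "[:c:]" x for c] by (auto intro: poly_over_const)

lemma self_in_adjoin: "is_subring F \<Longrightarrow> x \<in> adjoin F x"
  using adjoinI[of F "[:0, 1:]" x] by (auto intro!: poly_over_pCons poly_over_0 subring_zero subring_one)

lemma adjoin_subset: "is_subring B \<Longrightarrow> F \<subseteq> B \<Longrightarrow> x \<in> B \<Longrightarrow> adjoin F x \<subseteq> B"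
  by (auto simp: adjoin_def intro: poly_in_subring poly_over_mono)

lemma subring_adjoin:
  assumes "is_subring F"
  shows "is_subring (adjoin F x)"
  unfolding is_subring_def
proof (intro conjI ballI)
  show "1 \<in> adjoin F x"
    using subset_adjoin[OF assms] subring_one[OF assms] by blast
next
  fix a b
  assume "a \<in> adjoin F x" "b \<in> adjoin F x"
  then obtain g h where "poly_over F g" "poly_over F h" "a = poly g x" "b = poly h x"
    by (auto simp: adjoin_def)
  then show "a - b \<in> adjoin F x" "a * b \<in> adjoin F x"
    using adjoinI[of F "g - h" x] adjoinI[of F "g * h" x] assms
    by (auto intro: poly_over_diff poly_over_mult)
qed

lemma adjoin_reduce:
  assumes F: "is_subfield F" and p: "min_poly F x p" and g: "poly_over F g"
  obtains r where "poly_over F r" "poly g x = poly r x" "degree r < degree p"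
proof -
  obtain h r where hr: "poly_over F h" "poly_over F r" "g = p * h + r" "r = 0 \<or> degree r < degree p"
    using poly_over_division[OF F _ _ g] min_poly_over[OF F p] min_poly_nonzero[OF F p] by metis
  then show ?thesis
    using that[of r] min_poly_root[OF F p] min_poly_degree_pos[OF F p] by auto
qed

lemma adjoin_eq_lin_span:
  assumes F: "is_subfield F" and p: "min_poly F x p"
  shows "adjoin F x = lin_span F {..<degree p} (\<lambda>i. x ^ i)"
proof (intro equalityI subsetI)
  fix y
  assume "y \<in> adjoin F x"
  then obtain g where "poly_over F g" "y = poly g x"
    by (auto simp: adjoin_def)
  then obtain r where r: "poly_over F r" "y = poly r x" "degree r < degree p"
    using adjoin_reduce[OF F p] by metis
  have "y = (\<Sum>i<degree p. coeff r i * x ^ i)"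
    unfolding r(2) poly_altdef using r(3) by (intro sum.mono_neutral_left) (auto simp: coeff_eq_0)
  then show "y \<in> lin_span F {..<degree p} (\<lambda>i. x ^ i)"
    using r(1) subfield_subring[OF F] by (intro lin_spanI) (auto simp: poly_over_coeff)
next
  fix y
  assume "y \<in> lin_span F {..<degree p} (\<lambda>i. x ^ i)"
  then obtain c where c: "\<And>i. i < degree p \<Longrightarrow> c i \<in> F" "y = (\<Sum>i<degree p. c i * x ^ i)"
    by (auto elim!: lin_spanE)
  have "y = poly (\<Sum>i<degree p. monom (c i) i) x"
    by (simp add: c(2) poly_sum poly_monom)
  then show "y \<in> adjoin F x"
    using c(1) subfield_subring[OF F] by (auto intro!: adjoinI poly_over_sum poly_over_monom)
qed

text \<open>Inverses come from Euclid's algorithm: dividing \<open>p\<close> by \<open>g\<close>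
  gives \<open>r(x) = - g(x) h(x)\<close> for the remainder \<open>r\<close>, so an inverse of
  \<open>r(x)\<close>, where \<open>r\<close> has smaller degree, yields one of
  \<open>g(x)\<close>.\<close>

lemma subfield_adjoin:
  assumes F: "is_subfield F" and alg: "algebraic_over F x"
  shows "is_subfield (adjoin F x)"
proof -
  note R = subfield_subring[OF F]
  obtain p where p: "min_poly F x p"
    using min_poly_exists[OF F alg] .
  have inv: "\<exists>h. poly_over F h \<and> poly g x * poly h x = 1"
    if "poly_over F g" "poly g x \<noteq> 0" "degree g < degree p" for g
    using that
  proof (induction "degree g" arbitrary: g rule: less_induct)
    case less
    have g0: "g \<noteq> 0"
      using less.prems by auto
    show ?case
    proof (cases "degree g = 0")
      case True
      then obtain c where "g = [:c:]"
        using degree_eq_zeroE by blast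
      then show ?thesis
        using less.prems R
        by (intro exI[of _ "[:inverse c:]"])
          (auto intro!: poly_over_const subfield_inverse[OF F] simp: poly_over_pCons_iff)
    next
      case False
      obtain h r where hr: "poly_over F h" "poly_over F r" "p = g * h + r" "r = 0 \<or> degree r < degree g"
        using poly_over_division[OF F less.prems(1) g0 min_poly_over[OF F p]] by blast
      have eq: "poly r x = - poly g x * poly h x"
        using min_poly_root[OF F p] hr(3) by (simp add: eq_neg_iff_add_eq_0 add.commute)
      have h0: "h \<noteq> 0"
        using hr less.prems(3) min_poly_nonzero[OF F p] by auto
      have "degree p = degree g + degree h"
        using hr h0 g0 less.prems(3) 
        by (metis add.right_neutral degree_add_eq_left degree_mult_eq trans_less_add1)
      then have "poly h x \<noteq> 0"
        using min_poly_least[OF F p hr(1)] h0 False by auto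
      then have "poly r x \<noteq> 0"
        using eq less.prems by simp
      moreover from this have "degree r < degree g"
        using hr by auto
      ultimately obtain k where k: "poly_over F k" "poly r x * poly k x = 1"
        using less.hyps[of r] hr less.prems(3) by fastforce
      show ?thesis
        using k eq hr R
        by (intro exI[of _ "- (h * k)"]) (auto intro: poly_over_mult poly_over_uminus simp: algebra_simps)
    qed
  qed
  have "inverse y \<in> adjoin F x" if y: "y \<in> adjoin F x" for y
  proof (cases "y = 0")
    case False
    obtain g where "poly_over F g" "y = poly g x"
      using y by (auto simp: adjoin_def)
    then obtain r where "poly_over F r" "y = poly r x" "degree r < degree p"
      using adjoin_reduce[OF F p] by metis
    then obtain h where "poly_over F h" "y * poly h x = 1"
      using inv False by blast
    then show ?thesis
      using adjoinI inverse_unique by metis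
  qed (use y in auto)
  then show ?thesis
    using subring_adjoin[OF R] by (auto simp: is_subfield_def)
qed

text \<open>A quotient whose denominator vanishes at \<open>t\<close> is \<open>0\<close>, which lies in the field anyway.\<close>

definition fraction_field :: "'a::field set \<Rightarrow> 'a \<Rightarrow> 'a set"
  where "fraction_field F t = {poly p t / poly q t |p q. poly_over F p \<and> poly_over F q}"

lemma fraction_fieldI: "poly_over F p \<Longrightarrow> poly_over F q \<Longrightarrow> poly p t / poly q t \<in> fraction_field F t"
  by (auto simp: fraction_field_def)

lemma adjoin_subset_fraction_field: "is_subring F \<Longrightarrow> adjoin F t \<subseteq> fraction_field F t"
  using fraction_fieldI[of F _ 1 t] by (fastforce simp: adjoin_def intro: poly_over_1)

lemma subset_fraction_field: "is_subring F \<Longrightarrow> F \<subseteq> fraction_field F t"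
  and self_in_fraction_field: "is_subring F \<Longrightarrow> t \<in> fraction_field F t"
  using adjoin_subset_fraction_field subset_adjoin self_in_adjoin by blast+

lemma fraction_field_mono: "F \<subseteq> G \<Longrightarrow> fraction_field F t \<subseteq> fraction_field G t"
  unfolding fraction_field_def using poly_over_mono by blast

lemma fraction_field_subset:
  assumes "is_subfield G" "F \<subseteq> G" "t \<in> G"
  shows "fraction_field F t \<subseteq> G"
  using assms poly_in_subring[OF subfield_subring[OF assms(1)]]
  by (auto simp: fraction_field_def intro!: subfield_divide poly_over_mono)

lemma subfield_fraction_field:
  assumes R: "is_subring F"
  shows "is_subfield (fraction_field F t)"
  unfolding is_subfield_def is_subring_def
proof (intro conjI ballI)
  show "1 \<in> fraction_field F t"
    using subset_fraction_field[OF R] subring_one[OF R] by blast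
next
  fix a b
  assume a: "a \<in> fraction_field F t" and b: "b \<in> fraction_field F t"
  obtain p q where pq: "a = poly p t / poly q t" "poly_over F p" "poly_over F q"
    using a by (auto simp: fraction_field_def)
  obtain p' q' where pq': "b = poly p' t / poly q' t" "poly_over F p'" "poly_over F q'"
    using b by (auto simp: fraction_field_def)
  have "a * b = poly (p * p') t / poly (q * q') t"
    by (simp add: pq pq')
  then show "a * b \<in> fraction_field F t"
    using pq pq' R by (metis fraction_fieldI poly_over_mult)
  show "a - b \<in> fraction_field F t"
  proof (cases "poly q t = 0 \<or> poly q' t = 0")
    case True
    then show ?thesis
    proof
      assume "poly q t = 0"
      then have "a - b = poly (- p') t / poly q' t"
        by (simp add: pq pq')
      then show ?thesis
        using pq' R by (metis fraction_fieldI poly_over_uminus)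
    qed (use a pq' in simp)
  next
    case False
    then have "a - b = poly (p * q' - p' * q) t / poly (q * q') t"
      by (simp add: pq pq' diff_frac_eq)
    then show ?thesis
      using pq pq' R by (metis fraction_fieldI poly_over_mult poly_over_diff)
  qed
next
  fix a
  assume "a \<in> fraction_field F t"
  then obtain p q where pq: "a = poly p t / poly q t" "poly_over F p" "poly_over F q"
    by (auto simp: fraction_field_def)
  then have "inverse a = poly q t / poly p t"
    by simp
  then show "inverse a \<in> fraction_field F t"
    using pq by (metis fraction_fieldI)
qed

subsection \<open>Splitting\<close>

definition algebraically_closed_type :: "'a::field itself \<Rightarrow> bool"
  where "algebraically_closed_type _ \<longleftrightarrow> (\<forall>p::'a poly. degree p > 0 \<longrightarrow> (\<exists>z. poly p z = 0))"

lemma monic_splits: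
  fixes p :: "'a::field poly"
  assumes ac: "algebraically_closed_type TYPE('a)" and "lead_coeff p = 1"
  obtains xs where "p = (\<Prod>x\<leftarrow>xs. [:- x, 1:])" "length xs = degree p"
proof -
  have "\<exists>xs. p = (\<Prod>x\<leftarrow>xs. [:- x, 1:]) \<and> length xs = degree p"
    using assms(2)
  proof (induction "degree p" arbitrary: p)
    case 0
    then have "p = 1"
      by (metis degree_eq_zeroE lead_coeff_pCons(2) one_pCons)
    then show ?case
      by (intro exI[of _ "[]"]) auto
  next
    case (Suc n)
    then obtain z where "poly p z = 0"
      using ac by (metis algebraically_closed_type_def zero_less_Suc)
    then obtain q where q: "p = [:- z, 1:] * q"
      by (metis dvdE poly_eq_0_iff_dvd)
    then have "q \<noteq> 0"
      using Suc.prems by auto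
    then have "degree p = Suc (degree q)"
      unfolding q by (subst degree_mult_eq) auto
    moreover have "lead_coeff q = 1"
      using Suc.prems unfolding q lead_coeff_mult by simp
    ultimately obtain xs where "q = (\<Prod>x\<leftarrow>xs. [:- x, 1:])" "length xs = degree q"
      using Suc.hyps(1)[of q] Suc.hyps(2) by auto
    then show ?case
      using q \<open>degree p = Suc (degree q)\<close> by (intro exI[of _ "z # xs"]) auto
  qed
  then show ?thesis
    using that by blast
qed

lemma poly_prod_list: "poly (prod_list ps) x = (\<Prod>p\<leftarrow>ps. poly p x)"
  by (induction ps) auto

subsection \<open>Valuation rings\<close>

definition valuation_ring :: "'a::field set \<Rightarrow> bool"
  where "valuation_ring V \<longleftrightarrow> is_subring V \<and> (\<forall>y. y \<in> V \<or> inverse y \<in> V)"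

lemma valuation_ring_subring: "valuation_ring V \<Longrightarrow> is_subring V"
  by (simp add: valuation_ring_def)

lemma valuation_ring_inverse: "valuation_ring V \<Longrightarrow> y \<notin> V \<Longrightarrow> inverse y \<in> V"
  by (auto simp: valuation_ring_def)

text \<open>In \<open>valuation_ring_exists\<close>, the shortest such expressions in
  \<open>y\<close> and in \<open>inverse y\<close> are played off against each other.\<close>

lemma relation_of_min_length:
  assumes R: "is_subring V" and "z \<in> adjoin V y" "z \<notin> V"
  obtains a n where "z = (\<Sum>i\<le>n. a i * y ^ i)" "\<And>i. a i \<in> V" "n > 0"
    "\<And>b m. z = (\<Sum>i\<le>m. b i * y ^ i) \<Longrightarrow> (\<And>i. b i \<in> V) \<Longrightarrow> n \<le> m"
proof -
  define Q where "Q = (\<lambda>n. \<exists>a. z = (\<Sum>i\<le>n. a i * y ^ i) \<and> (\<forall>i. a i \<in> V))"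
  obtain g where "poly_over V g" "z = poly g y"
    using assms by (auto simp: adjoin_def)
  then have "Q (degree g)"
    unfolding Q_def poly_altdef using R by (auto intro!: exI[of _ "coeff g"] simp: poly_over_coeff)
  then obtain n where n: "Q n" "\<And>m. Q m \<Longrightarrow> n \<le> m"
    using ex_has_least_nat[of Q _ id] by auto
  then obtain a where a: "z = (\<Sum>i\<le>n. a i * y ^ i)" "\<forall>i. a i \<in> V"
    by (auto simp: Q_def)
  have "n > 0"
    using a assms(3) by (metis atMost_0 bot_nat_0.not_eq_extremum finite.emptyI mult.right_neutral
        power_0 sum.empty sum.insert_remove add.right_neutral Diff_cancel sum.atMost_Suc empty_iff sum.insert)
  then show ?thesis
    using that[of a n] a n(2) unfolding Q_def by blast
qed

text \<open>A subring maximal among those not containing \<open>1 / \<pi>\<close> is a valuation ring.\<close>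

lemma valuation_ring_exists:
  fixes A :: "'a::field set"
  assumes A: "is_subring A" "\<pi> \<in> A" "inverse \<pi> \<notin> A"
  obtains V where "valuation_ring V" "A \<subseteq> V" "inverse \<pi> \<notin> V"
proof -
  define \<A> where "\<A> = {V. is_subring V \<and> A \<subseteq> V \<and> inverse \<pi> \<notin> V}"
  have "\<Union>C \<in> \<A>" if "C \<noteq> {}" "subset.chain \<A> C" for C
  proof -
    have sub: "is_subring V" "A \<subseteq> V" "inverse \<pi> \<notin> V" if "V \<in> C" for V
      using that \<open>subset.chain \<A> C\<close> by (auto simp: \<A>_def subset.chain_def)
    obtain V0 where "V0 \<in> C"
      using \<open>C \<noteq> {}\<close> by blast
    have "x - y \<in> \<Union>C \<and> x * y \<in> \<Union>C" if xy: "x \<in> \<Union>C" "y \<in> \<Union>C" for x y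
    proof -
      obtain V W where VW: "V \<in> C" "x \<in> V" "W \<in> C" "y \<in> W"
        using xy by blast
      then have "V \<subseteq> W \<or> W \<subseteq> V"
        using \<open>subset.chain \<A> C\<close> by (auto simp: subset_chain_def)
      then obtain V where "V \<in> C" "x \<in> V" "y \<in> V"
        using VW by blast
      then show ?thesis
        using sub[of V] by (auto intro: subring_diff subring_mult)
    qed
    moreover have "1 \<in> \<Union>C"
      using \<open>V0 \<in> C\<close> sub subring_one by blast
    ultimately show ?thesis
      using sub \<open>V0 \<in> C\<close> unfolding \<A>_def is_subring_def by blast
  qed
  moreover have "\<A> \<noteq> {}"
    using A by (auto simp: \<A>_def)
  ultimately obtain V where V: "V \<in> \<A>" "\<forall>W\<in>\<A>. V \<subseteq> W \<longrightarrow> W = V"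
    using subset_Zorn_nonempty[of \<A>] by metis
  then have R: "is_subring V" and AV: "A \<subseteq> V" and inv: "inverse \<pi> \<notin> V"
    by (auto simp: \<A>_def)
  have \<pi>: "\<pi> \<noteq> 0" "\<pi> \<in> V"
    using inv AV A subring_zero[OF R] by auto
  \<comment> \<open>Maximality: adjoining any element outside \<open>V\<close> already produces
    \<open>1 / \<pi>\<close>.\<close>
  have grow: "inverse \<pi> \<in> adjoin V y" if "y \<notin> V" for y
  proof (rule ccontr)
    assume "inverse \<pi> \<notin> adjoin V y"
    then have "adjoin V y \<in> \<A>"
      using subring_adjoin[OF R] subset_adjoin[OF R] AV by (auto simp: \<A>_def)
    then show False
      using V subset_adjoin[OF R] self_in_adjoin[OF R] that by metis
  qed
  \<comment> \<open>Otherwise \<open>1 / \<pi>\<close> is a polynomial of some degree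
    \<open>n\<close> in \<open>1 / e\<close>, so \<open>e ^ n / \<pi>\<close> lies in
    \<open>V\<close>. Since \<open>e ^ n\<close> is \<open>1\<close> modulo \<open>\<pi>\<close>,
    this puts \<open>1 / \<pi>\<close> into \<open>V\<close>.\<close>
  have unit: "inverse (1 - \<pi> * b) \<in> V" if b: "b \<in> V" for b
  proof (rule ccontr)
    define e where "e = 1 - \<pi> * b"
    assume "inverse (1 - \<pi> * b) \<notin> V"
    then have "inverse \<pi> \<in> adjoin V (inverse e)"
      using grow by (simp add: e_def)
    then obtain a n where a: "inverse \<pi> = (\<Sum>i\<le>n. a i * inverse e ^ i)" "\<And>i. a i \<in> V"
      using relation_of_min_length[OF R _ inv] by metis
    have e: "e \<in> V"
      unfolding e_def using R \<pi> b by (intro subring_diff subring_mult subring_one)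
    have e0: "e \<noteq> 0"
      using \<open>inverse (1 - \<pi> * b) \<notin> V\<close> subring_zero[OF R] by (auto simp: e_def)
    have "e ^ n * inverse \<pi> = (\<Sum>i\<le>n. a i * e ^ (n - i))"
      unfolding a(1) sum_distrib_left
      using e0 by (intro sum.cong) (auto simp: power_diff field_simps power_inverse)
    then have 1: "e ^ n * inverse \<pi> \<in> V"
      using R a(2) e by (auto intro!: subring_sum subring_mult subring_power)
    have "\<exists>d\<in>V. e ^ m = 1 - \<pi> * d" for m
    proof (induction m)
      case 0
      then show ?case
        using subring_zero[OF R] by (intro bexI[of _ 0]) auto
    next
      case (Suc m)
      then obtain d where d: "d \<in> V" "e ^ m = 1 - \<pi> * d"
        by blast
      have "e ^ Suc m = 1 - \<pi> * (b + d - \<pi> * b * d)"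
        unfolding power_Suc d(2) by (simp add: e_def algebra_simps)
      then show ?case
        using R b \<pi> d(1) by (blast intro: subring_add subring_diff subring_mult)
    qed
    then obtain d where d: "d \<in> V" "e ^ n = 1 - \<pi> * d"
      by blast
    have "inverse \<pi> = e ^ n * inverse \<pi> + d"
      using d \<pi> by (simp add: field_simps)
    then show False
      using 1 d R inv by (metis subring_add)
  qed
  \<comment> \<open>Multiplied by \<open>y ^ n\<close>, the relation in \<open>1 / y\<close>
    expresses \<open>y ^ n\<close> through lower powers, because \<open>1 - \<pi> * b 0\<close> is a
    unit. This shortens the relation in \<open>y\<close>. For \<open>m > n\<close>, the roles of
    \<open>y\<close> and \<open>1 / y\<close> are exchanged below.\<close>
  have key: False
    if y: "y \<notin> V" "y \<noteq> 0" and rel: "inverse \<pi> = (\<Sum>i\<le>n. a i * y ^ i)" "\<And>i. a i \<in> V" "n > 0"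
      and least: "\<And>b m. inverse \<pi> = (\<Sum>i\<le>m. b i * y ^ i) \<Longrightarrow> (\<And>i. b i \<in> V) \<Longrightarrow> n \<le> m"
      and rel': "inverse \<pi> = (\<Sum>i\<le>m. b i * inverse y ^ i)" "\<And>i. b i \<in> V" "0 < m" "m \<le> n"
    for y n m a b
  proof -
    define e where "e = 1 - \<pi> * b 0"
    have e0: "e \<noteq> 0"
    proof
      assume "e = 0"
      then have "inverse \<pi> = b 0"
        using \<pi> unfolding e_def by (simp add: inverse_unique)
      then show False
        using rel'(2) inv by metis
    qed
    have "1 = \<pi> * (\<Sum>i\<le>m. b i * inverse y ^ i)"
      using rel'(1) \<pi> by (metis right_inverse)
    also have "\<dots> = \<pi> * b 0 + \<pi> * (\<Sum>i=1..m. b i * inverse y ^ i)"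
      by (simp add: sum.remove[of "{..m}" 0] atLeast1_atMost_eq_remove0 distrib_left del: sum.atMost_Suc)
    finally have "e = \<pi> * (\<Sum>i=1..m. b i * inverse y ^ i)"
      by (simp add: e_def algebra_simps)
    then have "e * y ^ n = (\<Sum>i=1..m. \<pi> * (b i * inverse y ^ i) * y ^ n)"
      by (simp add: sum_distrib_left sum_distrib_right)
    also have "\<dots> = (\<Sum>i=1..m. \<pi> * b i * y ^ (n - i))"
      using y(2) rel'(4) by (intro sum.cong) (auto simp: power_diff field_simps power_inverse)
    finally have "e * y ^ n = (\<Sum>i=1..m. \<pi> * b i * y ^ (n - i))" .
    then have yn: "y ^ n = (\<Sum>i=1..m. inverse e * \<pi> * b i * y ^ (n - i))"
      using e0 by (simp add: field_simps sum_distrib_left[symmetric] sum_divide_distrib[symmetric])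
    define c where "c = (\<lambda>j. if n - m \<le> j then inverse e * \<pi> * b (n - j) else 0)"
    have c: "c j \<in> V" for j
      unfolding c_def e_def using R \<pi> rel'(2) unit by (auto intro!: subring_mult subring_zero)
    have "y ^ n = (\<Sum>j\<in>{n-m..n-1}. inverse e * \<pi> * b (n - j) * y ^ j)"
      unfolding yn using rel'(3,4)
      by (intro sum.reindex_bij_witness[of _ "\<lambda>j. n - j" "\<lambda>i. n - i"]) auto
    also have "\<dots> = (\<Sum>j\<le>n-1. c j * y ^ j)"
      by (intro sum.mono_neutral_cong_left) (auto simp: c_def)
    finally have yn': "y ^ n = (\<Sum>j\<le>n-1. c j * y ^ j)" .
    have "inverse \<pi> = (\<Sum>i\<le>n-1. a i * y ^ i) + a n * y ^ n"
      unfolding rel(1) using rel(3) by (cases n) auto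
    also have "\<dots> = (\<Sum>i\<le>n-1. (a i + a n * c i) * y ^ i)"
      unfolding yn' by (simp add: sum.distrib sum_distrib_left algebra_simps)
    finally have "n \<le> n - 1"
      using least[of "\<lambda>i. a i + a n * c i" "n - 1"] R rel(2) c
      by (auto intro: subring_add subring_mult)
    then show False
      using rel(3) by simp
  qed
  have "y \<in> V \<or> inverse y \<in> V" for y
  proof (rule ccontr)
    assume "\<not> ?thesis"
    then have y: "y \<notin> V" "inverse y \<notin> V"
      by auto
    then have y0: "y \<noteq> 0"
      using subring_zero[OF R] by auto
    obtain a n where 1: "inverse \<pi> = (\<Sum>i\<le>n. a i * y ^ i)" "\<And>i. a i \<in> V" "n > 0"
      "\<And>b m. inverse \<pi> = (\<Sum>i\<le>m. b i * y ^ i) \<Longrightarrow> (\<And>i. b i \<in> V) \<Longrightarrow> n \<le> m"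
      using relation_of_min_length[OF R grow[OF y(1)] inv] by blast
    obtain b m where 2: "inverse \<pi> = (\<Sum>i\<le>m. b i * inverse y ^ i)" "\<And>i. b i \<in> V" "m > 0"
      "\<And>c l. inverse \<pi> = (\<Sum>i\<le>l. c i * inverse y ^ i) \<Longrightarrow> (\<And>i. c i \<in> V) \<Longrightarrow> m \<le> l"
      using relation_of_min_length[OF R grow[OF y(2)] inv] by blast
    show False
    proof (cases "m \<le> n")
      case True
      then show ?thesis
        using key[of y a n b m] y y0 1 2 by blast
    next
      case False
      then show ?thesis
        using key[of "inverse y" b m a n] y y0 1 2 by simp
    qed
  qed
  then have "valuation_ring V"
    using R by (auto simp: valuation_ring_def)
  then show ?thesis
    using that AV inv by blast
qed

context
  fixes V :: "'a::field set"
  assumes V: "valuation_ring V"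
begin

text \<open>Dividing the equation by \<open>y ^ (n - 1)\<close> writes \<open>y\<close> as a
  polynomial in \<open>1 / y\<close>, which lies in \<open>V\<close> if \<open>y\<close> does
  not.\<close>

lemma valuation_ring_integrally_closed:
  assumes p: "poly_over V p" "lead_coeff p = 1" "poly p y = 0"
  shows "y \<in> V"
proof (rule ccontr)
  note R = valuation_ring_subring[OF V]
  assume y: "y \<notin> V"
  then have inv: "inverse y \<in> V" and y0: "y \<noteq> 0"
    using valuation_ring_inverse[OF V] subring_zero[OF R] by auto
  define n where "n = degree p"
  have "n > 0"
    using p(2,3) unfolding n_def by (metis degree_eq_zeroE lead_coeff_pCons(2) neq0_conv poly_const_conv zero_neq_one)
  have "0 = (\<Sum>i<n. coeff p i * y ^ i) + y ^ n"
    using p(2,3) unfolding poly_altdef n_def by (simp add: lessThan_Suc_atMost[symmetric])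
  then have "y ^ n = - (\<Sum>i<n. coeff p i * y ^ i)"
    by (metis add.commute eq_neg_iff_add_eq_0)
  then have "y = - (\<Sum>i<n. coeff p i * y ^ i) * inverse y ^ (n - 1)"
    using y0 \<open>n > 0\<close> by (cases n) (auto simp: field_simps power_inverse)
  also have "\<dots> = - (\<Sum>i<n. coeff p i * inverse y ^ (n - 1 - i))"
  proof -
    have "y ^ i * inverse y ^ (n - 1) = inverse y ^ (n - 1 - i)" if "i < n" for i
    proof -
      have "inverse y ^ (n - 1) = inverse y ^ i * inverse y ^ (n - 1 - i)"
        using that by (simp flip: power_add)
      then show ?thesis
        using y0 by (simp add: power_inverse)
    qed
    then show ?thesis
      by (simp add: sum_distrib_right mult.assoc)
  qed
  also have "\<dots> \<in> V"
    using R inv p(1) by (intro subring_uminus subring_sum subring_mult subring_power) (auto simp: poly_over_coeff)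
  finally show False
    using y by simp
qed

text \<open>The coefficients of \<open>q\<close> can be recovered from those of the product
  downwards, by multiplying with \<open>t\<close>, or upwards, by multiplying with
  \<open>1 / t\<close>. One of \<open>t\<close> and \<open>1 / t\<close> lies in
  \<open>V\<close>.\<close>

lemma valuation_ring_linear_factor:
  assumes Q: "poly_over V (q * [:- t, 1:])"
  shows "poly_over V q"
proof -
  note R = valuation_ring_subring[OF V]
  define Q where "Q = q * [:- t, 1:]"
  have Q0: "coeff Q 0 = - t * coeff q 0" and QS: "coeff Q (Suc i) = coeff q i - t * coeff q (Suc i)" for i
    by (auto simp: Q_def coeff_pCons)
  have QV: "coeff Q i \<in> V" for i
    using poly_over_coeff[OF R Q] by (simp only: Q_def)
  show ?thesis
  proof (cases "t \<in> V")
    case True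
    have "coeff q (degree q + 1 - j) \<in> V" for j
    proof (induction j)
      case 0
      then show ?case
        using subring_zero[OF R] by (simp add: coeff_eq_0)
    next
      case (Suc j)
      show ?case
      proof (cases "j \<le> degree q")
        case True
        then have "coeff q (degree q + 1 - Suc j) =
            coeff Q (degree q + 1 - j) + t * coeff q (degree q + 1 - j)"
          using QS[of "degree q - j"] by (simp add: Suc_diff_le)
        then show ?thesis
          using Suc QV \<open>t \<in> V\<close> R by (auto intro: subring_add subring_mult)
      qed (use Suc in simp)
    qed
    then have "coeff q i \<in> V" for i
      using subring_zero[OF R]
      by (cases "i \<le> degree q") (metis diff_diff_cancel le_add1 le_trans, simp add: coeff_eq_0)
    then show ?thesis
      by (simp add: poly_over_iff R)
  next
    case False
    then have inv: "inverse t \<in> V" "t \<noteq> 0"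
      using valuation_ring_inverse[OF V] subring_zero[OF R] by auto
    have "coeff q i \<in> V" for i
    proof (induction i)
      case 0
      have "coeff q 0 = - (inverse t * coeff Q 0)"
        using Q0 inv by simp
      then show ?case
        using QV inv R by (metis subring_uminus subring_mult)
    next
      case (Suc i)
      have "coeff q (Suc i) = inverse t * (coeff q i - coeff Q (Suc i))"
        using QS[of i] inv by simp
      then show ?case
        using Suc QV inv R by (metis subring_diff subring_mult)
    qed
    then show ?thesis
      by (simp add: poly_over_iff R)
  qed
qed

text \<open>A form of Gauss's lemma: the monic factor may itself have coefficients outside
  \<open>V\<close>. Its linear factors are stripped off one at a time.\<close>

lemma valuation_ring_monic_factor:
  assumes ac: "algebraically_closed_type TYPE('a)"
    and Q: "poly_over V (q * r)" "lead_coeff r = 1"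
  shows "poly_over V q"
proof -
  obtain xs where "r = (\<Prod>x\<leftarrow>xs. [:- x, 1:])"
    using monic_splits[OF ac Q(2)] .
  moreover have "poly_over V (q * (\<Prod>x\<leftarrow>xs. [:- x, 1:])) \<Longrightarrow> poly_over V q" for xs
  proof (induction xs arbitrary: q)
    case (Cons x xs)
    have "q * (\<Prod>x\<leftarrow>x # xs. [:- x, 1:]) = q * [:- x, 1:] * (\<Prod>x\<leftarrow>xs. [:- x, 1:])"
      by (simp only: list.map prod_list.Cons mult.assoc)
    then show ?case
      using Cons valuation_ring_linear_factor by metis
  qed simp
  ultimately show ?thesis
    using Q by blast
qed

end

subsection \<open>Homomorphisms on a subfield\<close>

text \<open>A total function of which only the restriction to \<open>F\<close> matters. Fixing
  \<open>1\<close> excludes the zero map, and differences give sums, negatives and \<open>0\<close>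
  at once.\<close>

definition hom_on :: "'a::field set \<Rightarrow> ('a \<Rightarrow> 'a) \<Rightarrow> bool"
  where "hom_on F \<theta> \<longleftrightarrow> \<theta> 1 = 1 \<and>
    (\<forall>x\<in>F. \<forall>y\<in>F. \<theta> (x - y) = \<theta> x - \<theta> y \<and> \<theta> (x * y) = \<theta> x * \<theta> y)"

context
  fixes F :: "'a::field set" and \<theta> :: "'a \<Rightarrow> 'a"
  assumes F: "is_subfield F" and \<theta>: "hom_on F \<theta>"
begin

lemma hom_on_1: "\<theta> 1 = 1"
  and hom_on_diff: "x \<in> F \<Longrightarrow> y \<in> F \<Longrightarrow> \<theta> (x - y) = \<theta> x - \<theta> y"
  and hom_on_mult: "x \<in> F \<Longrightarrow> y \<in> F \<Longrightarrow> \<theta> (x * y) = \<theta> x * \<theta> y"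
  using \<theta> by (auto simp: hom_on_def)

lemma hom_on_0: "\<theta> 0 = 0"
  using hom_on_diff[of 1 1] subring_one[OF subfield_subring[OF F]] by simp

lemma hom_on_uminus: "x \<in> F \<Longrightarrow> \<theta> (- x) = - \<theta> x"
  using hom_on_diff[of 0 x] subring_zero[OF subfield_subring[OF F]] hom_on_0 by simp

lemma hom_on_add: "x \<in> F \<Longrightarrow> y \<in> F \<Longrightarrow> \<theta> (x + y) = \<theta> x + \<theta> y"
  using hom_on_diff[of x "- y"] hom_on_uminus[of y] subring_uminus[OF subfield_subring[OF F]] by simp

lemma hom_on_power: "x \<in> F \<Longrightarrow> \<theta> (x ^ n) = \<theta> x ^ n"
  by (induction n) (auto simp: hom_on_1 hom_on_mult subring_power[OF subfield_subring[OF F]])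

lemma hom_on_sum: "(\<And>i. i \<in> I \<Longrightarrow> f i \<in> F) \<Longrightarrow> \<theta> (sum f I) = (\<Sum>i\<in>I. \<theta> (f i))"
  by (induction I rule: infinite_finite_induct)
    (auto simp: hom_on_0 hom_on_add subring_sum[OF subfield_subring[OF F]])

lemma hom_on_inverse: "x \<in> F \<Longrightarrow> \<theta> (inverse x) = inverse (\<theta> x)"
proof (cases "x = 0")
  case False
  assume "x \<in> F"
  then have "\<theta> x * \<theta> (inverse x) = \<theta> (x * inverse x)"
    by (simp add: hom_on_mult subfield_inverse[OF F])
  then show ?thesis
    using False hom_on_1 by (simp add: inverse_unique)
qed (simp add: hom_on_0)

lemma hom_on_eq_0: "x \<in> F \<Longrightarrow> \<theta> x = 0 \<longleftrightarrow> x = 0"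
  using hom_on_0 hom_on_1 hom_on_mult[of x "inverse x"] subfield_inverse[OF F, of x]
  by (cases "x = 0") auto

lemma coeff_map_hom: "coeff (map_poly \<theta> p) i = \<theta> (coeff p i)"
  by (simp add: coeff_map_poly hom_on_0)

lemma map_hom_add: "poly_over F p \<Longrightarrow> poly_over F q \<Longrightarrow> map_poly \<theta> (p + q) = map_poly \<theta> p + map_poly \<theta> q"
  and map_hom_diff: "poly_over F p \<Longrightarrow> poly_over F q \<Longrightarrow> map_poly \<theta> (p - q) = map_poly \<theta> p - map_poly \<theta> q"
  by (auto intro!: poly_eqI simp: coeff_map_hom hom_on_add hom_on_diff
      poly_over_coeff[OF subfield_subring[OF F]])

lemma map_hom_mult: "poly_over F p \<Longrightarrow> poly_over F q \<Longrightarrow> map_poly \<theta> (p * q) = map_poly \<theta> p * map_poly \<theta> q"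
  using subfield_subring[OF F]
  by (intro poly_eqI) (simp add: coeff_map_hom coeff_mult hom_on_sum hom_on_mult poly_over_coeff subring_mult)

lemma poly_map_hom: "poly_over F p \<Longrightarrow> x \<in> F \<Longrightarrow> poly (map_poly \<theta> p) (\<theta> x) = \<theta> (poly p x)"
proof (induction p)
  case (pCons a p)
  then have "a \<in> F" "poly_over F p"
    using subfield_subring[OF F] by (auto simp: poly_over_pCons_iff)
  then show ?case
    using pCons subfield_subring[OF F]
    by (simp add: map_poly_pCons hom_on_0 hom_on_add hom_on_mult subring_mult poly_in_subring)
qed (simp add: hom_on_0)

lemma degree_map_hom: "poly_over F p \<Longrightarrow> degree (map_poly \<theta> p) = degree p"
  using hom_on_eq_0 subfield_subring[OF F]
  by (metis degree_map_poly map_poly_degree_eq hom_on_0 poly_over_coeff degree_0 map_poly_0 leading_coeff_0_iff)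

lemma map_hom_eq_0: "poly_over F p \<Longrightarrow> map_poly \<theta> p = 0 \<longleftrightarrow> p = 0"
  using hom_on_eq_0 subfield_subring[OF F]
  by (metis coeff_map_hom poly_over_coeff coeff_0 leading_coeff_0_iff map_poly_0)

end

lemma hom_on_id: "hom_on F (\<lambda>x. x)"
  by (simp add: hom_on_def)

section \<open>Resultants as products over roots, and descent of coefficients\<close>

lemma prod_roots_commute:
  fixes xs zs :: "'a::field list"
  shows "(\<Prod>x\<leftarrow>xs. \<Prod>z\<leftarrow>zs. (x - z)) = (- 1) ^ (length xs * length zs) * (\<Prod>z\<leftarrow>zs. \<Prod>x\<leftarrow>xs. (z - x))"
proof (induction xs)
  case Nil
  have "(\<Prod>z\<leftarrow>zs. 1 :: 'a) = 1"
    by (induction zs) auto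
  then show ?case
    by simp
next
  case (Cons a xs)
  have "(\<Prod>z\<leftarrow>zs. a - z) = (- 1) ^ length zs * (\<Prod>z\<leftarrow>zs. z - a)"
    by (induction zs) (auto simp: algebra_simps)
  moreover have "(\<Prod>z\<leftarrow>zs. (z - a) * f z) = (\<Prod>z\<leftarrow>zs. z - a) * (\<Prod>z\<leftarrow>zs. f z)" for f
    by (induction zs) (auto simp: algebra_simps)
  ultimately show ?case
    using Cons by (simp add: power_add algebra_simps)
qed

lemma poly_prod_linear: "poly (\<Prod>x\<leftarrow>xs. [:- x, 1:]) z = (\<Prod>x\<leftarrow>xs. z - x)" for z :: "'a::field"
  by (induction xs) (auto simp: algebra_simps)

lemma prod_list_mult_const: "(\<Prod>x\<leftarrow>xs. c * f x) = c ^ length xs * (\<Prod>x\<leftarrow>xs. f x)"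
  for c :: "'a::comm_monoid_mult"
  by (induction xs) (auto simp: ac_simps)

lemma monic_prod_linear: "lead_coeff (\<Prod>x\<leftarrow>xs. [:- x, 1:]) = (1 :: 'a::field)"
  by (induction xs) (simp_all only: list.map prod_list.Cons lead_coeff_mult, simp_all)

lemma degree_prod_linear: "degree (\<Prod>x\<leftarrow>xs. [:- x, 1 :: 'a::field:]) = length xs"
proof (induction xs)
  case (Cons x xs)
  have "(\<Prod>x\<leftarrow>xs. [:- x, 1:]) \<noteq> 0"
    using monic_prod_linear[of xs] by auto
  then have "degree ([:- x, 1:] * (\<Prod>x\<leftarrow>xs. [:- x, 1:])) = Suc (length xs)"
    using Cons by (subst degree_mult_eq) auto
  then show ?case
    by (simp only: list.map prod_list.Cons list.size)
qed simp

text \<open>Swapping the two polynomials and reducing modulo one of them, as in the computation of a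
  resultant by Euclid's algorithm, keeps everything in \<open>F\<close>.\<close>

lemma norm_in_subfield:
  fixes F :: "'a::field set"
  assumes ac: "algebraically_closed_type TYPE('a)" and F: "is_subfield F" and \<theta>: "hom_on F \<theta>"
    and W: "poly_over F W" and P: "poly_over F P" "P \<noteq> 0"
    and xs: "P = smult c (\<Prod>x\<leftarrow>xs. [:- x, 1:])"
    and ys: "map_poly \<theta> P = smult (\<theta> c) (\<Prod>y\<leftarrow>ys. [:- y, 1:])"
  shows "(\<Prod>x\<leftarrow>xs. poly W x) \<in> F \<and>
    \<theta> (\<Prod>x\<leftarrow>xs. poly W x) = (\<Prod>y\<leftarrow>ys. poly (map_poly \<theta> W) y)"
  using W P xs ys
proof (induction "degree W" arbitrary: W P c xs ys rule: less_induct)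
  case less
  note R = subfield_subring[OF F] and h = F \<theta>
  have c0: "c \<noteq> 0" 
    using less.prems by auto
  have lead: "lead_coeff P = c"
    using less.prems(4) monic_prod_linear[of xs] by simp
  then have cF: "c \<in> F"
    using less.prems(2) R poly_over_coeff by blast
  have \<theta>c: "\<theta> c \<noteq> 0"
    using hom_on_eq_0[OF h cF] c0 by simp
  have len: "length ys = length xs"
    using less.prems(4,5) c0 \<theta>c degree_map_hom[OF h less.prems(2)]
    by (simp add: degree_prod_linear)
  show ?case
  proof (cases "degree W = 0")
    case True
    then obtain w where w: "W = [:w:]"
      using degree_eq_zeroE by blast
    have wF: "w \<in> F"
      using less.prems(1) R unfolding w by (simp add: poly_over_pCons_iff)
    have "(\<Prod>x\<leftarrow>xs. poly W x) = w ^ length xs"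
      by (simp add: w prod_list_replicate map_replicate_const)
    moreover have "map_poly \<theta> W = [:\<theta> w:]"
      by (simp add: w map_poly_pCons hom_on_0[OF h])
    moreover have "prod_list (map (poly [:a:]) ys) = a ^ length ys" for a
      by (induction ys) auto
    ultimately show ?thesis
      using wF R len by (auto intro: subring_power simp: hom_on_power[OF h])
  next
    case False
    then have W0: "W \<noteq> 0"
      by auto
    define b where "b = lead_coeff W"
    have b: "b \<in> F" "b \<noteq> 0" "\<theta> b \<noteq> 0"
      using less.prems(1) R W0 hom_on_eq_0[OF h] by (auto simp: b_def poly_over_coeff)
    obtain h r where hr: "poly_over F h" "poly_over F r" "P = W * h + r" "r = 0 \<or> degree r < degree W"
      using poly_over_division[OF F less.prems(1) W0 less.prems(2)] by blast
    have deg_r: "degree r < degree W"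
      using hr False by auto
    have "lead_coeff (smult (inverse b) W) = 1"
      using b by (simp add: b_def)
    then obtain zs where "smult (inverse b) W = (\<Prod>z\<leftarrow>zs. [:- z, 1:])"
      using monic_splits[OF ac] by metis
    then have zs: "W = smult b (\<Prod>z\<leftarrow>zs. [:- z, 1:])"
      using b by (metis right_inverse smult_1_left smult_smult)
    define W' where "W' = map_poly \<theta> W"
    have "lead_coeff W' = \<theta> b"
      unfolding W'_def b_def using degree_map_hom[OF F \<theta> less.prems(1)] coeff_map_hom[OF F \<theta>] by metis
    then have "lead_coeff (smult (inverse (\<theta> b)) W') = 1"
      using b by simp
    then obtain zs' where "smult (inverse (\<theta> b)) W' = (\<Prod>z\<leftarrow>zs'. [:- z, 1:])"
      using monic_splits[OF ac] by metis
    then have zs': "W' = smult (\<theta> b) (\<Prod>z\<leftarrow>zs'. [:- z, 1:])"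
      using b by (metis right_inverse smult_1_left smult_smult)
    have len': "length zs' = length zs"
      using zs zs' b degree_map_hom[OF F \<theta> less.prems(1)]
      by (metis W'_def degree_prod_linear degree_smult_eq)
    \<comment> \<open>Here the roles are exchanged: the remainder \<open>r\<close>, of smaller
      degree than \<open>W\<close>, is evaluated at the roots of \<open>W\<close>.\<close>
    have IH: "(\<Prod>z\<leftarrow>zs. poly r z) \<in> F"
      "\<theta> (\<Prod>z\<leftarrow>zs. poly r z) = (\<Prod>z\<leftarrow>zs'. poly (map_poly \<theta> r) z)"
      using less.hyps[OF deg_r hr(2) less.prems(1) W0 zs] zs' unfolding W'_def by blast+
    have swap: "(\<Prod>x\<leftarrow>as. poly A x) = a ^ length as * (- 1) ^ (length as * length bs) *
        inverse d ^ length bs * (\<Prod>z\<leftarrow>bs. poly B z)"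
      if "A = smult a (\<Prod>z\<leftarrow>bs. [:- z, 1:])" "B = smult d (\<Prod>x\<leftarrow>as. [:- x, 1:])" "d \<noteq> 0"
      for A B :: "'a poly" and a d as bs
    proof -
      have "(\<Prod>z\<leftarrow>bs. poly B z) = d ^ length bs * (\<Prod>z\<leftarrow>bs. \<Prod>x\<leftarrow>as. z - x)"
        by (simp add: that(2) poly_prod_linear prod_list_mult_const)
      moreover have "(\<Prod>x\<leftarrow>as. poly A x) = a ^ length as * (\<Prod>x\<leftarrow>as. \<Prod>z\<leftarrow>bs. x - z)"
        by (simp add: that(1) poly_prod_linear prod_list_mult_const)
      moreover have "((- 1) ^ n :: 'a) * (- 1) ^ n = 1" for n
        by (metis minus_one_mult_self)
      moreover have "inverse d ^ n * d ^ n = 1" for n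
        using that(3) by (simp add: power_inverse)
      ultimately show ?thesis
        by (simp add: prod_roots_commute[of as bs] ac_simps)
    qed
    \<comment> \<open>Reduction modulo \<open>A\<close> does not change the values at the roots of
      \<open>A\<close>.\<close>
    have cong: "(\<Prod>z\<leftarrow>bs. poly B z) = (\<Prod>z\<leftarrow>bs. poly C z)"
      if "A = smult a (\<Prod>z\<leftarrow>bs. [:- z, 1:])" "B = A * H + C"
      for A B C H :: "'a poly" and a bs
    proof -
      have "poly A z = 0" if "z \<in> set bs" for z
        using that \<open>A = _\<close> by (auto simp: poly_prod_linear prod_list_zero_iff)
      then show ?thesis
        using that by (intro arg_cong[of _ _ prod_list] map_cong) auto
    qed
    have 1: "(\<Prod>x\<leftarrow>xs. poly W x) = b ^ length xs * (- 1) ^ (length xs * length zs) *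
        inverse c ^ length zs * (\<Prod>z\<leftarrow>zs. poly r z)"
      using swap[OF zs less.prems(4) c0] cong[OF zs hr(3)] by simp
    have "map_poly \<theta> P = W' * map_poly \<theta> h + map_poly \<theta> r"
      unfolding hr(3) W'_def using hr less.prems(1) R
      by (simp add: map_hom_add[OF F \<theta>] map_hom_mult[OF F \<theta>] poly_over_mult)
    then have 2: "(\<Prod>y\<leftarrow>ys. poly W' y) = \<theta> b ^ length ys * (- 1) ^ (length ys * length zs') *
        inverse (\<theta> c) ^ length zs' * (\<Prod>z\<leftarrow>zs'. poly (map_poly \<theta> r) z)"
      using swap[OF zs' less.prems(5) \<theta>c] cong[OF zs'] by simp
    have mem: "b ^ length xs \<in> F" "(- 1) ^ (length xs * length zs) \<in> F" "inverse c ^ length zs \<in> F"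
      using b cF R by (auto intro!: subring_power subring_uminus subring_one subfield_inverse[OF F])
    have "\<theta> ((- 1) ^ n) = (- 1) ^ n" for n
      using hom_on_power[OF F \<theta>, of "- 1" n] hom_on_uminus[OF F \<theta>, of 1] hom_on_1[OF F \<theta>]
        subring_one[OF R] subring_uminus[OF R] by simp
    then show ?thesis
      unfolding 1 2[unfolded W'_def] using mem IH R len len' b cF
      by (simp add: subring_mult hom_on_mult[OF F \<theta>] hom_on_power[OF F \<theta>] hom_on_inverse[OF F \<theta>]
          subfield_inverse[OF F])
  qed
qed

text \<open>Norms are computed for one constant \<open>c\<close> at a time. Infinitely many values
  at points fixed by \<open>\<theta>\<close> determine a polynomial together with its image; the
  proof divides by \<open>z - c\<close> repeatedly.\<close>

lemma interpolation_over:
  fixes F :: "'a::field set"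
  assumes F: "is_subfield F" and \<theta>: "hom_on F \<theta>"
    and S: "infinite S" "S \<subseteq> F" "\<And>c. c \<in> S \<Longrightarrow> \<theta> c = c"
    and p: "\<And>c. c \<in> S \<Longrightarrow> poly p c \<in> F \<and> \<theta> (poly p c) = poly p' c"
  shows "poly_over F p \<and> map_poly \<theta> p = p'"
  using S p
proof (induction "max (degree p) (degree p')" arbitrary: S p p' rule: less_induct)
  case less
  note R = subfield_subring[OF F]
  obtain c where c: "c \<in> S"
    using infinite_imp_nonempty[OF less.prems(1)] by blast
  define a where "a = poly p c"
  define q where "q = synthetic_div p c"
  define q' where "q' = synthetic_div p' c"
  have a: "a \<in> F" "\<theta> a = poly p' c"
    using less.prems(4)[OF c] by (auto simp: a_def)
  have cF: "c \<in> F" "\<theta> c = c"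
    using c less.prems by auto
  have pq: "p = [:- c, 1:] * q + [:a:]" "p' = [:- c, 1:] * q' + [:\<theta> a:]"
    using synthetic_div_correct'[of c p] synthetic_div_correct'[of c p'] a
    by (simp_all add: q_def q'_def a_def)
  have val: "poly q y \<in> F \<and> \<theta> (poly q y) = poly q' y" if "y \<in> S - {c}" for y
  proof -
    have y: "y \<in> F" "\<theta> y = y" "y \<noteq> c"
      using that less.prems by auto
    have 1: "poly q y = (poly p y - a) * inverse (y - c)"
      using y by (simp add: pq(1) field_simps)
    have 2: "poly q' y = (poly p' y - \<theta> a) * inverse (y - c)"
      using y by (simp add: pq(2) field_simps)
    have 3: "poly p y \<in> F" "\<theta> (poly p y) = poly p' y"
      using that less.prems(4) by auto
    have 4: "y - c \<in> F" "\<theta> (y - c) = y - c"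
      using y cF R by (auto simp: hom_on_diff[OF F \<theta>] intro: subring_diff)
    show ?thesis
      unfolding 1 2 using 3 4 a R
      by (auto simp: hom_on_mult[OF F \<theta>] hom_on_diff[OF F \<theta>] hom_on_inverse[OF F \<theta>]
          subring_diff subring_mult subfield_inverse[OF F])
  qed
  show ?case
  proof (cases "max (degree p) (degree p') = 0")
    case True
    then have "p = [:a:]" "p' = [:\<theta> a:]"
      using a by (auto simp: a_def elim!: degree_eq_zeroE)
    then show ?thesis
      using a R by (auto simp: map_poly_pCons hom_on_0[OF F \<theta>] intro: poly_over_const)
  next
    case False
    then have "max (degree q) (degree q') < max (degree p) (degree p')"
      unfolding q_def q'_def degree_synthetic_div by linarith
    moreover have "infinite (S - {c})"
      using less.prems(1) by simp
    ultimately have "poly_over F q \<and> map_poly \<theta> q = q'"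
      using less.hyps[of q q' "S - {c}"] less.prems val by blast
    moreover have "poly_over F [:- c, 1:]" "poly_over F [:a:]"
      using R a cF by (auto intro: poly_over_linear poly_over_const)
    moreover have "map_poly \<theta> [:- c, 1:] = [:- c, 1:]" "map_poly \<theta> [:a:] = [:\<theta> a:]"
      using cF by (simp_all add: map_poly_pCons hom_on_0[OF F \<theta>] hom_on_1[OF F \<theta>] hom_on_uminus[OF F \<theta>])
    moreover note R
    ultimately have "poly_over F p" "map_poly \<theta> p = [:- c, 1:] * q' + [:\<theta> a:]"
      unfolding pq(1) by (simp_all only: map_hom_add[OF F \<theta>] map_hom_mult[OF F \<theta>] poly_over_mult poly_over_add)
    then show ?thesis
      using pq(2) by simp
  qed
qed

subsection \<open>The rational function field and its places\<close>

text \<open>As \<open>k\<close> is algebraically closed in the ambient type, every element outside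
  \<open>k\<close> is transcendental over it. The theorem uses this with the algebraic closure of
  its field \<open>k\<close>.\<close>

locale function_field =
  fixes k :: "'a::field set" and s :: 'a
  assumes ac: "algebraically_closed_type TYPE('a)"
    and k: "is_subfield k"
    and k_closed: "algebraic_over k y \<Longrightarrow> y \<in> k"
    and s: "s \<notin> k"
begin

abbreviation F where "F \<equiv> fraction_field k s"

lemma k_ring: "is_subring k"
  using k by (rule subfield_subring)

lemma F: "is_subfield F"
  using k_ring by (rule subfield_fraction_field)

lemma F_ring: "is_subring F"
  using F by (rule subfield_subring)

lemma k_subset_F: "k \<subseteq> F" and s_in_F: "s \<in> F"
  using k_ring by (auto simp: self_in_fraction_field dest: subset_fraction_field)

lemma transcendental_not_in: "t \<notin> k \<Longrightarrow> poly_over k p \<Longrightarrow> poly p t = 0 \<Longrightarrow> p = 0"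
  using k_closed unfolding algebraic_over_def by blast

lemma s_nonzero: "s \<noteq> 0"
  using s subring_zero[OF k_ring] by auto

lemma s_power_notin: "n > 0 \<Longrightarrow> s ^ n \<notin> k"
proof
  assume n: "n > 0" and "s ^ n \<in> k"
  then have "poly_over k (monom 1 n - [:s ^ n:])"
    using k_ring by (intro poly_over_diff poly_over_monom poly_over_const subring_one) auto
  moreover have "poly (monom 1 n - [:s ^ n:]) s = 0"
    by (simp add: poly_monom)
  ultimately have "monom 1 n - [:s ^ n:] = 0"
    using transcendental_not_in[OF s] by blast
  then have "coeff (monom 1 n - [:s ^ n:]) n = 0"
    by simp
  then show False
    using n by (simp add: coeff_pCons split: nat.splits)
qed

lemma infinite_k: "infinite k"
proof
  assume fin: "finite k"
  define p where "p = (\<Prod>c\<in>k. [:- c, 1:]) + 1"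
  have "poly_over k p"
    unfolding p_def using k_ring by (intro poly_over_add poly_over_prod poly_over_1 poly_over_linear)
  have deg: "degree (\<Prod>c\<in>k. [:- c, 1:]) = card k"
    by (subst degree_prod_eq_sum_degree) auto
  moreover have "card k > 0"
    using fin subring_one[OF k_ring] by (auto simp: card_gt_0_iff)
  ultimately have "degree p > 0"
    unfolding p_def by (simp add: degree_add_eq_left)
  then obtain y where y: "poly p y = 0"
    using ac by (auto simp: algebraically_closed_type_def)
  have "p \<noteq> 0"
    using \<open>degree p > 0\<close> by auto
  then have "y \<in> k"
    using \<open>poly_over k p\<close> y k_closed by (auto simp: algebraic_over_def)
  then have "poly p y = 1"
    using fin by (auto simp: p_def poly_prod prod_zero_iff)
  then show False
    using y by simp
qed

lemma F_cases:
  assumes "y \<in> F"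
  obtains p r where "poly_over k p" "poly_over k r" "r \<noteq> 0" "poly r s \<noteq> 0" "y = poly p s / poly r s"
proof -
  obtain p r where pr: "poly_over k p" "poly_over k r" "y = poly p s / poly r s"
    using assms by (auto simp: fraction_field_def)
  show ?thesis
  proof (cases "r = 0")
    case True
    then show ?thesis
      using that[of 0 1] pr k_ring by (simp add: poly_over_0 poly_over_1)
  next
    case False
    then show ?thesis
      using that[of p r] pr transcendental_not_in[OF s] by blast
  qed
qed

text \<open>The choice of \<open>p\<close> and \<open>r\<close> does not matter because \<open>s\<close> is transcendental over \<open>k\<close>.\<close>

definition subst_power :: "nat \<Rightarrow> 'a \<Rightarrow> 'a"
  where "subst_power n y = (SOME z. \<exists>p r. poly_over k p \<and> poly_over k r \<and> r \<noteq> 0 \<and>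
    y = poly p s / poly r s \<and> z = poly p (s ^ n) / poly r (s ^ n))"

lemma subst_power_eq:
  assumes n: "n > 0" and pr: "poly_over k p" "poly_over k r" "r \<noteq> 0"
  shows "subst_power n (poly p s / poly r s) = poly p (s ^ n) / poly r (s ^ n)"
proof -
  have ex: "\<exists>z p' r'. poly_over k p' \<and> poly_over k r' \<and> r' \<noteq> 0 \<and>
      poly p s / poly r s = poly p' s / poly r' s \<and> z = poly p' (s ^ n) / poly r' (s ^ n)"
    using pr by blast
  obtain p' r' where pr': "poly_over k p'" "poly_over k r'" "r' \<noteq> 0"
    "poly p s / poly r s = poly p' s / poly r' s"
    and eq: "subst_power n (poly p s / poly r s) = poly p' (s ^ n) / poly r' (s ^ n)"
    using someI_ex[OF ex] unfolding subst_power_def by blast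
  have nz: "poly r t \<noteq> 0" "poly r' t \<noteq> 0" if "t \<notin> k" for t
    using transcendental_not_in[OF that] pr pr' by auto
  have "poly (p * r' - p' * r) s = 0"
    using pr'(4) nz[OF s] by (simp add: field_simps)
  then have "p * r' - p' * r = 0"
    using pr pr' k_ring by (intro transcendental_not_in[OF s] poly_over_diff poly_over_mult)
  then have "poly p (s ^ n) * poly r' (s ^ n) = poly p' (s ^ n) * poly r (s ^ n)"
    by (metis eq_iff_diff_eq_0 poly_mult)
  then show ?thesis
    unfolding eq using nz[OF s_power_notin[OF n]] by (simp add: field_simps)
qed

lemma subst_power_poly:
  assumes "n > 0" "poly_over k p"
  shows "subst_power n (poly p s) = poly p (s ^ n)"
  using subst_power_eq[OF assms poly_over_1[OF k_ring]] by simp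

lemma subst_power_const: "n > 0 \<Longrightarrow> c \<in> k \<Longrightarrow> subst_power n c = c"
  using subst_power_poly[of n "[:c:]"] by (simp add: poly_over_const k_ring)

lemma hom_on_subst_power:
  assumes n: "n > 0"
  shows "hom_on F (subst_power n)"
  unfolding hom_on_def
proof (intro conjI ballI)
  show "subst_power n 1 = 1"
    using subst_power_const[OF n] subring_one[OF k_ring] .
next
  fix x y
  assume "x \<in> F" "y \<in> F"
  obtain p r where x: "poly_over k p" "poly_over k r" "r \<noteq> 0" "poly r s \<noteq> 0" "x = poly p s / poly r s"
    using F_cases[OF \<open>x \<in> F\<close>] .
  obtain p' r' where y: "poly_over k p'" "poly_over k r'" "r' \<noteq> 0" "poly r' s \<noteq> 0" "y = poly p' s / poly r' s"
    using F_cases[OF \<open>y \<in> F\<close>] .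
  have nz: "poly r (s ^ n) \<noteq> 0" "poly r' (s ^ n) \<noteq> 0"
    using transcendental_not_in[OF s_power_notin[OF n]] x y by auto
  have 1: "x - y = poly (p * r' - p' * r) s / poly (r * r') s"
    unfolding x(5) y(5) using x(4) y(4) by (simp add: diff_frac_eq)
  have 2: "x * y = poly (p * p') s / poly (r * r') s"
    unfolding x(5) y(5) by simp
  have "poly_over k (p * r' - p' * r)" "poly_over k (p * p')" "poly_over k (r * r')" "r * r' \<noteq> 0"
    using x y k_ring by (auto intro: poly_over_diff poly_over_mult)
  then have "subst_power n (x - y) = poly (p * r' - p' * r) (s ^ n) / poly (r * r') (s ^ n)"
    "subst_power n (x * y) = poly (p * p') (s ^ n) / poly (r * r') (s ^ n)"
    unfolding 1 2 by (blast intro: subst_power_eq[OF n])+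
  moreover have "subst_power n x = poly p (s ^ n) / poly r (s ^ n)"
    "subst_power n y = poly p' (s ^ n) / poly r' (s ^ n)"
    unfolding x y using x y by (blast intro: subst_power_eq[OF n])+
  ultimately show "subst_power n (x - y) = subst_power n x - subst_power n y"
    "subst_power n (x * y) = subst_power n x * subst_power n y"
    using nz by (simp_all add: diff_frac_eq)
qed

lemma finite_place_exists:
  assumes c: "c \<in> k"
  obtains V where "valuation_ring V" "k \<subseteq> V" "s \<in> V" "inverse (s - c) \<notin> V"
proof -
  have sc: "s - c \<in> adjoin k s"
    using subring_diff[OF subring_adjoin[OF k_ring]] self_in_adjoin[OF k_ring]
      subset_adjoin[OF k_ring] c by blast
  have "s \<noteq> c"
    using c s by blast
  have "inverse (s - c) \<notin> adjoin k s"
  proof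
    assume "inverse (s - c) \<in> adjoin k s"
    then obtain p where p: "poly_over k p" "inverse (s - c) = poly p s"
      by (auto simp: adjoin_def)
    have "poly (p * [:- c, 1:] - 1) s = poly p s * (s - c) - 1"
      by (simp add: algebra_simps)
    also have "\<dots> = 0"
      using \<open>s \<noteq> c\<close> by (simp add: p(2)[symmetric])
    finally have "p * [:- c, 1:] - 1 = 0"
      using p c k_ring
      by (intro transcendental_not_in[OF s] poly_over_diff poly_over_mult poly_over_linear poly_over_1)
    then have "poly (p * [:- c, 1:] - 1) c = 0"
      by simp
    then show False
      by simp
  qed
  then obtain V where "valuation_ring V" "adjoin k s \<subseteq> V" "inverse (s - c) \<notin> V"
    using valuation_ring_exists[OF subring_adjoin[OF k_ring] sc] by blast
  then show ?thesis
    using that subset_adjoin[OF k_ring] self_in_adjoin[OF k_ring] by blast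
qed

text \<open>In a fraction with denominator of least degree, a root \<open>c\<close> of the
  denominator is not a root of the numerator, and a place over \<open>s = c\<close> exhibits a
  pole.\<close>

lemma integral_imp_poly:
  assumes y: "y \<in> F" and int: "\<And>V. valuation_ring V \<Longrightarrow> k \<subseteq> V \<Longrightarrow> s \<in> V \<Longrightarrow> y \<in> V"
  shows "y \<in> adjoin k s"
proof -
  define Q where "Q = (\<lambda>r. poly_over k r \<and> r \<noteq> 0 \<and> (\<exists>p. poly_over k p \<and> y = poly p s / poly r s))"
  have "\<exists>r. Q r"
    using F_cases[OF y] unfolding Q_def by metis
  then obtain r where r: "Q r" "\<And>r'. Q r' \<Longrightarrow> degree r \<le> degree r'"
    using ex_has_least_nat[of Q _ degree] by blast
  then obtain p where p: "poly_over k p" "y = poly p s / poly r s" and rk: "poly_over k r" "r \<noteq> 0"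
    by (auto simp: Q_def)
  have "degree r = 0"
  proof (rule ccontr)
    assume "degree r \<noteq> 0"
    then obtain c where c: "poly r c = 0"
      using ac by (auto simp: algebraically_closed_type_def)
    then have ck: "c \<in> k"
      using rk k_closed by (auto simp: algebraic_over_def)
    have mp: "min_poly k c [:- c, 1:]"
      unfolding min_poly_def
    proof (intro conjI allI impI)
      fix g
      assume "poly g c = 0" "g \<noteq> 0"
      then show "degree [:- c, 1:] \<le> degree g"
        by (cases "degree g") (auto elim: degree_eq_zeroE)
    qed (use ck k_ring in \<open>auto intro: poly_over_linear\<close>)
    obtain r1 where r1: "poly_over k r1" "r = [:- c, 1:] * r1"
      using min_poly_dvd[OF k mp rk(1) c] by blast
    have r1_0: "r1 \<noteq> 0"
      using r1 rk by auto
    have deg: "degree r = Suc (degree r1)"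
      using r1_0 unfolding r1(2) by (subst degree_mult_eq) auto
    have nz: "poly r1 s \<noteq> 0" "s - c \<noteq> 0"
      using r1 r1_0 transcendental_not_in[OF s] ck s by auto
    have pc: "poly p c \<noteq> 0"
    proof
      assume "poly p c = 0"
      then obtain p1 where "poly_over k p1" "p = [:- c, 1:] * p1"
        using min_poly_dvd[OF k mp p(1)] by blast
      moreover from this have "poly p s = (s - c) * poly p1 s" "poly r s = (s - c) * poly r1 s"
        by (simp_all add: r1(2) left_diff_distrib)
      then have "y = poly p1 s / poly r1 s"
        unfolding p(2) using nz by simp
      ultimately have "Q r1"
        using r1 r1_0 unfolding Q_def by blast
      then show False
        using r(2) deg by fastforce
    qed
    have pcF: "poly p c \<in> k"
      using p(1) ck k_ring by (rule_tac poly_in_subring)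
    have "poly_over k (p - [:poly p c:])" "poly (p - [:poly p c:]) c = 0"
      using p pcF k_ring by (auto intro: poly_over_diff poly_over_const)
    then obtain p1 where p1: "poly_over k p1" "p - [:poly p c:] = [:- c, 1:] * p1"
      using min_poly_dvd[OF k mp] by blast
    have "poly (p - [:poly p c:]) s = poly ([:- c, 1:] * p1) s"
      by (simp only: p1(2))
    then have ps: "poly p s = poly p c + (s - c) * poly p1 s"
      by (simp add: algebra_simps)
    obtain V where V: "valuation_ring V" "k \<subseteq> V" "s \<in> V" "inverse (s - c) \<notin> V"
      using finite_place_exists[OF ck] .
    note R = valuation_ring_subring[OF V(1)]
    have inV: "poly g s \<in> V" if "poly_over k g" for g
      using that V(2,3) R by (auto intro: poly_in_subring poly_over_mono)
    \<comment> \<open>Solved from \<open>y * (s - c) * r1(s) = p(c) + (s - c) * p1(s)\<close>. All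
      terms on the right lie in \<open>V\<close> once \<open>y\<close> does.\<close>
    have "inverse (s - c) = inverse (poly p c) * (y * poly r1 s - poly p1 s)"
      using nz pc unfolding p(2) ps r1(2) by (simp add: field_simps)
    moreover have "inverse (poly p c) \<in> V"
      using pcF subfield_inverse[OF k] V(2) by blast
    moreover have "y \<in> V"
      using int V by blast
    ultimately show False
      using V(4) inV[OF r1(1)] inV[OF p1(1)] R by (auto intro: subring_mult subring_diff)
  qed
  then obtain c where c: "r = [:c:]"
    using degree_eq_zeroE by blast
  then have "inverse c \<in> k"
    using rk k_ring by (intro subfield_inverse[OF k]) (simp add: poly_over_pCons_iff)
  moreover have "y = poly (smult (inverse c) p) s"
    using p(2) c by (simp add: divide_inverse mult.commute)
  ultimately have "y = poly (smult (inverse c) p) s" "inverse c \<in> k"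
    by blast+
  then show ?thesis
    using p k_ring by (metis adjoinI poly_over_smult)
qed

lemma infinite_place_exists:
  obtains V where "valuation_ring V" "k \<subseteq> V" "s \<notin> V"
proof -
  have inv: "inverse s \<notin> k"
    using subfield_inverse[OF k, of "inverse s"] s by auto
  have "inverse (inverse s) \<notin> adjoin k (inverse s)"
  proof
    assume "inverse (inverse s) \<in> adjoin k (inverse s)"
    then obtain p where p: "poly_over k p" "s = poly p (inverse s)"
      by (auto simp: adjoin_def)
    have "poly_over k (pCons 0 p - 1)"
      using p k_ring by (intro poly_over_diff poly_over_pCons poly_over_1 subring_zero)
    moreover have "poly (pCons 0 p - 1) (inverse s) = 0"
      using s_nonzero by (simp add: p(2)[symmetric])
    ultimately have "pCons 0 p - 1 = 0"
      using transcendental_not_in[OF inv] by blast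
    then have "coeff (pCons 0 p - 1) 0 = 0"
      by simp
    then show False
      by simp
  qed
  then obtain V where "valuation_ring V" "adjoin k (inverse s) \<subseteq> V" "inverse (inverse s) \<notin> V"
    using valuation_ring_exists[OF subring_adjoin[OF k_ring] self_in_adjoin[OF k_ring]] by blast
  then show ?thesis
    using that[of V] subset_adjoin[OF k_ring, of "inverse s"] by auto
qed

end

locale infinite_place = function_field +
  fixes V :: "'a::field set"
  assumes V: "valuation_ring V" "k \<subseteq> V" "s \<notin> V"
begin

lemma V_ring: "is_subring V"
  using V(1) by (rule valuation_ring_subring)

lemma inverse_s: "inverse s \<in> V"
  using valuation_ring_inverse[OF V(1,3)] .

text \<open>For the absolute value with valuation ring \<open>V\<close>, membership in \<open>D i\<close> means
  \<open>\<bar>y\<bar> \<le> \<bar>s\<bar>\<^sup>i\<close>, and \<open>exact y i\<close> below means equality. Not every \<open>y\<close> has an exact order, since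
  \<open>V\<close> may be ramified over \<open>k(s)\<close>.\<close>

definition D :: "int \<Rightarrow> 'a set"
  where "D i = {y. y * s powi (- i) \<in> V}"

lemma D_0: "D 0 = V"
  by (simp add: D_def)

lemma D_zero: "0 \<in> D i"
  using subring_zero[OF V_ring] by (simp add: D_def)

lemma D_diff: "y \<in> D i \<Longrightarrow> z \<in> D i \<Longrightarrow> y - z \<in> D i"
  using subring_diff[OF V_ring] by (simp add: D_def left_diff_distrib)

lemma D_uminus: "y \<in> D i \<Longrightarrow> - y \<in> D i"
  using D_diff[OF D_zero] by force

lemma D_add: "y \<in> D i \<Longrightarrow> z \<in> D i \<Longrightarrow> y + z \<in> D i"
  using D_diff[OF _ D_uminus] by force

lemma D_mult: "y \<in> D i \<Longrightarrow> z \<in> D j \<Longrightarrow> y * z \<in> D (i + j)"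
proof -
  assume "y \<in> D i" "z \<in> D j"
  then have "(y * s powi (- i)) * (z * s powi (- j)) \<in> V"
    using subring_mult[OF V_ring] by (auto simp: D_def)
  moreover have "(y * s powi (- i)) * (z * s powi (- j)) = y * z * s powi (- (i + j))"
    using s_nonzero by (simp add: power_int_add[symmetric] add.commute ac_simps flip: minus_add_distrib)
       (simp add: power_int_add power_int_minus power_int_diff field_simps)
  ultimately show ?thesis
    by (simp add: D_def)
qed

lemma D_mono: "i \<le> j \<Longrightarrow> y \<in> D i \<Longrightarrow> y \<in> D j"
proof -
  assume ij: "i \<le> j" and "y \<in> D i"
  moreover have "1 \<in> D (j - i)"
    using ij subring_power[OF V_ring inverse_s, of "nat (j - i)"]
      subring_one[OF V_ring]
    by (simp add: D_def power_int_def split: if_splits)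
  ultimately show ?thesis
    using D_mult[of y i 1 "j - i"] by simp
qed

lemma D_not_imp_inverse: "y \<notin> D i \<Longrightarrow> inverse y \<in> D (- i)"
  using valuation_ring_inverse[OF V(1), of "y * s powi (- i)"]
  by (simp add: D_def power_int_minus)

lemma D_power: "y \<in> D i \<Longrightarrow> y ^ n \<in> D (int n * i)"
proof (induction n)
  case 0
  then show ?case
    by (simp add: D_0 subring_one[OF V_ring])
next
  case (Suc n)
  then show ?case
    using D_mult[of y i "y ^ n" "int n * i"] by (simp add: algebra_simps)
qed

lemma D_prod: "finite I \<Longrightarrow> (\<And>j. j \<in> I \<Longrightarrow> f j \<in> D (g j)) \<Longrightarrow> prod f I \<in> D (sum g I)"
  by (induction I rule: finite_induct) (auto simp: D_0 subring_one[OF V_ring] intro: D_mult)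

lemma one_notin_D: "i < 0 \<Longrightarrow> 1 \<notin> D i"
proof
  assume "i < 0" "1 \<in> D i"
  then have "1 \<in> D (- 1)"
    using D_mono[of i "- 1"] by simp
  then show False
    using V(3) by (simp add: D_def)
qed

lemma k_subset_D: "c \<in> k \<Longrightarrow> i \<ge> 0 \<Longrightarrow> c \<in> D i"
  using V(2) D_mono[of 0 i] D_0 by blast

definition exact :: "'a \<Rightarrow> int \<Rightarrow> bool"
  where "exact y i \<longleftrightarrow> y \<noteq> 0 \<and> y \<in> D i \<and> inverse y \<in> D (- i)"

lemma exact_imp_D: "exact y i \<Longrightarrow> y \<in> D i"
  by (simp add: exact_def)

lemma exact_mult: "exact y i \<Longrightarrow> exact z j \<Longrightarrow> exact (y * z) (i + j)"
  using D_mult[of "inverse y" "- i" "inverse z" "- j"] by (simp add: exact_def D_mult)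

lemma exact_inverse: "exact y i \<Longrightarrow> exact (inverse y) (- i)"
  by (simp add: exact_def)

lemma exact_divide: "exact y i \<Longrightarrow> exact z j \<Longrightarrow> exact (y / z) (i - j)"
  using exact_mult[OF _ exact_inverse] by (simp add: divide_inverse)

lemma exact_const: "c \<in> k \<Longrightarrow> c \<noteq> 0 \<Longrightarrow> exact c 0"
  using k_subset_D subfield_inverse[OF k] by (simp add: exact_def)

lemma exact_s: "exact s 1"
  using s_nonzero subring_one[OF V_ring] by (simp add: exact_def D_def)

lemma exact_prod: "finite I \<Longrightarrow> (\<And>j. j \<in> I \<Longrightarrow> exact (f j) (g j)) \<Longrightarrow> exact (prod f I) (sum g I)"
  by (induction I rule: finite_induct)
    (auto intro: exact_mult exact_const subring_one[OF k_ring])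

lemma exact_le: "exact y i \<Longrightarrow> y \<in> D j \<Longrightarrow> i \<le> j"
  using D_mult[of y j "inverse y" "- i"] one_notin_D[of "j - i"] by (force simp: exact_def)

lemma exact_unique: "exact y i \<Longrightarrow> exact y j \<Longrightarrow> i = j"
  using exact_le exact_imp_D by (metis order_antisym)

text \<open>The strict triangle inequality: with \<open>w = s * z / y\<close> in \<open>V\<close>,
  the sum \<open>s + w\<close> stays outside \<open>V\<close>, so \<open>(s + w) / s\<close> is a
  unit at \<open>V\<close>.\<close>

lemma exact_add:
  assumes y: "exact y i" and z: "z \<in> D (i - 1)"
  shows "exact (y + z) i"
proof -
  have y0: "y \<noteq> 0"
    using y by (simp add: exact_def)
  have iy: "inverse y \<in> D (- i)"
    using y by (simp add: exact_def)
  define w where "w = s * (z * inverse y)"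
  have wV: "w \<in> V"
    unfolding w_def using D_mult[OF exact_imp_D[OF exact_s] D_mult[OF z iy]] by (simp add: D_0)
  have "s + w \<notin> V"
  proof
    assume "s + w \<in> V"
    then have "(s + w) - w \<in> V"
      using wV V_ring by (intro subring_diff)
    then show False
      using V(3) by simp
  qed
  then have inv: "inverse (s + w) \<in> V" and sw: "s + w \<noteq> 0"
    using valuation_ring_inverse[OF V(1)] subring_zero[OF V_ring] by auto
  have *: "y + z = y * ((s + w) * inverse s)"
    using y0 s_nonzero by (simp add: w_def field_simps)
  have "inverse (y + z) = inverse y * (1 - w * inverse (s + w))"
    unfolding * using y0 s_nonzero sw by (simp add: field_simps)
  also have "\<dots> \<in> D (- i)"
    using D_mult[OF iy, of _ 0] wV inv V_ring
    by (auto simp: D_0 intro: subring_diff subring_mult subring_one)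
  finally have "inverse (y + z) \<in> D (- i)" .
  moreover have "y + z \<in> D i"
    using y D_mono[OF _ z, of i] by (auto simp: exact_def intro: D_add)
  moreover have "y + z \<noteq> 0"
    unfolding * using y0 s_nonzero sw by simp
  ultimately show ?thesis
    by (simp add: exact_def)
qed

lemma exact_poly: "poly_over k p \<Longrightarrow> p \<noteq> 0 \<Longrightarrow> exact (poly p s) (int (degree p))"
proof (induction p)
  case (pCons a p)
  then have ak: "a \<in> k" "poly_over k p"
    using k_ring by (auto simp: poly_over_pCons_iff)
  show ?case
  proof (cases "p = 0")
    case True
    then show ?thesis
      using pCons ak by (auto intro: exact_const)
  next
    case False
    then have "exact (s * poly p s) (1 + int (degree p))"
      using pCons ak exact_s by (intro exact_mult) auto
    then have "exact (s * poly p s + a) (1 + int (degree p))"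
      using ak by (intro exact_add) (auto intro: k_subset_D)
    then show ?thesis
      using False by (simp add: add.commute)
  qed
qed simp

text \<open>The map \<open>s \<mapsto> s ^ n\<close> is totally ramified at infinity, hence the
  factor \<open>n\<close>.\<close>

lemma exact_subst_power:
  assumes g: "g \<in> F" "g \<noteq> 0" and n: "n > 0"
  obtains i where "exact g i" "exact (subst_power n g) (int n * i)"
proof -
  obtain p r where pr: "poly_over k p" "poly_over k r" "r \<noteq> 0" "poly r s \<noteq> 0" "g = poly p s / poly r s"
    using F_cases[OF g(1)] .
  have p0: "p \<noteq> 0"
    using pr g by auto
  have comp: "exact (poly h (s ^ n)) (int n * int (degree h))" if h: "poly_over k h" "h \<noteq> 0" for h
  proof -
    have "poly_over k (pcompose h (monom 1 n))"
      using h k_ring by (intro poly_over_pcompose poly_over_monom subring_one)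
    moreover have "poly (pcompose h (monom 1 n)) s = poly h (s ^ n)"
      by (simp add: poly_pcompose poly_monom)
    moreover have "pcompose h (monom 1 n) \<noteq> 0"
      using h n by (simp add: pcompose_eq_0_iff degree_monom_eq)
    moreover have "degree (pcompose h (monom 1 n)) = n * degree h"
      by (simp add: degree_pcompose degree_monom_eq)
    ultimately show ?thesis
      using exact_poly[of "pcompose h (monom 1 n)"] by simp
  qed
  have "exact g (int (degree p) - int (degree r))"
    unfolding pr(5) using pr p0 by (intro exact_divide exact_poly)
  moreover have "exact (subst_power n g) (int n * int (degree p) - int n * int (degree r))"
    unfolding pr(5) subst_power_eq[OF n pr(1-3)] using pr p0 comp by (intro exact_divide) auto
  ultimately show ?thesis
    using that by (simp add: right_diff_distrib)
qed

text \<open>The point at infinity is fixed by \<open>s \<mapsto> s ^ n\<close>, so a function that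
  is regular there and its image take the same value \<open>c\<close>.\<close>

lemma residue_subst_power:
  assumes g: "g \<in> F" "g \<in> V" and n: "n > 0"
  obtains c where "c \<in> k" "g - c \<in> D (- 1)" "subst_power n g - c \<in> D (- 1)"
proof -
  have main: "\<exists>c\<in>k. g - c \<in> D (- 1)"
  proof (cases "g = 0")
    case True
    then show ?thesis
      using subring_zero[OF k_ring] D_zero by (intro bexI[of _ 0]) auto
  next
    case False
    obtain p r where pr: "poly_over k p" "poly_over k r" "r \<noteq> 0" "poly r s \<noteq> 0" "g = poly p s / poly r s"
      using F_cases[OF g(1)] .
    have p0: "p \<noteq> 0"
      using False pr by auto
    have "exact g (int (degree p) - int (degree r))"
      unfolding pr(5) using pr p0 by (intro exact_divide exact_poly)
    then have deg: "degree p \<le> degree r"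
      using exact_le[of g _ 0] g(2) by (fastforce simp: D_0)
    \<comment> \<open>For \<open>degree p < degree r\<close> this is \<open>0\<close>, which is the
      value at infinity in that case.\<close>
    define c where "c = coeff p (degree r) / lead_coeff r"
    have c: "c \<in> k"
      unfolding c_def using pr k_ring by (auto intro!: subfield_divide[OF k] poly_over_coeff)
    define h where "h = p - smult c r"
    have h: "poly_over k h"
      unfolding h_def using pr c k_ring by (intro poly_over_diff poly_over_smult)
    have gc: "g - c = poly h s / poly r s"
      using pr by (simp add: h_def field_simps)
    have "g - c \<in> D (- 1)"
    proof (cases "h = 0")
      case True
      then show ?thesis
        by (simp add: gc D_zero)
    next
      case False
      have "coeff h (degree r) = 0"
        using pr(3) by (simp add: h_def c_def)
      moreover have "degree h \<le> degree r"
        unfolding h_def using deg by (intro degree_diff_le degree_smult_le order_trans[OF degree_smult_le]) auto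
      ultimately have "degree h < degree r"
        using False by (metis leading_coeff_0_iff order_le_less)
      moreover have "exact (g - c) (int (degree h) - int (degree r))"
        unfolding gc using pr h False by (intro exact_divide exact_poly)
      ultimately show ?thesis
        by (intro D_mono[OF _ exact_imp_D]) auto
    qed
    then show ?thesis
      using c by blast
  qed
  then obtain c where c: "c \<in> k" "g - c \<in> D (- 1)"
    by blast
  have gc: "g - c \<in> F"
    using g c k_subset_F F_ring by (auto intro: subring_diff)
  have "subst_power n (g - c) \<in> D (- 1)"
  proof (cases "g - c = 0")
    case True
    then show ?thesis
      using hom_on_0[OF F hom_on_subst_power[OF n]] D_zero by simp
  next
    case False
    then obtain i where i: "exact (g - c) i" "exact (subst_power n (g - c)) (int n * i)"
      using exact_subst_power[OF gc _ n] by blast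
    then have "i \<le> - 1"
      using exact_le c(2) by blast
    then have "int n * i \<le> 1 * i"
      using n by (intro mult_right_mono_neg) auto
    then have "int n * i \<le> - 1"
      using \<open>i \<le> - 1\<close> by linarith
    then show ?thesis
      using i(2) exact_imp_D D_mono by blast
  qed
  then have "subst_power n g - c \<in> D (- 1)"
    using g c k_subset_F hom_on_diff[OF F hom_on_subst_power[OF n], of g c]
      subst_power_const[OF n c(1)] by auto
  then show ?thesis
    using that c by blast
qed

text \<open>\<open>V\<close> is not known to have rank one, and elements outside this ring exceed
  every power of \<open>s\<close>. Approximation arguments take place inside it; it contains
  \<open>F\<close>.\<close>

definition bounded_elements :: "'a set"
  where "bounded_elements = {y. \<exists>i. y \<in> D i}"

lemma subring_bounded_elements: "is_subring bounded_elements"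
  unfolding is_subring_def
proof (intro conjI ballI)
  show "1 \<in> bounded_elements"
    using k_subset_D[OF subring_one[OF k_ring], of 0] by (auto simp: bounded_elements_def)
next
  fix x y
  assume "x \<in> bounded_elements" "y \<in> bounded_elements"
  then obtain i j where "x \<in> D i" "y \<in> D j"
    by (auto simp: bounded_elements_def)
  then have "x - y \<in> D (max i j)" "x * y \<in> D (i + j)"
    using D_mono[of i "max i j"] D_mono[of j "max i j"] by (auto intro: D_diff D_mult)
  then show "x - y \<in> bounded_elements" "x * y \<in> bounded_elements"
    by (auto simp: bounded_elements_def)
qed

lemma F_subset_bounded: "F \<subseteq> bounded_elements"
proof
  fix y
  assume y: "y \<in> F"
  show "y \<in> bounded_elements"
  proof (cases "y = 0")
    case True
    then show ?thesis
      using subring_zero[OF subring_bounded_elements] by simp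
  next
    case False
    then obtain i where "exact y i"
      using exact_subst_power[OF y False, of 1] by auto
    then show ?thesis
      by (auto simp: bounded_elements_def dest: exact_imp_D)
  qed
qed

text \<open>Horner's scheme: the error of \<open>a + x * W x\<close> splits into
  \<open>x * (W x - W y)\<close> and \<open>(x - y) * W y\<close>.\<close>

lemma poly_continuous:
  assumes W: "poly_over bounded_elements W" and x: "x \<in> bounded_elements"
  shows "\<exists>m. \<forall>y. x - y \<in> D m \<longrightarrow> poly W x - poly W y \<in> D n"
  using W
proof (induction W arbitrary: n)
  case 0
  then show ?case
    by (simp add: D_zero)
next
  case (pCons a W)
  note B = subring_bounded_elements
  have W: "poly_over bounded_elements W"
    using pCons.prems B by (simp add: poly_over_pCons_iff)
  obtain i where i: "x \<in> D i"
    using x by (auto simp: bounded_elements_def)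
  have "poly W x \<in> bounded_elements"
    using W x B by (auto intro: poly_in_subring)
  then obtain j where j: "poly W x \<in> D j"
    by (auto simp: bounded_elements_def)
  obtain m where m: "\<And>y. x - y \<in> D m \<Longrightarrow> poly W x - poly W y \<in> D (min (n - i) j)"
    using pCons.IH[OF W] by blast
  have "poly (pCons a W) x - poly (pCons a W) y \<in> D n" if y: "x - y \<in> D (min m (n - j))" for y
  proof -
    have y1: "x - y \<in> D m" "x - y \<in> D (n - j)"
      using y D_mono[of "min m (n - j)"] by auto
    have 1: "poly W x - poly W y \<in> D (min (n - i) j)"
      using m y1 by blast
    then have 2: "poly W x - poly W y \<in> D (n - i)" "poly W x - poly W y \<in> D j"
      using D_mono[of "min (n - i) j"] by auto
    have "poly W x - (poly W x - poly W y) \<in> D j"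
      using j 2(2) by (rule D_diff)
    then have "poly W y \<in> D j"
      by (simp only: diff_diff_eq2 add_diff_cancel_left')
    then have "(x - y) * poly W y \<in> D (n - j + j)"
      using y1 by (intro D_mult)
    moreover have "x * (poly W x - poly W y) \<in> D (i + (n - i))"
      using i 2 by (intro D_mult)
    ultimately have "x * (poly W x - poly W y) + (x - y) * poly W y \<in> D n"
      by (intro D_add) auto
    then show ?thesis
      by (simp add: algebra_simps)
  qed
  then show ?case
    by blast
qed

end

text \<open>The exponent \<open>q\<close> is specified by the two properties of a Frobenius power
  that the proof relies on; \<open>frobenius_exponent\<close> supplies it.\<close>

locale frobenius_place = infinite_place +
  fixes Fq :: "'a::field set" and q :: nat
  assumes Fq: "is_subfield Fq" "Fq \<subseteq> k"
    and q: "q \<ge> 2"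
    and frob_diff: "(x - y) ^ q = x ^ q - (y :: 'a) ^ q"
    and frob_fixed: "c \<in> Fq \<Longrightarrow> c ^ q = c"
begin

abbreviation \<theta> where "\<theta> \<equiv> subst_power q"

lemma q_pos: "q > 0"
  using q by simp

lemma Fq_ring: "is_subring Fq"
  using Fq(1) by (rule subfield_subring)

lemma theta: "hom_on F \<theta>"
  using hom_on_subst_power[OF q_pos] .

lemma Fqs_subset_F: "fraction_field Fq s \<subseteq> F"
  using Fq(2) by (rule fraction_field_mono)

lemma subfield_Fqs: "is_subfield (fraction_field Fq s)"
  using Fq_ring by (rule subfield_fraction_field)

lemma hom_on_frobenius: "hom_on UNIV (\<lambda>x :: 'a. x ^ q)"
  by (simp add: hom_on_def frob_diff power_mult_distrib)

lemma subfield_UNIV: "is_subfield UNIV"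
  by (simp add: is_subfield_def is_subring_def)

lemma map_frobenius_Fq: "poly_over Fq p \<Longrightarrow> map_poly (\<lambda>x. x ^ q) p = p"
  using q_pos by (intro poly_eqI) (simp add: coeff_map_poly frob_fixed poly_over_coeff[OF Fq_ring])

lemma poly_over_UNIV: "poly_over UNIV p"
  by (simp add: poly_over_def)

lemma poly_frobenius: "poly_over Fq p \<Longrightarrow> poly p (x ^ q) = poly p x ^ q"
  using poly_map_hom[OF subfield_UNIV hom_on_frobenius poly_over_UNIV UNIV_I, of p x]
  by (simp add: map_frobenius_Fq)

text \<open>The substitution fixes \<open>Fq\<close> because it fixes all constants, and the
  \<open>q\<close>-th power map fixes \<open>Fq\<close> as well; both send \<open>s\<close> to
  \<open>s ^ q\<close>. This is the link between the \<open>k\<close>-linear map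
  \<open>\<theta>\<close> and Frobenius.\<close>

lemma theta_Fqs:
  assumes "\<xi> \<in> fraction_field Fq s"
  shows "\<theta> \<xi> = \<xi> ^ q"
proof -
  obtain p r where pr: "poly_over Fq p" "poly_over Fq r" "\<xi> = poly p s / poly r s"
    using assms by (auto simp: fraction_field_def)
  show ?thesis
  proof (cases "r = 0")
    case True
    then show ?thesis
      using pr q_pos hom_on_0[OF F theta] by simp
  next
    case False
    then have "\<theta> \<xi> = poly p (s ^ q) / poly r (s ^ q)"
      using pr Fq unfolding pr(3) by (intro subst_power_eq q_pos poly_over_mono[OF Fq(2)])
    then show ?thesis
      using pr by (simp add: poly_frobenius power_divide)
  qed
qed

subsection \<open>Elements approximable at the infinite place\<close>

text \<open>The part of the completion \<open>Fq((1/s))\<close> that lies in the ambient field,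
  described as the closure of \<open>Fq(s)\<close> for the neighbourhoods \<open>D n\<close> of
  \<open>0\<close>.\<close>

definition approximable :: "'a set"
  where "approximable = {y. \<forall>n. \<exists>\<xi>\<in>fraction_field Fq s. y - \<xi> \<in> D n}"

lemma approximableE:
  assumes "y \<in> approximable"
  obtains \<xi> where "\<xi> \<in> fraction_field Fq s" "y - \<xi> \<in> D n"
  using assms unfolding approximable_def by blast

lemma approximable_bounded: "approximable \<subseteq> bounded_elements"
proof
  fix y
  assume "y \<in> approximable"
  then obtain \<xi> where \<xi>: "\<xi> \<in> fraction_field Fq s" "y - \<xi> \<in> D 0"
    by (rule approximableE)
  have "\<xi> \<in> bounded_elements" "y - \<xi> \<in> bounded_elements"
    using \<xi> Fqs_subset_F F_subset_bounded by (auto simp: bounded_elements_def)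
  then have "(y - \<xi>) + \<xi> \<in> bounded_elements"
    using subring_add[OF subring_bounded_elements] by blast
  then show "y \<in> bounded_elements"
    by simp
qed

lemma Fqs_approximable: "fraction_field Fq s \<subseteq> approximable"
  unfolding approximable_def using D_zero by (auto intro!: bexI)

lemma subring_approximable: "is_subring approximable"
  unfolding is_subring_def
proof (intro conjI ballI)
  note R = subfield_subring[OF subfield_Fqs]
  show "1 \<in> approximable"
    using Fqs_approximable subring_one[OF R] by blast
  fix x y
  assume x: "x \<in> approximable" and y: "y \<in> approximable"
  show "x - y \<in> approximable"
    unfolding approximable_def mem_Collect_eq
  proof
    fix n
    obtain \<xi> \<eta> where *: "\<xi> \<in> fraction_field Fq s" "x - \<xi> \<in> D n" "\<eta> \<in> fraction_field Fq s" "y - \<eta> \<in> D n"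
      using x y by (metis approximableE)
    then have "(x - \<xi>) - (y - \<eta>) \<in> D n"
      using D_diff by blast
    moreover have "(x - \<xi>) - (y - \<eta>) = (x - y) - (\<xi> - \<eta>)"
      by simp
    ultimately show "\<exists>\<xi>\<in>fraction_field Fq s. x - y - \<xi> \<in> D n"
      using * R by (metis subring_diff)
  qed
  obtain a b where ab: "x \<in> D a" "y \<in> D b"
    using x y approximable_bounded unfolding bounded_elements_def by blast
  show "x * y \<in> approximable"
    unfolding approximable_def mem_Collect_eq
  proof
    fix n
    obtain \<xi> where \<xi>: "\<xi> \<in> fraction_field Fq s" "x - \<xi> \<in> D (n - b)"
      using x by (rule approximableE)
    obtain c where c: "\<xi> \<in> D c"
      using \<xi>(1) Fqs_subset_F F_subset_bounded by (auto simp: bounded_elements_def)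
    obtain \<eta> where \<eta>: "\<eta> \<in> fraction_field Fq s" "y - \<eta> \<in> D (n - c)"
      using y by (rule approximableE)
    have "(x - \<xi>) * y \<in> D n" "\<xi> * (y - \<eta>) \<in> D n"
      using D_mult[OF \<xi>(2) ab(2)] D_mult[OF c \<eta>(2)] by simp_all
    then have "(x - \<xi>) * y + \<xi> * (y - \<eta>) \<in> D n"
      by (rule D_add)
    moreover have "(x - \<xi>) * y + \<xi> * (y - \<eta>) = x * y - \<xi> * \<eta>"
      by (simp add: algebra_simps)
    ultimately show "\<exists>\<xi>\<in>fraction_field Fq s. x * y - \<xi> \<in> D n"
      using \<xi> \<eta> R by (metis subring_mult)
  qed
qed

text \<open>An approximation up to \<open>D (- 1)\<close> has a polynomial part \<open>h\<close>
  over \<open>Fq\<close>. Then \<open>p - h\<close> is a polynomial whose value at \<open>s\<close>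
  has negative order, so it vanishes.\<close>

lemma approximable_poly_over:
  assumes p: "poly_over k p" and ps: "poly p s \<in> approximable"
  shows "poly_over Fq p"
proof -
  obtain \<xi> where \<xi>: "\<xi> \<in> fraction_field Fq s" "poly p s - \<xi> \<in> D (- 1)"
    using ps by (rule approximableE)
  obtain a b where ab: "poly_over Fq a" "poly_over Fq b" "\<xi> = poly a s / poly b s"
    using \<xi>(1) by (auto simp: fraction_field_def)
  obtain h where h: "poly_over Fq h" "\<xi> - poly h s \<in> D (- 1)"
  proof (cases "b = 0")
    case True
    then show ?thesis
      using that[of 0] ab Fq_ring D_zero by (simp add: poly_over_0)
  next
    case False
    obtain h r where hr: "poly_over Fq h" "poly_over Fq r" "a = b * h + r" "r = 0 \<or> degree r < degree b"
      using poly_over_division[OF Fq(1) ab(2) False ab(1)] by blast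
    have bs: "exact (poly b s) (int (degree b))"
      using ab(2) False Fq(2) by (intro exact_poly) (auto intro: poly_over_mono)
    then have "\<xi> - poly h s = poly r s / poly b s"
      unfolding ab(3) hr(3) by (auto simp: exact_def field_simps)
    moreover have "poly r s / poly b s \<in> D (- 1)"
    proof (cases "r = 0")
      case False
      then have "exact (poly r s / poly b s) (int (degree r) - int (degree b))"
        using bs poly_over_mono[OF Fq(2) hr(2)] by (intro exact_divide[OF _ bs] exact_poly)
      then show ?thesis
        using hr(4) False by (intro D_mono[OF _ exact_imp_D]) auto
    qed (simp add: D_zero)
    ultimately show ?thesis
      using that hr(1) by simp
  qed
  have "(poly p s - \<xi>) + (\<xi> - poly h s) \<in> D (- 1)"
    using \<xi>(2) h(2) by (rule D_add)
  then have "poly (p - h) s \<in> D (- 1)"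
    by simp
  moreover have "poly_over k (p - h)"
    using p h(1) Fq(2) k_ring by (auto intro: poly_over_diff poly_over_mono)
  ultimately have "p - h = 0"
    using exact_le[OF exact_poly] by fastforce
  then show ?thesis
    using h(1) by simp
qed

context
  fixes U :: "'a poly" and x :: 'a
  assumes U: "poly_over F U" and x: "x \<in> approximable"
begin

text \<open>\<open>x ^ q\<close> plays the part of \<open>\<theta> x\<close>: if
  \<open>\<xi>\<close> in \<open>Fq(s)\<close> is close to \<open>x\<close>, then
  \<open>\<theta> \<xi> = \<xi> ^ q\<close> is close to \<open>x ^ q\<close>, and
  \<open>g = U(\<xi>)\<close> serves both approximations.\<close>

lemma approximate_value:
  obtains g where "g \<in> F" "poly U x - g \<in> D n" "poly (map_poly \<theta> U) (x ^ q) - \<theta> g \<in> D n"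
proof -
  note B = subring_bounded_elements
  have UB: "poly_over bounded_elements U"
    using U F_subset_bounded by (rule poly_over_mono[rotated])
  have \<theta>F: "\<theta> y \<in> bounded_elements" if "y \<in> F" for y
  proof (cases "y = 0")
    case True
    then show ?thesis
      using hom_on_0[OF F theta] subring_zero[OF B] by simp
  next
    case False
    then obtain i where "exact (\<theta> y) (int q * i)"
      using exact_subst_power[OF \<open>y \<in> F\<close> _ q_pos] by blast
    then show ?thesis
      by (auto simp: bounded_elements_def dest: exact_imp_D)
  qed
  have U'B: "poly_over bounded_elements (map_poly \<theta> U)"
    using U \<theta>F F_ring B by (simp add: poly_over_iff coeff_map_hom[OF F theta])
  have xB: "x \<in> bounded_elements" "x ^ q \<in> bounded_elements"
    using x approximable_bounded B by (auto intro: subring_power)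
  obtain m1 where m1: "\<And>y. x - y \<in> D m1 \<Longrightarrow> poly U x - poly U y \<in> D n"
    using poly_continuous[OF UB xB(1)] by blast
  obtain m2 where m2: "\<And>y. x ^ q - y \<in> D m2 \<Longrightarrow>
      poly (map_poly \<theta> U) (x ^ q) - poly (map_poly \<theta> U) y \<in> D n"
    using poly_continuous[OF U'B xB(2)] by blast
  \<comment> \<open>With \<open>m \<le> 0\<close> we have \<open>q * m \<le> m\<close>, so the
    \<open>q\<close>-th power loses no accuracy.\<close>
  define m where "m = min 0 (min m1 m2)"
  obtain \<xi> where \<xi>: "\<xi> \<in> fraction_field Fq s" "x - \<xi> \<in> D m"
    using x by (rule approximableE)
  have \<xi>F: "\<xi> \<in> F"
    using \<xi>(1) Fqs_subset_F by blast
  have "(x - \<xi>) ^ q \<in> D (int q * m)"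
    using \<xi>(2) by (rule D_power)
  moreover have "int q * m \<le> 1 * m"
    using q_pos by (intro mult_right_mono_neg) (auto simp: m_def)
  then have "int q * m \<le> m2"
    by (simp add: m_def)
  ultimately have "x ^ q - \<xi> ^ q \<in> D m2"
    using D_mono by (auto simp: frob_diff)
  then have "poly (map_poly \<theta> U) (x ^ q) - poly (map_poly \<theta> U) (\<theta> \<xi>) \<in> D n"
    using m2 by (simp add: theta_Fqs[OF \<xi>(1)])
  then have "poly (map_poly \<theta> U) (x ^ q) - \<theta> (poly U \<xi>) \<in> D n"
    by (simp add: poly_map_hom[OF F theta U \<xi>F])
  moreover have "poly U x - poly U \<xi> \<in> D n"
    using m1 D_mono[OF _ \<xi>(2), of m1] by (simp add: m_def)
  moreover have "poly U \<xi> \<in> F"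
    using U \<xi>F F_ring by (auto intro: poly_in_subring)
  ultimately show ?thesis
    using that by blast
qed

text \<open>A close approximation \<open>g\<close> in \<open>F\<close> has the same exact order as
  the value, and \<open>exact_subst_power\<close> applies to \<open>g\<close>. The bounded inverse
  excludes infinitely small values, for which no accuracy would be enough.\<close>

lemma leading_order:
  assumes u: "poly U x \<noteq> 0" "inverse (poly U x) \<in> bounded_elements"
  obtains j where "exact (poly U x) j" "exact (poly (map_poly \<theta> U) (x ^ q)) (int q * j)"
proof -
  obtain n where n: "inverse (poly U x) \<in> D n"
    using u(2) by (auto simp: bounded_elements_def)
  have small: "poly U x \<notin> D (- n - 1)"
    using D_mult[OF _ n, of "poly U x" "- n - 1"] u(1) one_notin_D[of "- 1"] by auto
  have approx: "\<exists>j. exact (poly U x) j \<and> exact g j \<and> exact (\<theta> g) (int q * j)"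
    if g: "g \<in> F" "poly U x - g \<in> D (- n - 1)" for g
  proof -
    have "g \<noteq> 0"
      using small g by auto
    then obtain j where j: "exact g j" "exact (\<theta> g) (int q * j)"
      using exact_subst_power[OF g(1) _ q_pos] by blast
    have "- n \<le> j"
    proof (rule ccontr)
      assume "\<not> ?thesis"
      then have "g \<in> D (- n - 1)"
        using D_mono[OF _ exact_imp_D[OF j(1)], of "- n - 1"] by simp
      then have "(poly U x - g) + g \<in> D (- n - 1)"
        using D_add[OF g(2)] by blast
      then show False
        using small by simp
    qed
    then have "exact (g + (poly U x - g)) j"
      using g(2) j(1) by (intro exact_add D_mono[of "- n - 1" "j - 1"]) auto
    then show ?thesis
      using j by auto
  qed
  obtain g0 where "g0 \<in> F" "poly U x - g0 \<in> D (- n - 1)"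
    by (rule approximate_value)
  then obtain j where j: "exact (poly U x) j"
    using approx by blast
  \<comment> \<open>The second approximation is also accurate for the image, whose order
    \<open>q * j\<close> is known only after the first one.\<close>
  define N where "N = min (- n - 1) (int q * j - 1)"
  obtain g where g: "g \<in> F" "poly U x - g \<in> D N" "poly (map_poly \<theta> U) (x ^ q) - \<theta> g \<in> D N"
    by (rule approximate_value)
  have "poly U x - g \<in> D (- n - 1)"
    using g(2) by (rule D_mono[rotated]) (simp add: N_def)
  then obtain j' where "exact (poly U x) j'" "exact (\<theta> g) (int q * j')"
    using approx g(1) by blast
  then have "exact (\<theta> g) (int q * j)"
    using exact_unique[OF j] by blast
  moreover have "poly (map_poly \<theta> U) (x ^ q) - \<theta> g \<in> D (int q * j - 1)"
    using g(3) by (rule D_mono[rotated]) (simp add: N_def)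
  ultimately have "exact (\<theta> g + (poly (map_poly \<theta> U) (x ^ q) - \<theta> g)) (int q * j)"
    by (rule exact_add)
  then show ?thesis
    using that j by simp
qed

text \<open>Both residues are those of one approximation \<open>g\<close> and of
  \<open>\<theta> g\<close>, which agree by \<open>residue_subst_power\<close>.\<close>

lemma common_residue:
  assumes u: "poly U x \<in> V"
  obtains c where "c \<in> k" "poly U x - c \<in> D (- 1)" "poly (map_poly \<theta> U) (x ^ q) - c \<in> D (- 1)"
proof -
  obtain g where g: "g \<in> F" "poly U x - g \<in> D (- 1)" "poly (map_poly \<theta> U) (x ^ q) - \<theta> g \<in> D (- 1)"
    by (rule approximate_value)
  have "poly U x - (poly U x - g) \<in> D 0"
    using u D_mono[OF _ g(2), of 0] D_diff[of "poly U x" 0] by (auto simp only: D_0)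
  then have "g \<in> V"
    by (simp add: D_0)
  then obtain c where c: "c \<in> k" "g - c \<in> D (- 1)" "\<theta> g - c \<in> D (- 1)"
    using residue_subst_power[OF g(1) _ q_pos] by blast
  have "poly U x - c \<in> D (- 1)" "poly (map_poly \<theta> U) (x ^ q) - c \<in> D (- 1)"
    using D_add[OF g(2) c(2)] D_add[OF g(3) c(3)] by simp_all
  then show ?thesis
    using that c(1) by blast
qed

end

subsection \<open>Preperiodic points at the infinite place\<close>

lemma exact_uminus: "exact y i \<Longrightarrow> exact (- y) i"
  by (simp add: exact_def D_uminus)

lemma V_multiple_total: "(\<exists>v\<in>V. y = v * z) \<or> (\<exists>v\<in>V. z = v * y)" for y z
proof (cases "y = 0 \<or> z = 0")
  case True
  then show ?thesis
    using subring_zero[OF V_ring] by auto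
next
  case False
  then have "y = y / z * z" "z = inverse (y / z) * y"
    by auto
  then show ?thesis
    using valuation_ring_inverse[OF V(1), of "y / z"] by metis
qed

text \<open>Divisibility by elements of \<open>V\<close> is a total preorder. This picks the root
  nearest to a point.\<close>

lemma V_multiple_least:
  fixes h :: "'i \<Rightarrow> 'a"
  assumes "finite J" "J \<noteq> {}"
  shows "\<exists>j\<in>J. \<forall>l\<in>J. \<exists>v\<in>V. h j = v * h l"
  using assms
proof (induction J rule: finite_ne_induct)
  case (singleton j)
  then show ?case
    using subring_one[OF V_ring] by (auto intro!: bexI[of _ 1])
next
  case (insert i J)
  then obtain j where j: "j \<in> J" "\<forall>l\<in>J. \<exists>v\<in>V. h j = v * h l"
    by blast
  from V_multiple_total[of "h i" "h j"] show ?case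
  proof
    assume "\<exists>v\<in>V. h i = v * h j"
    then obtain v where v: "v \<in> V" "h i = v * h j"
      by blast
    have "\<exists>w\<in>V. h i = w * h l" if l: "l \<in> insert i J" for l
    proof (cases "l = i")
      case True
      then show ?thesis
        using subring_one[OF V_ring] by (auto intro!: bexI[of _ 1])
    next
      case False
      then obtain w where "w \<in> V" "h j = w * h l"
        using j l by blast
      then show ?thesis
        using v subring_mult[OF V_ring] by (intro bexI[of _ "v * w"]) (auto simp: mult.assoc)
    qed
    then show ?thesis
      by blast
  qed (use j in blast)
qed

context
  fixes J :: "'i set" and A :: "'i \<Rightarrow> 'a" and e :: "'i \<Rightarrow> 'i \<Rightarrow> int" and m :: int
    and f :: "'a \<Rightarrow> 'a"
  assumes J: "finite J" "card J > 1" and m: "m \<ge> 0"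
    and A: "\<And>j. j \<in> J \<Longrightarrow> A j \<in> fraction_field Fq s" "\<And>j. j \<in> J \<Longrightarrow> A j \<in> D m"
    and e: "\<And>i j. i \<in> J \<Longrightarrow> j \<in> J \<Longrightarrow> i \<noteq> j \<Longrightarrow> exact (A i - A j) (e i j)"
    and e_nonneg: "\<And>i j. i \<in> J \<Longrightarrow> j \<in> J \<Longrightarrow> e i j \<ge> 0"
    and ineq: "\<And>i j. i \<in> J \<Longrightarrow> j \<in> J \<Longrightarrow> i \<noteq> j \<Longrightarrow> e i j + (\<Sum>l\<in>J - {j}. e l j) > m"
  defines "f \<equiv> \<lambda>z. \<Prod>j\<in>J. z - A j"
begin

text \<open>The order of the derivative of \<open>f\<close> at \<open>A j\<close>, which is the
  product of the \<open>A j - A l\<close> with \<open>l \<noteq> j\<close>; so it measures the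
  expansion near this root. In the application, \<open>A j\<close> is \<open>\<alpha> j\<close> at
  \<open>s\<close>, and \<open>e i j\<close> is the degree of
  \<open>\<alpha> i - \<alpha> j\<close>.\<close>

definition root_weight :: "'i \<Rightarrow> int"
  where "root_weight j = (\<Sum>l\<in>J - {j}. e l j)"

text \<open>Since \<open>e i j\<close> is one of the summands of the weight, the inequality shows
  that twice the weight exceeds \<open>m\<close>.\<close>

lemma root_weight_pos:
  assumes j: "j \<in> J"
  shows "root_weight j \<ge> 1"
proof -
  have "card (J - {j}) > 0"
    using J j by simp
  then obtain i where i: "i \<in> J" "i \<noteq> j"
    by (metis Diff_iff card_gt_0_iff ex_in_conv singletonI)
  have "e i j \<le> root_weight j"
    unfolding root_weight_def using i J j e_nonneg by (intro member_le_sum) auto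
  then show ?thesis
    using ineq[OF i(1) j i(2)] m by (simp add: root_weight_def)
qed

text \<open>Each factor \<open>z - A l\<close> has the size of \<open>z\<close>. Two of them beat
  \<open>z\<close>, and the remaining ones only enlarge the product: if \<open>f z / z\<close> were
  in \<open>V\<close>, so would be \<open>z - A j\<close>.\<close>

lemma escape:
  assumes z: "z \<notin> D m"
  shows "f z / z \<notin> V" "f z \<notin> D m"
proof -
  have z0: "z \<noteq> 0"
    using z D_zero by blast
  have diff: "z - A j \<notin> D m" if "j \<in> J" for j
    using D_add[OF _ A(2)[OF that], of "z - A j"] z by auto
  have inv: "inverse (z - A j) \<in> D (- m)" if "j \<in> J" for j
    using D_not_imp_inverse[OF diff[OF that]] .
  then have invV: "inverse (z - A j) \<in> V" if "j \<in> J" for j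
    using D_mono[of "- m" 0] m that by (auto simp: D_0)
  have nz: "z - A j \<noteq> 0" if "j \<in> J" for j
    using diff[OF that] D_zero by metis
  obtain i where i: "i \<in> J"
    using J by fastforce
  have "card (J - {i}) > 0"
    using J i by simp
  then obtain j where j: "j \<in> J - {i}"
    by (metis card_gt_0_iff ex_in_conv)
  define w where "w = (\<Prod>l\<in>J - {i} - {j}. inverse (z - A l))"
  have w: "w \<in> V"
    unfolding w_def using invV V_ring by (intro subring_prod) auto
  have "f z = (z - A i) * ((z - A j) * (\<Prod>l\<in>J - {i} - {j}. z - A l))"
    using J i j unfolding f_def by (metis finite_Diff prod.remove)
  moreover have "(\<Prod>l\<in>J - {i} - {j}. z - A l) * w = 1"
    unfolding w_def prod.distrib[symmetric] using nz by (intro prod.neutral ballI right_inverse) auto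
  ultimately have fz: "f z * w = (z - A i) * (z - A j)"
    by (simp only: mult.assoc mult_1_right)
  have v: "1 + A i * inverse (z - A i) \<in> V"
    using D_mult[OF A(2)[OF i] inv[OF i]] V_ring by (auto simp: D_0 intro: subring_add subring_one)
  have "z - A j = f z / z * w * (1 + A i * inverse (z - A i))"
  proof -
    have "f z / z * w * (1 + A i * inverse (z - A i)) = (z - A i) * (z - A j) / z * (z * inverse (z - A i))"
      using nz[OF i] by (simp add: fz[symmetric] field_simps)
    then show ?thesis
      using nz[OF i] z0 by simp
  qed
  moreover have "z - A j \<notin> V"
    using diff[of j] j D_mono[of 0 m "z - A j"] m by (auto simp: D_0)
  ultimately show fV: "f z / z \<notin> V"
    using w v V_ring by (metis subring_mult)
  show "f z \<notin> D m"
    using D_mult[OF _ D_not_imp_inverse[OF z], of "f z" m] fV by (auto simp: D_0 divide_inverse)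
qed

lemma iterate_escape:
  assumes z: "z \<notin> D m" and "n > 0"
  shows "(f ^^ n) z / z \<notin> V"
  using assms(2,1)
proof (induction n arbitrary: z rule: nat_induct_non_zero)
  case 1
  then show ?case
    using escape by simp
next
  case (Suc n)
  have "f z \<noteq> 0"
    using escape(2)[OF Suc.prems] D_zero by metis
  have 1: "(f ^^ n) (f z) / f z \<notin> V" "f z / z \<notin> V"
    using Suc escape by auto
  then have "inverse ((f ^^ n) (f z) / f z) \<in> V"
    using valuation_ring_inverse[OF V(1)] by blast
  moreover have "f z / z = inverse ((f ^^ n) (f z) / f z) * ((f ^^ n) (f z) / z)"
    using \<open>f z \<noteq> 0\<close> 1 subring_zero[OF V_ring] by (cases "(f ^^ n) (f z) = 0") auto
  ultimately have "(f ^^ n) (f z) / z \<notin> V"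
    using 1(2) subring_mult[OF V_ring] by metis
  then show ?case
    by (simp add: funpow_swap1)
qed

text \<open>Outside \<open>D m\<close> the orbit grows strictly in absolute value and never returns
  to an earlier point.\<close>

lemma bounded_orbit:
  assumes fin: "finite (range (\<lambda>n. (f ^^ n) x))"
  shows "(f ^^ n) x \<in> D m"
proof (rule ccontr)
  assume n: "(f ^^ n) x \<notin> D m"
  have "(f ^^ i) ((f ^^ n) x) \<notin> D m" for i
    using n escape(2) by (induction i) auto
  then have "inj (\<lambda>i. (f ^^ i) ((f ^^ n) x))"
  proof (intro linorder_injI)
    fix i j :: nat
    assume notin: "\<And>i. (f ^^ i) ((f ^^ n) x) \<notin> D m" and ij: "i < j"
    let ?z = "(f ^^ i) ((f ^^ n) x)"
    have "(f ^^ (j - i)) ?z / ?z \<notin> V"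
      using ij notin by (intro iterate_escape) auto
    moreover have "(f ^^ (j - i)) ?z = (f ^^ j) ((f ^^ n) x)"
      using ij by (metis comp_apply funpow_add le_add_diff_inverse2 less_imp_le)
    moreover have "?z \<noteq> 0"
      using notin D_zero by metis
    ultimately show "?z \<noteq> (f ^^ j) ((f ^^ n) x)"
      using subring_one[OF V_ring] by auto
  qed
  moreover have "range (\<lambda>i. (f ^^ i) ((f ^^ n) x)) \<subseteq> range (\<lambda>n. (f ^^ n) x)"
    by (auto simp flip: funpow_add[THEN fun_cong, unfolded comp_def])
  ultimately show False
    using fin by (meson finite_subset infinite_UNIV_nat range_inj_infinite)
qed

text \<open>If \<open>A j\<close> is the root nearest to \<open>y\<close>, then \<open>y\<close> is
  at least as far from any other root \<open>A l\<close> as \<open>A j\<close> is. So the factors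
  with \<open>l \<noteq> j\<close> account for an order of at least \<open>root_weight j\<close> in
  \<open>f y\<close>.\<close>

lemma nearest_root:
  assumes y: "f y \<in> D m"
  shows "\<exists>j\<in>J. y - A j \<in> D (m - root_weight j)"
proof -
  obtain j where j: "j \<in> J" "\<And>l. l \<in> J \<Longrightarrow> \<exists>v\<in>V. y - A j = v * (y - A l)"
    using V_multiple_least[of J "\<lambda>j. y - A j"] J by force
  have l: "y - A l \<noteq> 0 \<and> inverse (y - A l) \<in> D (- e l j)" if l: "l \<in> J - {j}" for l
  proof -
    obtain v where v: "v \<in> V" "y - A j = v * (y - A l)"
      using j(2) l by blast
    have eq: "A l - A j = (v - 1) * (y - A l)"
      using v(2) by (simp add: algebra_simps)
    have ex: "exact (A l - A j) (e l j)"
      using e l j(1) by blast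
    then have nz: "(v - 1) * (y - A l) \<noteq> 0"
      unfolding eq by (simp add: exact_def)
    then have "v - 1 \<noteq> 0"
      by auto
    then have "inverse (y - A l) = (v - 1) * inverse (A l - A j)"
      unfolding eq by (simp add: mult.assoc[symmetric] del: right_diff_distrib left_diff_distrib)
    moreover have "(v - 1) * inverse (A l - A j) \<in> D (0 + - e l j)"
      using v(1) ex V_ring by (intro D_mult) (auto simp: D_0 exact_def intro: subring_diff subring_one)
    ultimately show ?thesis
      using nz by simp
  qed
  have "(\<Prod>l\<in>J - {j}. inverse (y - A l)) \<in> D (\<Sum>l\<in>J - {j}. - e l j)"
    using l J by (intro D_prod) auto
  then have "f y * (\<Prod>l\<in>J - {j}. inverse (y - A l)) \<in> D (m - root_weight j)"
    using D_mult[OF y, of _ "- root_weight j"] by (simp add: root_weight_def sum_negf)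
  moreover have "(\<Prod>l\<in>J - {j}. y - A l) * (\<Prod>l\<in>J - {j}. inverse (y - A l)) = 1"
    unfolding prod.distrib[symmetric] using l by (intro prod.neutral ballI right_inverse) auto
  then have "f y * (\<Prod>l\<in>J - {j}. inverse (y - A l)) = y - A j"
    unfolding f_def prod.remove[OF J(1) j(1)] by (simp only: mult.assoc mult_1_right)
  ultimately show ?thesis
    using j(1) by auto
qed

text \<open>Near a root \<open>A j\<close>, the map \<open>f\<close> is an expansion, and one step of the inverse branch
  \<open>y = A j + f y / (\<Prod>l\<noteq>j. y - A l)\<close> gains a factor \<open>s\<close> in the accuracy of an approximation.\<close>

lemma improve_approximation:
  assumes j: "j \<in> J" and y: "y - A j \<in> D (m - root_weight j)"
    and \<xi>: "\<xi> \<in> fraction_field Fq s" "y - \<xi> \<in> D (m - root_weight j - c)" and c: "c \<ge> 0"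
    and \<eta>: "\<eta> \<in> fraction_field Fq s" "f y - \<eta> \<in> D (m - 1 - c)"
  shows "\<exists>\<xi>'\<in>fraction_field Fq s. y - \<xi>' \<in> D (m - root_weight j - (c + 1))"
proof -
  note R = subfield_subring[OF subfield_Fqs]
  define p where "p = (\<lambda>z. \<Prod>l\<in>J - {j}. z - A l)"
  \<comment> \<open>The decisive use of the inequality on degrees: the disc around
    \<open>A j\<close> that contains \<open>y\<close> is too small to reach another root.\<close>
  have small: "m - root_weight j \<le> e l j - 1" if "l \<in> J - {j}" for l
    using ineq[of l j] that j by (auto simp: root_weight_def)
  have exy: "exact (y - A l) (e l j)" if l: "l \<in> J - {j}" for l
  proof -
    have "exact (A j - A l) (e l j)"
      using exact_uminus[OF e[of l j]] l j by auto
    then have "exact ((A j - A l) + (y - A j)) (e l j)"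
      using y small[OF l] by (intro exact_add D_mono[OF _ y]) auto
    then show ?thesis
      by simp
  qed
  have ex\<xi>: "exact (\<xi> - A l) (e l j)" if l: "l \<in> J - {j}" for l
  proof -
    have "exact ((y - A l) + - (y - \<xi>)) (e l j)"
      using exy[OF l] small[OF l] c by (intro exact_add D_uminus D_mono[OF _ \<xi>(2)]) auto
    then show ?thesis
      by simp
  qed
  have p\<xi>: "exact (p \<xi>) (root_weight j)"
    unfolding p_def root_weight_def using ex\<xi> J by (intro exact_prod) auto
  have fy: "f y = (y - A j) * p y"
    unfolding f_def p_def using J j by (metis prod.remove)
  \<comment> \<open>The factors are changed from \<open>y\<close> to \<open>\<xi>\<close> one at a
    time. The gain of one order comes from \<open>y - A j\<close>, which by \<open>small\<close> has
    order at most \<open>e l j - 1\<close>.\<close>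
  have "(y - A j) * ((\<Prod>l\<in>S. \<xi> - A l) - (\<Prod>l\<in>S. y - A l)) \<in> D ((\<Sum>l\<in>S. e l j) + (m - root_weight j - c - 1))"
    if "S \<subseteq> J - {j}" for S
    using finite_subset[OF that] J(1) that
  proof (induction S rule: infinite_finite_induct)
    case (insert l S)
    let ?a = "\<Prod>l\<in>S. \<xi> - A l" and ?b = "\<Prod>l\<in>S. y - A l"
    have l: "l \<in> J - {j}"
      using insert by auto
    have 1: "(\<xi> - A l) * ((y - A j) * (?a - ?b)) \<in> D (e l j + ((\<Sum>l\<in>S. e l j) + (m - root_weight j - c - 1)))"
      using insert.IH insert.prems by (intro D_mult[OF exact_imp_D[OF ex\<xi>[OF l]]]) auto
    have "(y - A j) * - (y - \<xi>) \<in> D ((e l j - 1) + (m - root_weight j - c))"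
      using D_mono[OF small[OF l] y] \<xi>(2) by (intro D_mult D_uminus)
    moreover have "?b \<in> D (\<Sum>l\<in>S. e l j)"
      using insert exact_imp_D[OF exy] by (intro D_prod) auto
    ultimately have 2: "(y - A j) * - (y - \<xi>) * ?b \<in> D ((e l j - 1) + (m - root_weight j - c) + (\<Sum>l\<in>S. e l j))"
      by (rule D_mult)
    have "(\<xi> - A l) * ((y - A j) * (?a - ?b)) + (y - A j) * - (y - \<xi>) * ?b
        \<in> D (e l j + ((\<Sum>l\<in>S. e l j) + (m - root_weight j - c - 1)))"
      using 1 2 by (intro D_add) (auto simp: algebra_simps)
    moreover have "(\<xi> - A l) * ((y - A j) * (?a - ?b)) + (y - A j) * - (y - \<xi>) * ?b
        = (y - A j) * ((\<xi> - A l) * ?a - (y - A l) * ?b)"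
      by (simp add: algebra_simps)
    ultimately show ?case
      using insert by (simp add: algebra_simps)
  qed (auto simp: D_zero)
  from this[of "J - {j}"] have pdiff: "(y - A j) * (p \<xi> - p y) \<in> D (m - 1 - c)"
    by (simp add: p_def root_weight_def algebra_simps)
  define \<xi>' where "\<xi>' = A j + \<eta> * inverse (p \<xi>)"
  have "p \<xi> \<in> fraction_field Fq s"
    unfolding p_def using \<xi>(1) A(1) R by (intro subring_prod subring_diff) auto
  then have "\<xi>' \<in> fraction_field Fq s"
    unfolding \<xi>'_def using \<eta>(1) A(1)[OF j] R
    by (intro subring_add subring_mult subfield_inverse[OF subfield_Fqs])
  moreover have "y - \<xi>' = ((f y - \<eta>) + (y - A j) * (p \<xi> - p y)) * inverse (p \<xi>)"
    using p\<xi> unfolding \<xi>'_def fy by (simp add: exact_def field_simps)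
  moreover have "((f y - \<eta>) + (y - A j) * (p \<xi> - p y)) * inverse (p \<xi>) \<in> D ((m - 1 - c) + - root_weight j)"
    using \<eta>(2) pdiff p\<xi> by (intro D_mult D_add) (auto simp: exact_def)
  ultimately have "y - \<xi>' \<in> D ((m - 1 - c) + - root_weight j)"
    by simp
  moreover have "(m - 1 - c) + - root_weight j = m - root_weight j - (c + 1)"
    by simp
  ultimately show ?thesis
    using \<open>\<xi>' \<in> fraction_field Fq s\<close> by (metis (no_types))
qed

text \<open>Induction on the accuracy \<open>c\<close>, for all points of the orbit at once: an
  approximation of the next point is pulled back along the inverse branch. The first approximation
  is the nearby root itself.\<close>

lemma preperiodic_approximable:
  assumes fin: "finite (range (\<lambda>n. (f ^^ n) x))"
  shows "x \<in> approximable" "x \<in> D m"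
proof -
  have orbit: "(f ^^ n) x \<in> D m" for n
    using bounded_orbit[OF fin] .
  show "x \<in> D m"
    using orbit[of 0] by simp
  have main: "\<exists>\<xi>\<in>fraction_field Fq s. (f ^^ n) x - \<xi> \<in> D (m - root_weight j - int c)"
    if "j \<in> J" "(f ^^ n) x - A j \<in> D (m - root_weight j)" for n j c
    using that
  proof (induction c arbitrary: n j)
    case 0
    then show ?case
      using A(1) by auto
  next
    case (Suc c)
    have "f ((f ^^ n) x) = (f ^^ Suc n) x" "(f ^^ Suc (Suc n)) x = f ((f ^^ Suc n) x)"
      by auto
    then have "f ((f ^^ Suc n) x) \<in> D m"
      using orbit by metis
    then obtain i where i: "i \<in> J" "(f ^^ Suc n) x - A i \<in> D (m - root_weight i)"
      using nearest_root by blast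
    obtain \<eta> where \<eta>: "\<eta> \<in> fraction_field Fq s" "(f ^^ Suc n) x - \<eta> \<in> D (m - root_weight i - int c)"
      using Suc.IH[OF i] by blast
    obtain \<xi> where \<xi>: "\<xi> \<in> fraction_field Fq s" "(f ^^ n) x - \<xi> \<in> D (m - root_weight j - int c)"
      using Suc.IH[OF Suc.prems] by blast
    \<comment> \<open>The accuracy at the next point refers to its own root \<open>i\<close>; as
      \<open>root_weight i \<ge> 1\<close>, it is sufficient for the inverse branch at
      \<open>j\<close>.\<close>
    have "f ((f ^^ n) x) - \<eta> \<in> D (m - 1 - int c)"
      using D_mono[OF _ \<eta>(2), of "m - 1 - int c"] root_weight_pos[OF i(1)] by simp
    then show ?case
      using improve_approximation[OF Suc.prems \<xi> _ \<eta>(1)] by (simp add: add.commute)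
  qed
  have "f x \<in> D m"
    using orbit[of 1] by simp
  then obtain j where j: "j \<in> J" "x - A j \<in> D (m - root_weight j)"
    using nearest_root by blast
  show "x \<in> approximable"
    unfolding approximable_def mem_Collect_eq
  proof
    fix n
    obtain \<xi> where \<xi>: "\<xi> \<in> fraction_field Fq s" "x - \<xi> \<in> D (m - root_weight j - int (nat (m - n)))"
      using main[of j 0 "nat (m - n)"] j by auto
    have "m - root_weight j - int (nat (m - n)) \<le> n"
      using root_weight_pos[OF j(1)] by linarith
    then show "\<exists>\<xi>\<in>fraction_field Fq s. x - \<xi> \<in> D n"
      using \<xi> D_mono by blast
  qed
qed

end

end

section \<open>Algebraicity, powers of minimal polynomials, lifts of coefficients\<close>

lemma algebraic_if_powers_in_span:
  assumes F: "is_subfield F" and I: "finite I" and span: "\<And>i. y ^ i \<in> lin_span F I w"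
  shows "algebraic_over F y"
proof -
  note R = subfield_subring[OF F]
  have "\<not> lin_indep_on F {..card I} (\<lambda>i. y ^ i)"
    using card_indep_le_card_span[OF F _ I, of "{..card I}" "\<lambda>i. y ^ i" w] span by auto
  then obtain c where c: "\<forall>i\<in>{..card I}. c i \<in> F" "(\<Sum>i\<le>card I. c i * y ^ i) = 0"
    "\<not> (\<forall>i\<in>{..card I}. c i = 0)"
    unfolding lin_indep_on_def by blast
  define g where "g = (\<Sum>i\<le>card I. monom (c i) i)"
  have "coeff g i = (if i \<le> card I then c i else 0)" for i
    by (simp add: g_def coeff_sum)
  then have "g \<noteq> 0"
    using c(3) by (metis atMost_iff coeff_0)
  moreover have "poly_over F g"
    unfolding g_def using c(1) R by (intro poly_over_sum poly_over_monom) auto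
  moreover have "poly g y = 0"
    using c(2) by (simp add: g_def poly_sum poly_monom)
  ultimately show ?thesis
    by (auto simp: algebraic_over_def)
qed

text \<open>Every root of \<open>p\<close> has minimal polynomial \<open>Q\<close>, so
  \<open>Q\<close> can be divided off until nothing is left.\<close>

lemma min_poly_power:
  fixes F :: "'a::field set"
  assumes ac: "algebraically_closed_type TYPE('a)" and F: "is_subfield F"
    and Q: "min_poly F t Q"
    and p: "poly_over F p" "lead_coeff p = 1" and roots: "\<And>z. poly p z = 0 \<Longrightarrow> poly Q z = 0"
  obtains n where "p = Q ^ n"
proof -
  have "\<exists>n. p = Q ^ n"
    using p roots
  proof (induction "degree p" arbitrary: p rule: less_induct)
    case less
    show ?case
    proof (cases "degree p = 0")
      case True
      then have "p = Q ^ 0"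
        using less.prems(2) by (metis degree_eq_zeroE lead_coeff_pCons(2) one_pCons power_0)
      then show ?thesis ..
    next
      case False
      then obtain z where z: "poly p z = 0"
        using ac by (auto simp: algebraically_closed_type_def)
      then have mz: "min_poly F z Q"
        using min_poly_conjugate[OF F Q] less.prems(3) by blast
      obtain h where h: "poly_over F h" "p = Q * h"
        using min_poly_dvd[OF F mz less.prems(1) z] by blast
      have nz: "h \<noteq> 0" "Q \<noteq> 0"
        using h less.prems(2) by auto
      have "degree p = degree Q + degree h"
        using nz h by (simp add: degree_mult_eq)
      then have "degree h < degree p"
        using min_poly_degree_pos[OF F Q] by simp
      moreover have "lead_coeff h = 1"
        using less.prems(2) min_poly_monic[OF F Q] by (simp add: h(2) lead_coeff_mult)
      ultimately obtain n where "h = Q ^ n"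
        using less.hyps[of h] h less.prems(3) by auto
      then have "p = Q ^ Suc n"
        using h by simp
      then show ?thesis ..
    qed
  qed
  then show ?thesis
    using that by blast
qed

text \<open>The lifts will be evaluated at other conjugates of \<open>x\<close>. Lifting the leading
  \<open>1\<close> to \<open>1\<close>, and the coefficients above the degree to \<open>0\<close>,
  keeps the resulting polynomials monic of the same degree.\<close>

lemma coefficient_lift:
  assumes p: "poly_over (adjoin F x) p" and R: "is_subring F"
  obtains g where "\<And>i. poly_over F (g i)" "\<And>i. coeff p i = poly (g i) x"
    "\<And>i. i > degree p \<Longrightarrow> g i = 0" "lead_coeff p = 1 \<Longrightarrow> g (degree p) = 1"
proof -
  have "\<exists>g. poly_over F g \<and> coeff p i = poly g x" for i
    using poly_over_coeff[OF subring_adjoin[OF R] p, of i] by (auto simp: adjoin_def)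
  then obtain h where h: "\<And>i. poly_over F (h i)" "\<And>i. coeff p i = poly (h i) x"
    by metis
  define g where "g = (\<lambda>i. if i > degree p then 0 else if coeff p i = 1 then 1 else h i)"
  show ?thesis
  proof (rule that[of g])
    show "poly_over F (g i)" for i
      using h(1) R by (auto simp: g_def poly_over_0 poly_over_1)
    show "coeff p i = poly (g i) x" for i
      using h(2)[of i] coeff_eq_0[of p i] by (cases "degree p < i") (auto simp: g_def)
  qed (auto simp: g_def)
qed

definition poly_of_coeffs :: "nat \<Rightarrow> (nat \<Rightarrow> 'a::field) \<Rightarrow> 'a poly"
  where "poly_of_coeffs n c = (\<Sum>i\<le>n. monom (c i) i)"

lemma coeff_poly_of_coeffs: "coeff (poly_of_coeffs n c) i = (if i \<le> n then c i else 0)"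
  by (simp add: poly_of_coeffs_def coeff_sum)

lemma poly_of_coeffs_monic:
  assumes "c n = 1"
  shows "lead_coeff (poly_of_coeffs n c) = 1" "degree (poly_of_coeffs n c) = n"
proof -
  show deg: "degree (poly_of_coeffs n c) = n"
    using assms by (intro antisym degree_le le_degree) (auto simp: coeff_poly_of_coeffs)
  show "lead_coeff (poly_of_coeffs n c) = 1"
    using assms by (simp add: deg coeff_poly_of_coeffs)
qed

lemma monic_prod_list: "(\<And>p. p \<in> set ps \<Longrightarrow> lead_coeff p = (1::'a::field)) \<Longrightarrow> lead_coeff (prod_list ps) = 1"
  by (induction ps) (auto simp: lead_coeff_mult)

lemma degree_monic_prod_list:
  "(\<And>p. p \<in> set ps \<Longrightarrow> lead_coeff p = (1::'a::field) \<and> degree p = n) \<Longrightarrow> degree (prod_list ps) = length ps * n"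
proof (induction ps)
  case (Cons p ps)
  have "lead_coeff (prod_list ps) = 1"
    using Cons.prems by (intro monic_prod_list) auto
  then have "prod_list ps \<noteq> 0" "p \<noteq> 0"
    using Cons.prems[of p] by auto
  moreover have "degree (prod_list ps) = length ps * n"
    using Cons.prems by (intro Cons.IH) auto
  ultimately show ?case
    using Cons.prems[of p] by (simp add: degree_mult_eq)
qed simp

lemma prod_list_filter:
  "(\<Prod>x\<leftarrow>xs. f x) = (\<Prod>x\<leftarrow>filter Q xs. f x) * (\<Prod>x\<leftarrow>filter (\<lambda>x. \<not> Q x) xs. f x)"
  for f :: "'b \<Rightarrow> 'a::comm_monoid_mult"
  by (induction xs) (auto simp: ac_simps)

lemma prod_list_distrib: "(\<Prod>x\<leftarrow>xs. f x * g x) = (\<Prod>x\<leftarrow>xs. f x) * (\<Prod>x\<leftarrow>xs. g x)"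
  for f :: "'b \<Rightarrow> 'a::comm_monoid_mult"
  by (induction xs) (auto simp: ac_simps)

section \<open>Polynomials in s of bounded degree\<close>

context function_field
begin

text \<open>The functions on the line whose only pole is at infinity, of order at most
  \<open>b\<close>.\<close>

definition polys :: "nat \<Rightarrow> 'a set"
  where "polys b = {poly g s |g. poly_over k g \<and> degree g \<le> b}"

lemma polys_subset: "polys b \<subseteq> adjoin k s"
  by (auto simp: polys_def adjoin_def)

lemma polys_subset_F: "polys b \<subseteq> F"
  using polys_subset adjoin_subset_fraction_field[OF k_ring] by blast

lemma polys_mult: "x \<in> polys a \<Longrightarrow> y \<in> polys b \<Longrightarrow> x * y \<in> polys (a + b)"
  unfolding polys_def using k_ring
  by safe (metis (mono_tags, lifting) add_mono degree_mult_le order_trans poly_mult poly_over_mult)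

lemma polys_sum: "(\<And>i. i \<in> I \<Longrightarrow> f i \<in> polys b) \<Longrightarrow> sum f I \<in> polys b"
proof (induction I rule: infinite_finite_induct)
  case (insert i I)
  have "f i \<in> polys b" "sum f I \<in> polys b"
    using insert by auto
  then obtain g h where "poly_over k g" "degree g \<le> b" "f i = poly g s"
    "poly_over k h" "degree h \<le> b" "sum f I = poly h s"
    unfolding polys_def by blast
  then show ?case
    using insert k_ring by (auto simp: polys_def intro!: exI[of _ "g + h"] poly_over_add degree_add_le)
qed (auto simp: polys_def k_ring intro!: exI[of _ 0] poly_over_0)

lemma coeffs_polys_mult:
  "(\<And>i. coeff p i \<in> polys a) \<Longrightarrow> (\<And>i. coeff r i \<in> polys b) \<Longrightarrow> coeff (p * r) i \<in> polys (a + b)"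
  unfolding coeff_mult by (intro polys_sum polys_mult) auto

lemma coeffs_polys_power: "(\<And>i. coeff p i \<in> polys b) \<Longrightarrow> coeff (p ^ n) i \<in> polys (n * b)"
proof (induction n arbitrary: i)
  case 0
  show ?case
    using k_ring by (auto simp: polys_def intro!: exI[of _ "if i = 0 then 1 else 0"] poly_over_0 poly_over_1)
next
  case (Suc n)
  then show ?case
    using coeffs_polys_mult[of p b "p ^ n" "n * b" i] by simp
qed

lemma subst_power_polys:
  assumes "n > 0" "y \<in> polys b"
  shows "subst_power n y \<in> polys (n * b)"
proof -
  obtain g where g: "poly_over k g" "degree g \<le> b" "y = poly g s"
    using assms(2) by (auto simp: polys_def)
  have "subst_power n y = poly (pcompose g (monom 1 n)) s"
    using g assms(1) by (simp add: subst_power_poly poly_pcompose poly_monom)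
  moreover have "poly_over k (pcompose g (monom 1 n))"
    using g k_ring by (intro poly_over_pcompose poly_over_monom subring_one)
  moreover have "degree (pcompose g (monom 1 n)) \<le> n * b"
    using g by (simp add: degree_pcompose degree_monom_eq)
  ultimately show ?thesis
    by (auto simp: polys_def)
qed

text \<open>The minimal relation of \<open>s\<close> over \<open>k(t)\<close>, cleared of denominators, is read as a relation for
  \<open>t\<close> over \<open>k[s]\<close>.\<close>

lemma relation_over_polys:
  assumes t: "t \<notin> k" and r: "min_poly (fraction_field k t) s r"
  obtains p where "p \<noteq> 0" "poly p t = 0" "\<And>i. coeff p i \<in> polys (degree r)"
proof -
  note KT = subfield_fraction_field[OF k_ring, of t]
  define \<beta> where "\<beta> = degree r"
  have "\<exists>a b. poly_over k a \<and> poly_over k b \<and> b \<noteq> 0 \<and> coeff r j = poly a t / poly b t" for j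
  proof -
    obtain a b where ab: "poly_over k a" "poly_over k b" "coeff r j = poly a t / poly b t"
      using poly_over_coeff[OF subfield_subring[OF KT] min_poly_over[OF KT r], of j]
      by (auto simp: fraction_field_def)
    show ?thesis
    proof (cases "b = 0")
      case True
      then show ?thesis
        using ab k_ring by (intro exI[of _ 0] exI[of _ 1]) (auto intro: poly_over_0 poly_over_1)
    qed (use ab in blast)
  qed
  then obtain a b where ab: "\<And>j. poly_over k (a j)" "\<And>j. poly_over k (b j)" "\<And>j. b j \<noteq> 0"
    "\<And>j. coeff r j = poly (a j) t / poly (b j) t"
    by metis
  \<comment> \<open>A common denominator of the coefficients of \<open>r\<close>; the
    \<open>h j\<close> are the numerators over it.\<close>
  define d where "d = (\<Prod>j\<le>\<beta>. b j)"
  define h where "h = (\<lambda>j. a j * (\<Prod>i\<in>{..\<beta>} - {j}. b i))"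
  have d: "poly_over k d" "d \<noteq> 0"
    unfolding d_def using ab k_ring by (auto intro: poly_over_prod)
  then have dt: "poly d t \<noteq> 0"
    using transcendental_not_in[OF t] by blast
  have bt: "poly (b j) t \<noteq> 0" for j
    using ab transcendental_not_in[OF t] by blast
  have h: "poly_over k (h j)" for j
    unfolding h_def using ab k_ring by (auto intro: poly_over_prod poly_over_mult)
  have ht: "poly (h j) t = coeff r j * poly d t" if "j \<le> \<beta>" for j
  proof -
    have "d = b j * (\<Prod>i\<in>{..\<beta>} - {j}. b i)"
      unfolding d_def using that by (intro prod.remove) auto
    then show ?thesis
      using bt[of j] by (simp add: h_def ab(4))
  qed
  define p where "p = (\<Sum>j\<le>\<beta>. smult (s ^ j) (h j))"
  define c where "c = (\<lambda>i. \<Sum>j\<le>\<beta>. monom (coeff (h j) i) j)"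
  have c: "poly_over k (c i)" "coeff p i = poly (c i) s" "degree (c i) \<le> \<beta>" for i
    unfolding c_def p_def using h k_ring
    by (auto simp: coeff_sum poly_sum poly_monom mult.commute poly_over_coeff
        intro!: poly_over_sum poly_over_monom degree_sum_le order_trans[OF degree_monom_le])
  have "poly p t = (\<Sum>j\<le>\<beta>. coeff r j * s ^ j) * poly d t"
    by (simp add: p_def poly_sum ht sum_distrib_left sum_distrib_right ac_simps)
  also have "(\<Sum>j\<le>\<beta>. coeff r j * s ^ j) = 0"
    using min_poly_root[OF KT r] by (simp add: poly_altdef \<beta>_def)
  finally have "poly p t = 0"
    by simp
  moreover have "p \<noteq> 0"
  proof
    \<comment> \<open>As \<open>s\<close> is transcendental over \<open>k\<close>, all
      \<open>h j\<close> with \<open>j \<le> \<beta>\<close> would vanish. But \<open>r\<close> is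
      monic, so \<open>h \<beta>\<close> and \<open>d\<close> have the same nonzero value at
      \<open>t\<close>.\<close>
    assume "p = 0"
    then have "c i = 0" for i
      using c[of i] transcendental_not_in[OF s] by simp
    then have "coeff (c i) \<beta> = 0" for i
      by simp
    then have "coeff (h \<beta>) i = 0" for i
      by (simp add: c_def coeff_sum)
    then have "h \<beta> = 0"
      by (intro poly_eqI) simp
    then show False
      using ht[of \<beta>] dt min_poly_monic[OF KT r] by (simp add: \<beta>_def)
  qed
  moreover have "coeff p i \<in> polys (degree r)" for i
    using c[of i] by (auto simp: polys_def \<beta>_def)
  ultimately show ?thesis
    using that by blast
qed

end

context infinite_place
begin

lemma polys_subset_D: "polys b \<subseteq> D (int b)"
proof
  fix y
  assume "y \<in> polys b"
  then obtain g where g: "poly_over k g" "degree g \<le> b" "y = poly g s"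
    by (auto simp: polys_def)
  then show "y \<in> D (int b)"
    using D_mono[OF _ exact_imp_D[OF exact_poly[OF g(1)]], of "int b"] D_zero
    by (cases "g = 0") auto
qed

end

text \<open>The values \<open>poly (M y) c\<close> may have poles, but the leading coefficient of \<open>Q\<close> absorbs any
  selection of them at once.\<close>

lemma valuation_ring_bounded_product:
  fixes W :: "'a::field set" and M :: "'a \<Rightarrow> 'a poly"
  assumes ac: "algebraically_closed_type TYPE('a)" and W: "valuation_ring W"
    and Q: "poly_over W (smult \<kappa> Q)" "Q = (\<Prod>y\<leftarrow>ys. M y) * C" "Q \<noteq> 0"
    and M: "\<And>y. lead_coeff (M y) = 1" and c: "c \<in> W"
  shows "\<kappa> * lead_coeff Q * (\<Prod>y\<leftarrow>ys. if B y then poly (M y) c else 1) \<in> W"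
proof -
  define a where "a = lead_coeff Q"
  have monic: "lead_coeff (\<Prod>y\<leftarrow>zs. M y) = 1" for zs
    using M by (intro monic_prod_list) auto
  have C: "C \<noteq> 0" "lead_coeff C = a"
    using Q monic[of ys] by (auto simp: a_def lead_coeff_mult)
  define C1 where "C1 = smult (inverse a) C"
  have C1: "C = smult a C1" "lead_coeff C1 = 1"
    using C by (auto simp: C1_def)
  \<comment> \<open>The factors outside the selection form a monic cofactor, which Gauss's lemma
    allows to drop.\<close>
  have "smult \<kappa> Q = smult (\<kappa> * a) (\<Prod>y\<leftarrow>filter B ys. M y) * ((\<Prod>y\<leftarrow>filter (\<lambda>y. \<not> B y) ys. M y) * C1)"
    unfolding Q(2) C1(1) by (subst prod_list_filter[of M ys B]) (simp add: mult.assoc)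
  then have "poly_over W (smult (\<kappa> * a) (\<Prod>y\<leftarrow>filter B ys. M y))"
    using valuation_ring_monic_factor[OF W ac] Q(1) monic C1(2) by (metis lead_coeff_mult mult_1)
  then have "poly (smult (\<kappa> * a) (\<Prod>y\<leftarrow>filter B ys. M y)) c \<in> W"
    using c valuation_ring_subring[OF W] by (intro poly_in_subring)
  moreover have "poly (\<Prod>y\<leftarrow>filter B ys. M y) c = (\<Prod>y\<leftarrow>ys. if B y then poly (M y) c else 1)"
    by (induction ys) auto
  ultimately show ?thesis
    by (simp add: a_def)
qed

context frobenius_place
begin

text \<open>A value \<open>u\<close> and its image \<open>u'\<close> under Frobenius are compared at
  infinity. Without a pole they have the same residue and their difference is small; with a pole
  both inverses are small. Either way a factor \<open>s\<close> is gained: one zero for each root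
  \<open>y\<close> of \<open>P\<close>.\<close>

lemma conjugate_values:
  assumes P: "min_poly F x P" and U: "poly_over F U" "poly U x \<notin> k"
    and y: "poly P y = 0" "y \<in> approximable"
  shows "poly U y \<noteq> 0" "inverse (poly U y) \<in> bounded_elements"
    and "poly (map_poly \<theta> U) (y ^ q) \<noteq> poly U y"
    and "poly U y \<in> V \<Longrightarrow> poly (map_poly \<theta> U) (y ^ q) \<in> V"
    and "poly U y \<notin> V \<Longrightarrow> poly (map_poly \<theta> U) (y ^ q) \<notin> V"
    and "poly U y \<in> V \<Longrightarrow> s * (poly (map_poly \<theta> U) (y ^ q) - poly U y) \<in> V"
    and "poly U y \<notin> V \<Longrightarrow> s * inverse (poly U y) \<in> V"
    and "poly U y \<notin> V \<Longrightarrow> s * inverse (poly (map_poly \<theta> U) (y ^ q)) \<in> V"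
proof -
  have Py: "min_poly F y P"
    using min_poly_conjugate[OF F P y(1)] .
  \<comment> \<open>A constant value at the conjugate \<open>y\<close> would also be the value at
    \<open>x\<close>.\<close>
  have not_const: "poly U y \<noteq> c" if c: "c \<in> k" for c
  proof
    assume "poly U y = c"
    then have "poly (U - [:c:]) y = 0" "poly_over F (U - [:c:])"
      using U c k_subset_F F_ring by (auto intro: poly_over_diff poly_over_const)
    then obtain h where "U - [:c:] = P * h"
      using min_poly_dvd[OF F Py] by blast
    then have "poly (U - [:c:]) x = 0"
      using min_poly_root[OF F P] by simp
    then show False
      using U c by simp
  qed
  show u0: "poly U y \<noteq> 0"
    using not_const subring_zero[OF k_ring] by blast
  have inv: "inverse (poly H y) \<in> bounded_elements" if "poly_over F H" for H
  proof -
    have "algebraic_over F y"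
      using min_poly_over[OF F Py] min_poly_nonzero[OF F Py] min_poly_root[OF F Py]
      by (auto simp: algebraic_over_def)
    then have "inverse (poly H y) \<in> adjoin F y"
      using that adjoinI subfield_inverse subfield_adjoin[OF F] by blast
    then show ?thesis
      using adjoin_subset[OF subring_bounded_elements F_subset_bounded] y approximable_bounded by blast
  qed
  then show "inverse (poly U y) \<in> bounded_elements"
    using U by blast
  let ?u = "poly U y" and ?u' = "poly (map_poly \<theta> U) (y ^ q)"
  obtain j where j: "exact ?u j" "exact ?u' (int q * j)"
    using leading_order[OF U(1) y(2) u0 inv[OF U(1)]] .
  have jV: "?u \<in> V \<longleftrightarrow> j \<le> 0"
    using exact_le[OF j(1), of 0] D_mono[OF _ exact_imp_D[OF j(1)], of 0] by (auto simp: D_0)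
  have sign: "int q * j \<le> 0 \<longleftrightarrow> j \<le> 0"
    using q_pos by (simp add: mult_le_0_iff)
  have jV': "?u' \<in> V \<longleftrightarrow> j \<le> 0"
    using exact_le[OF j(2), of 0] D_mono[OF _ exact_imp_D[OF j(2)], of 0] sign by (auto simp: D_0)
  show "?u \<in> V \<Longrightarrow> ?u' \<in> V" "?u \<notin> V \<Longrightarrow> ?u' \<notin> V"
    using jV jV' by auto
  have s1: "s * z \<in> V" if "z \<in> D (- 1)" for z
    using that by (simp add: D_def mult.commute)
  have diff: "?u' - ?u \<in> D (- 1)" if uV: "?u \<in> V"
  proof -
    obtain c where "c \<in> k" "?u - c \<in> D (- 1)" "?u' - c \<in> D (- 1)"
      using common_residue[OF U(1) y(2) uV] .
    then show ?thesis
      using D_diff[of "?u' - c" "- 1" "?u - c"] by simp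
  qed
  then show "?u \<in> V \<Longrightarrow> s * (?u' - ?u) \<in> V"
    using s1 by blast
  have "inverse ?u \<in> D (- 1)" "inverse ?u' \<in> D (- 1)" if "?u \<notin> V"
  proof -
    have "j \<ge> 1"
      using that jV by simp
    moreover have "1 * j \<le> int q * j"
      using q_pos \<open>j \<ge> 1\<close> by (intro mult_right_mono) auto
    ultimately have "- j \<le> - 1" "- (int q * j) \<le> - 1"
      by linarith+
    then show "inverse ?u \<in> D (- 1)" "inverse ?u' \<in> D (- 1)"
      using j D_mono unfolding exact_def by blast+
  qed
  then show "?u \<notin> V \<Longrightarrow> s * inverse ?u \<in> V" "?u \<notin> V \<Longrightarrow> s * inverse ?u' \<in> V"
    using s1 by blast+
  \<comment> \<open>The order of \<open>u'\<close> is \<open>q\<close> times that of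
    \<open>u\<close>, so equality forces order \<open>0\<close>. Applied to \<open>u - c\<close>
    with the residue \<open>c\<close>, the same argument gives order \<open>0\<close> again,
    although \<open>u - c\<close> is small.\<close>
  show "?u' \<noteq> ?u"
  proof
    assume eq: "?u' = ?u"
    have q1: "i = 0" if "i = int q * i" for i
      using that q by auto
    then have "j = 0"
      using exact_unique[OF j(1), of "int q * j"] j(2) eq by metis
    then have "?u \<in> V"
      using jV by simp
    then obtain c where c: "c \<in> k" "?u - c \<in> D (- 1)" "?u' - c \<in> D (- 1)"
      using common_residue[OF U(1) y(2)] by blast
    have Uc: "poly_over F (U - [:c:])" "poly (U - [:c:]) y = ?u - c"
      using U(1) c k_subset_F F_ring by (auto intro: poly_over_diff poly_over_const)
    have "map_poly \<theta> (U - [:c:]) = map_poly \<theta> U - [:c:]"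
      using U(1) c k_subset_F F_ring subst_power_const[OF q_pos c(1)]
      by (subst map_hom_diff[OF F theta]) (auto intro: poly_over_const simp: map_poly_pCons hom_on_0[OF F theta])
    then have "poly (map_poly \<theta> (U - [:c:])) (y ^ q) = ?u' - c"
      by simp
    moreover have "?u - c \<noteq> 0"
      using not_const[OF c(1)] by simp
    ultimately obtain i where i: "exact (?u - c) i" "exact (?u' - c) (int q * i)"
      using leading_order[OF Uc(1) y(2)] inv[OF Uc(1)] Uc(2) by metis
    then have "i = 0"
      using exact_unique[OF i(1), of "int q * i"] q1 eq by metis
    then show False
      using exact_le[OF i(1) c(2)] by simp
  qed
qed

end

context frobenius_place
begin

subsection \<open>The gonality bound\<close>

text \<open>In the proof, \<open>c\<close> is chosen such that \<open>u = poly M c\<close> is not constant. The function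
  \<open>\<Prod>y. u' y - u y\<close> compares \<open>u\<close> with its composition with the Frobenius map \<open>(s, x) \<mapsto> (s\<^sup>q, x\<^sup>q)\<close>.\<close>

lemma degree_bound:
  fixes w :: "'i \<Rightarrow> 'a"
  assumes P: "min_poly F x P" and approx: "\<And>y. poly P y = 0 \<Longrightarrow> y \<in> approximable"
    and P_coeffs: "poly_over (adjoin Fq s) P"
    and t: "t \<notin> k" and I: "finite I"
    and span: "\<And>i j. s ^ i * x ^ j \<in> lin_span (fraction_field k t) I w"
  shows "degree P \<le> (q + 1) * card I"
proof -
  define KT where "KT = fraction_field k t"
  have KT: "is_subfield KT"
    unfolding KT_def using k_ring by (rule subfield_fraction_field)
  have tKT: "t \<in> KT" and kKT: "k \<subseteq> KT"
    unfolding KT_def using k_ring self_in_fraction_field subset_fraction_field by blast+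
  have "algebraic_over KT s"
    using span[of _ 0] by (intro algebraic_if_powers_in_span[OF KT I]) (auto simp: KT_def)
  then obtain r where r: "min_poly KT s r"
    using min_poly_exists[OF KT] by blast
  obtain R where R: "R \<noteq> 0" "poly R t = 0" "\<And>i. coeff R i \<in> polys (degree r)"
    using relation_over_polys[OF t r[unfolded KT_def]] by blast
  have RF: "poly_over F R"
    using R(3) polys_subset_F F_ring by (auto simp: poly_over_iff)
  have alg_t: "algebraic_over F t"
    using R RF by (auto simp: algebraic_over_def)
  then obtain Q0 where Q0: "min_poly F t Q0"
    using min_poly_exists[OF F] by blast
  define FT where "FT = adjoin F t"
  have FT: "is_subfield FT"
    unfolding FT_def using F alg_t by (rule subfield_adjoin)
  have FFT: "F \<subseteq> FT" and tFT: "t \<in> FT"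
    unfolding FT_def using F_ring subset_adjoin self_in_adjoin by blast+
  have KTFT: "KT \<subseteq> FT"
    unfolding KT_def using fraction_field_subset[OF FT _ tFT] FFT k_subset_F by blast
  have alg_x: "algebraic_over F x"
    using min_poly_over[OF F P] min_poly_nonzero[OF F P] min_poly_root[OF F P]
    by (auto simp: algebraic_over_def)
  obtain m where m: "min_poly FT x m"
    using min_poly_exists[OF FT algebraic_over_mono[OF FFT alg_x]] .
  define FX where "FX = adjoin F x"
  have FX: "is_subfield FX"
    unfolding FX_def using F alg_x by (rule subfield_adjoin)
  have FFX: "F \<subseteq> FX" and xFX: "x \<in> FX"
    unfolding FX_def using F_ring subset_adjoin self_in_adjoin by blast+
  obtain M where M: "min_poly FX t M"
    using min_poly_exists[OF FX algebraic_over_mono[OF FFX alg_t]] .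
  \<comment> \<open>The degrees of \<open>k(t, s)\<close> over \<open>k(t)\<close>, of
    \<open>k(s, t, x)\<close> over \<open>k(s, t)\<close>, and of \<open>k(s, x, t)\<close> over
    \<open>k(s, x)\<close>.\<close>
  define \<beta> \<mu> e where "\<beta> = degree r" and "\<mu> = degree m" and "e = degree M"

  have "card ({..<\<mu>} \<times> {..<\<beta>}) \<le> card I"
  proof (rule card_indep_le_card_span[OF KT _ I])
    show "lin_indep_on KT ({..<\<mu>} \<times> {..<\<beta>}) (\<lambda>(l, j). s ^ j * x ^ l)"
      using lin_indep_on_powers[OF KT r] lin_indep_on_powers[OF FT m] FFT s_in_F
        subfield_subring[OF FT]
      by (intro lin_indep_on_tower[OF subfield_subring[OF KT] subfield_subring[OF FT] KTFT])
        (auto simp: \<beta>_def \<mu>_def intro: subring_power)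
    show "(case i of (l, j) \<Rightarrow> s ^ j * x ^ l) \<in> lin_span KT I w" for i
      using span by (auto simp: KT_def split: prod.split)
  qed auto
  then have \<beta>\<mu>: "\<mu> * \<beta> \<le> card I"
    by simp

  \<comment> \<open>The degree of \<open>k(s, x, t)\<close> over \<open>k(s)\<close>, seen through
    \<open>k(s, x)\<close> on the left and through \<open>k(s, t)\<close> on the right.\<close>
  have "card ({..<e} \<times> {..<degree P}) \<le> card ({..<\<mu>} \<times> {..<degree Q0})"
  proof (rule card_indep_le_card_span[OF F])
    show "lin_indep_on F ({..<e} \<times> {..<degree P}) (\<lambda>(l, j). x ^ j * t ^ l)"
      using lin_indep_on_powers[OF F P] lin_indep_on_powers[OF FX M] xFX
        subfield_subring[OF FX]
      by (intro lin_indep_on_tower[OF F_ring subfield_subring[OF FX] FFX])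
        (auto simp: e_def intro: subring_power)
    fix i
    have "x ^ j * t ^ l \<in> lin_span FT {..<\<mu>} (\<lambda>l. x ^ l)" for j l
    proof -
      have "poly (monom (t ^ l) j) x \<in> adjoin FT x"
        using tFT subfield_subring[OF FT] by (intro adjoinI poly_over_monom subring_power)
      then show ?thesis
        unfolding \<mu>_def adjoin_eq_lin_span[OF FT m, symmetric] by (simp add: poly_monom mult.commute)
    qed
    then have "x ^ j * t ^ l \<in> lin_span F ({..<\<mu>} \<times> {..<degree Q0}) (\<lambda>(i, j). t ^ j * x ^ i)" for j l
      using adjoin_eq_lin_span[OF F Q0] by (intro lin_span_tower[OF F_ring, of _ _ FT]) (auto simp: FT_def)
    then show "(case i of (l, j) \<Rightarrow> x ^ j * t ^ l) \<in> lin_span F ({..<\<mu>} \<times> {..<degree Q0}) (\<lambda>(i, j). t ^ j * x ^ i)"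
      by (auto split: prod.split)
  qed auto
  then have deg_le: "e * degree P \<le> \<mu> * degree Q0"
    by simp

  obtain g where g: "\<And>i. poly_over F (g i)" "\<And>i. coeff M i = poly (g i) x"
    "\<And>i. i > e \<Longrightarrow> g i = 0" "g e = 1"
    using coefficient_lift[OF min_poly_over[OF FX M, unfolded FX_def] F_ring] min_poly_monic[OF FX M]
    unfolding e_def by metis
  \<comment> \<open>\<open>conj y\<close> is the conjugate of \<open>M\<close> under
    \<open>x \<mapsto> y\<close>. In \<open>conj'\<close> also \<open>\<theta>\<close> is applied to
    the coefficients; it is meant to be evaluated at \<open>y ^ q\<close>.\<close>
  define conj where "conj = (\<lambda>y. poly_of_coeffs e (\<lambda>i. poly (g i) y))"
  define conj' where "conj' = (\<lambda>y. poly_of_coeffs e (\<lambda>i. poly (map_poly \<theta> (g i)) y))"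
  have ge': "map_poly \<theta> (g e) = 1"
    by (simp add: g(4) hom_on_1[OF F theta])
  have coeff_conj: "coeff (conj y) i = poly (g i) y" for y i
    by (simp add: conj_def coeff_poly_of_coeffs g(3))
  have monic: "lead_coeff (conj y) = 1" "degree (conj y) = e"
    "lead_coeff (conj' y) = 1" for y
    using g(4) ge' unfolding conj_def conj'_def by (auto intro!: poly_of_coeffs_monic)
  have conj_x: "conj x = M"
    by (intro poly_eqI) (simp add: coeff_conj g(2))
  \<comment> \<open>For a constant \<open>c\<close>, the value of \<open>M\<close> at
    \<open>c\<close> as a polynomial in \<open>x\<close>. This is the norm of \<open>c - t\<close>
    to \<open>k(s, x)\<close>.\<close>
  define U where "U = (\<lambda>c. \<Sum>i\<le>e. smult (c ^ i) (g i))"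
  have U: "poly_over F (U c)" "poly (U c) y = poly (conj y) c" if "c \<in> k" for c y
  proof -
    have "c ^ i \<in> F" for i
      using that k_subset_F F_ring by (auto intro: subring_power)
    then show "poly_over F (U c)"
      unfolding U_def using g(1) F_ring by (intro poly_over_sum poly_over_smult)
    show "poly (U c) y = poly (conj y) c"
      by (simp add: U_def conj_def poly_of_coeffs_def poly_sum poly_monom mult.commute)
  qed
  have U': "poly (map_poly \<theta> (U c)) y = poly (conj' y) c" if c: "c \<in> k" for c y
  proof -
    have ck: "c ^ i \<in> k" for i
      using c k_ring by (auto intro: subring_power)
    have "map_poly \<theta> (U c) = (\<Sum>i\<le>e. smult (c ^ i) (map_poly \<theta> (g i)))"
    proof (rule poly_eqI)
      fix n
      have "coeff (map_poly \<theta> (U c)) n = \<theta> (\<Sum>i\<le>e. c ^ i * coeff (g i) n)"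
        by (simp add: coeff_map_hom[OF F theta] U_def coeff_sum)
      also have "\<dots> = (\<Sum>i\<le>e. \<theta> (c ^ i * coeff (g i) n))"
        using ck k_subset_F g(1) F_ring
        by (intro hom_on_sum[OF F theta] subring_mult) (auto simp: poly_over_coeff)
      also have "\<dots> = (\<Sum>i\<le>e. c ^ i * \<theta> (coeff (g i) n))"
        using ck k_subset_F g(1) F_ring
        by (intro sum.cong)
          (simp_all add: hom_on_mult[OF F theta] subsetD poly_over_coeff subst_power_const[OF q_pos])
      finally show "coeff (map_poly \<theta> (U c)) n = coeff (\<Sum>i\<le>e. smult (c ^ i) (map_poly \<theta> (g i))) n"
        by (simp add: coeff_sum coeff_map_hom[OF F theta])
    qed
    then show ?thesis
      by (simp add: conj'_def poly_of_coeffs_def poly_sum poly_monom mult.commute)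
  qed

  obtain ys where ys: "P = (\<Prod>y\<leftarrow>ys. [:- y, 1:])" "length ys = degree P"
    using monic_splits[OF ac min_poly_monic[OF F P]] .
  have root_iff: "poly P y = 0 \<longleftrightarrow> y \<in> set ys" for y
    unfolding ys(1) poly_prod_linear by (auto simp: prod_list_zero_iff)
  \<comment> \<open>The coefficients of \<open>P\<close> lie in \<open>Fq[s]\<close>, where
    \<open>\<theta>\<close> is the \<open>q\<close>-th power. So Frobenius carries the roots of
    \<open>P\<close> to the roots of its image.\<close>
  have thP: "map_poly \<theta> P = (\<Prod>y\<leftarrow>map (\<lambda>y. y ^ q) ys. [:- y, 1:])"
  proof -
    have "\<theta> (coeff P i) = coeff P i ^ q" for i
    proof -
      have "coeff P i \<in> adjoin Fq s"
        using P_coeffs subring_adjoin[OF Fq_ring] by (intro poly_over_coeff)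
      then show ?thesis
        using theta_Fqs adjoin_subset_fraction_field[OF Fq_ring] by blast
    qed
    then have "map_poly \<theta> P = map_poly (\<lambda>x. x ^ q) P"
      using q_pos by (intro poly_eqI) (simp add: coeff_map_hom[OF F theta] coeff_map_poly)
    moreover have "map_poly (\<lambda>x. x ^ q) (\<Prod>y\<leftarrow>zs. [:- y, 1:]) = (\<Prod>y\<leftarrow>map (\<lambda>y. y ^ q) zs. [:- y, 1:])" for zs :: "'a list"
    proof (induction zs)
      case (Cons z zs)
      have "map_poly (\<lambda>x. x ^ q) [:- z, 1:] = [:- (z ^ q), 1:]"
        using q_pos hom_on_uminus[OF subfield_UNIV hom_on_frobenius, of z] by (simp add: map_poly_pCons)
      then show ?case
        using Cons map_hom_mult[OF subfield_UNIV hom_on_frobenius poly_over_UNIV poly_over_UNIV]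
        by (simp only: list.map prod_list.Cons)
    qed simp
    ultimately show ?thesis
      using ys(1) by metis
  qed
  have norm: "(\<Prod>y\<leftarrow>ys. poly W y) \<in> F \<and>
      \<theta> (\<Prod>y\<leftarrow>ys. poly W y) = (\<Prod>y\<leftarrow>ys. poly (map_poly \<theta> W) (y ^ q))" if "poly_over F W" for W
    using norm_in_subfield[OF ac F theta that min_poly_over[OF F P] min_poly_nonzero[OF F P],
        of 1 ys "map (\<lambda>y. y ^ q) ys"] ys(1) thP hom_on_1[OF F theta] by (simp add: comp_def)

  \<comment> \<open>The norm of \<open>M\<close> down to \<open>k(s)\<close>; it turns out to be a
    power of the minimal polynomial of \<open>t\<close> there.\<close>
  define Nm where "Nm = (\<Prod>y\<leftarrow>ys. conj y)"
  define Nm' where "Nm' = (\<Prod>y\<leftarrow>map (\<lambda>y. y ^ q) ys. conj' y)"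
  have "poly_over F Nm \<and> map_poly \<theta> Nm = Nm'"
  proof (rule interpolation_over[OF F theta infinite_k k_subset_F])
    fix c
    assume c: "c \<in> k"
    then show "poly Nm c \<in> F \<and> \<theta> (poly Nm c) = poly Nm' c"
      using norm[OF U(1)[OF c]] U(2)[OF c] U'[OF c]
      by (simp add: Nm_def Nm'_def poly_prod_list comp_def)
  qed (use subst_power_const[OF q_pos] in auto)
  then have Nm: "poly_over F Nm" "map_poly \<theta> Nm = Nm'"
    by auto
  have Nm_monic: "lead_coeff Nm = 1"
    unfolding Nm_def using monic by (intro monic_prod_list) auto
  have Nm_degree: "degree Nm = degree P * e"
    unfolding Nm_def using monic ys(2) by (subst degree_monic_prod_list[of _ e]) auto

  \<comment> \<open>\<open>M\<close> divides \<open>Q0\<close> over \<open>k(s, x)\<close>. The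
    coefficient identities are polynomial relations for \<open>x\<close> over \<open>k(s)\<close>,
    hence hold for its conjugate \<open>y\<close>.\<close>
  have Q0_root: "poly Q0 z = 0" if z: "poly (conj y) z = 0" and y: "y \<in> set ys" for y z
  proof -
    have "poly_over FX Q0"
      using min_poly_over[OF F Q0] FFX poly_over_mono by blast
    then obtain C where C: "poly_over FX C" "Q0 = M * C"
      using min_poly_dvd[OF FX M] min_poly_root[OF F Q0] by blast
    obtain h where h: "\<And>i. poly_over F (h i)" "\<And>i. coeff C i = poly (h i) x"
      "\<And>i. i > degree C \<Longrightarrow> h i = 0"
      using coefficient_lift[OF C(1)[unfolded FX_def] F_ring] by metis
    define C' where "C' = poly_of_coeffs (degree C) (\<lambda>i. poly (h i) y)"
    have C': "coeff C' i = poly (h i) y" for i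
      by (simp add: C'_def coeff_poly_of_coeffs h(3))
    have "Q0 = conj y * C'"
    proof (rule poly_eqI)
      fix n
      define H where "H = (\<Sum>i\<le>n. g i * h (n - i)) - [:coeff Q0 n:]"
      have "poly_over F H"
        unfolding H_def using g(1) h(1) F_ring poly_over_coeff[OF F_ring min_poly_over[OF F Q0]]
        by (intro poly_over_diff poly_over_sum poly_over_mult poly_over_const) auto
      moreover have "poly H x = 0"
        unfolding H_def C(2) by (simp add: coeff_mult poly_sum g(2) h(2))
      ultimately obtain H' where "H = P * H'"
        using min_poly_dvd[OF F P] by blast
      then have "poly H y = 0"
        using root_iff[of y] y by simp
      then show "coeff Q0 n = coeff (conj y * C') n"
        by (simp add: H_def coeff_mult poly_sum coeff_conj C')
    qed
    then show ?thesis
      using z by simp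
  qed
  have "poly Q0 z = 0" if "poly Nm z = 0" for z
    using that Q0_root by (auto simp: Nm_def poly_prod_list prod_list_zero_iff)
  then obtain \<nu> where \<nu>: "Nm = Q0 ^ \<nu>"
    using min_poly_power[OF ac F Q0 Nm(1) Nm_monic] by blast
  then have "degree P * e = \<nu> * degree Q0"
    using Nm_degree min_poly_nonzero[OF F Q0] by (simp add: degree_power_eq)
  then have "\<nu> \<le> \<mu>"
    using deg_le min_poly_degree_pos[OF F Q0] by (simp add: mult.commute)
  obtain R1 where R1: "poly_over F R1" "R = Q0 * R1"
    using min_poly_dvd[OF F Q0 RF R(2)] .
  \<comment> \<open>A multiple of the norm \<open>Nm\<close> whose coefficients are polynomials in
    \<open>s\<close> of degree at most \<open>\<mu> * \<beta>\<close>. It controls the poles of all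
    conjugates of \<open>u\<close> together.\<close>
  define Q where "Q = R ^ \<mu>"
  define C where "C = Q0 ^ (\<mu> - \<nu>) * R1 ^ \<mu>"
  have C: "poly_over F C"
    unfolding C_def using R1 min_poly_over[OF F Q0] F_ring
    by (intro poly_over_mult poly_over_power)
  have Q: "Q = Nm * C" "Q \<noteq> 0" "poly_over F Q"
  proof -
    have "Q0 ^ \<mu> = Nm * Q0 ^ (\<mu> - \<nu>)"
      unfolding \<nu> using \<open>\<nu> \<le> \<mu>\<close> by (simp flip: power_add)
    then show "Q = Nm * C"
      by (simp add: Q_def R1(2) C_def power_mult_distrib)
  qed (use R(1) RF F_ring in \<open>auto simp: Q_def intro: poly_over_power\<close>)
  define G where "G = \<mu> * \<beta>"
  have Q_polys: "coeff Q i \<in> polys G" for i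
    unfolding Q_def G_def \<beta>_def by (rule coeffs_polys_power[OF R(3)])
  define Q' where "Q' = map_poly \<theta> Q"
  have Q': "Q' = Nm' * map_poly \<theta> C" "Q' \<noteq> 0"
    using Q C Nm map_hom_mult[OF F theta] map_hom_eq_0[OF F theta] by (auto simp: Q'_def)
  have Q'_polys: "coeff Q' i \<in> polys (q * G)" for i
    unfolding Q'_def coeff_map_hom[OF F theta] using Q_polys by (rule subst_power_polys[OF q_pos])
  have lead_Q': "lead_coeff Q' = \<theta> (lead_coeff Q)"
    using degree_map_hom[OF F theta Q(3)] by (simp add: Q'_def coeff_map_hom[OF F theta])

  \<comment> \<open>If \<open>M\<close> had only constant values at constants, its coefficients
    would lie in \<open>k\<close> and \<open>t\<close> would be algebraic over
    \<open>k\<close>.\<close>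
  obtain c where c: "c \<in> k" "poly M c \<notin> k"
  proof (rule ccontr)
    assume "\<not> thesis"
    then have "poly_over k M"
      using interpolation_over[OF k hom_on_id infinite_k subset_refl, of M M] that by blast
    then have "M = 0"
      using transcendental_not_in[OF t _ min_poly_root[OF FX M]] by blast
    then show False
      using min_poly_nonzero[OF FX M] by blast
  qed
  define u where "u = (\<lambda>y. poly (conj y) c)"
  define u' where "u' = (\<lambda>y. poly (conj' (y ^ q)) c)"
  have uU: "poly (U c) y = u y" "poly (map_poly \<theta> (U c)) (y ^ q) = u' y" for y
    using U(2)[OF c(1)] U'[OF c(1)] by (simp_all add: u_def u'_def)
  have Ux: "poly (U c) x \<notin> k"
    using c(2) U(2)[OF c(1), of x] by (simp add: conj_x)
  have vals: "u y \<noteq> 0" "u' y \<noteq> u y" "u y \<in> V \<Longrightarrow> u' y \<in> V" "u y \<notin> V \<Longrightarrow> u' y \<notin> V"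
    "u y \<in> V \<Longrightarrow> s * (u' y - u y) \<in> V" "u y \<notin> V \<Longrightarrow> s * inverse (u y) \<in> V"
    "u y \<notin> V \<Longrightarrow> s * inverse (u' y) \<in> V" if y: "y \<in> set ys" for y
  proof -
    have Py: "poly P y = 0"
      using root_iff y by blast
    note * = conjugate_values[OF P U(1)[OF c(1)] Ux Py approx[OF Py], unfolded uU]
    show "u y \<noteq> 0" "u' y \<noteq> u y" "u y \<in> V \<Longrightarrow> u' y \<in> V" "u y \<notin> V \<Longrightarrow> u' y \<notin> V"
      "u y \<in> V \<Longrightarrow> s * (u' y - u y) \<in> V" "u y \<notin> V \<Longrightarrow> s * inverse (u y) \<in> V"
      "u y \<notin> V \<Longrightarrow> s * inverse (u' y) \<in> V"
      by (fact *)+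
  qed

  \<comment> \<open>The two leading coefficients clear the finite poles of the conjugates of
    \<open>u\<close> and of \<open>u'\<close>.\<close>
  define B where "B = lead_coeff Q * lead_coeff Q' * (\<Prod>y\<leftarrow>ys. u' y - u y)"
  have "B \<in> F"
  proof -
    define W where "W = pcompose (map_poly \<theta> (U c)) (monom 1 q) - U c"
    have thF: "\<theta> z \<in> F" if z: "z \<in> F" for z
    proof -
      obtain a b where ab: "poly_over k a" "poly_over k b" "b \<noteq> 0" "z = poly a s / poly b s"
        using F_cases[OF z] by blast
      have "s ^ q \<in> F"
        using s_in_F F_ring by (intro subring_power)
      then show ?thesis
        unfolding ab(4) subst_power_eq[OF q_pos ab(1-3)] using ab k_subset_F F_ring
        by (intro subfield_divide[OF F] poly_in_subring) (auto intro: poly_over_mono)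
    qed
    have "poly_over F (map_poly \<theta> (U c))"
      using thF poly_over_coeff[OF F_ring U(1)[OF c(1)]]
      by (simp add: poly_over_iff[OF F_ring] coeff_map_hom[OF F theta])
    then have "poly_over F W"
      unfolding W_def using U(1)[OF c(1)] F_ring
      by (intro poly_over_diff poly_over_pcompose poly_over_monom subring_one)
    then have "(\<Prod>y\<leftarrow>ys. poly W y) \<in> F"
      using norm by blast
    then have "(\<Prod>y\<leftarrow>ys. u' y - u y) \<in> F"
      by (simp add: W_def poly_pcompose poly_monom uU)
    moreover have "lead_coeff Q \<in> F" "lead_coeff Q' \<in> F"
      using Q_polys Q'_polys polys_subset_F by blast+
    ultimately show ?thesis
      unfolding B_def using F_ring by (intro subring_mult)
  qed

  \<comment> \<open>The estimate is the same at all places: the poles of the differences are dominated by those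
    of the products, and these are absorbed by the leading coefficients.\<close>
  have place: "\<kappa> * \<kappa>' * \<rho> ^ degree P * B \<in> W"
    if W: "valuation_ring W" "k \<subseteq> W"
      and \<kappa>: "poly_over W (smult \<kappa> Q)" "poly_over W (smult \<kappa>' Q')"
      and \<rho>: "\<And>y. y \<in> set ys \<Longrightarrow>
        \<rho> * ((u' y - u y) / ((if u y \<notin> W then u y else 1) * (if u' y \<notin> W then u' y else 1))) \<in> W"
    for W \<kappa> \<kappa>' \<rho>
  proof -
    note RW = valuation_ring_subring[OF W(1)]
    \<comment> \<open>The polar part at \<open>W\<close>: the function itself at a pole,
      \<open>1\<close> elsewhere. What remains of a difference after division by both polar parts is
      controlled by \<open>\<rho>\<close>.\<close>
    define E where "E = (\<lambda>y. if u y \<notin> W then u y else 1)"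
    define E' where "E' = (\<lambda>y. if u' y \<notin> W then u' y else 1)"
    have E0: "E y \<noteq> 0" "E' y \<noteq> 0" for y
      using subring_zero[OF RW] by (auto simp: E_def E'_def)
    have cW: "c \<in> W"
      using c(1) W(2) by blast
    have 1: "\<kappa> * lead_coeff Q * (\<Prod>y\<leftarrow>ys. E y) \<in> W"
      using valuation_ring_bounded_product[OF ac W(1) \<kappa>(1) Q(1)[unfolded Nm_def] Q(2) monic(1) cW,
          of "\<lambda>y. u y \<notin> W"] by (simp only: E_def u_def)
    have "Q' = (\<Prod>y\<leftarrow>ys. conj' (y ^ q)) * map_poly \<theta> C"
      unfolding Q'(1) Nm'_def by (simp add: comp_def)
    from valuation_ring_bounded_product[OF ac W(1) \<kappa>(2) this Q'(2) monic(3) cW,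
          of "\<lambda>y. u' y \<notin> W"] 
    have 2: "\<kappa>' * lead_coeff Q' * (\<Prod>y\<leftarrow>ys. E' y) \<in> W"
      by (simp only: E'_def u'_def)
    have 3: "(\<Prod>y\<leftarrow>ys. \<rho> * ((u' y - u y) / (E y * E' y))) \<in> W"
      using \<rho> RW by (intro subring_prod_list) (auto simp: E_def E'_def)
    have "(\<Prod>y\<leftarrow>ys. E y) * ((\<Prod>y\<leftarrow>ys. E' y) * (\<Prod>y\<leftarrow>ys. \<rho> * ((u' y - u y) / (E y * E' y)))) =
        (\<Prod>y\<leftarrow>ys. \<rho> * (u' y - u y))"
      unfolding prod_list_distrib[symmetric] using E0
      by (intro arg_cong[of _ _ prod_list] map_cong) (auto simp: field_simps)
    also have "\<dots> = \<rho> ^ degree P * (\<Prod>y\<leftarrow>ys. u' y - u y)"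
      by (simp add: prod_list_mult_const ys(2))
    finally have "(\<kappa> * lead_coeff Q * (\<Prod>y\<leftarrow>ys. E y)) * (\<kappa>' * lead_coeff Q' * (\<Prod>y\<leftarrow>ys. E' y)) *
        (\<Prod>y\<leftarrow>ys. \<rho> * ((u' y - u y) / (E y * E' y))) = \<kappa> * \<kappa>' * \<rho> ^ degree P * B"
      by (simp add: B_def ac_simps)
    moreover note subring_mult[OF RW subring_mult[OF RW 1 2] 3]
    ultimately show ?thesis
      by (simp only:)
  qed

  \<comment> \<open>At the finite places \<open>place\<close> is applied with
    \<open>\<kappa> = \<kappa>' = \<rho> = 1\<close>.\<close>
  have "B \<in> adjoin k s"
  proof (rule integral_imp_poly[OF \<open>B \<in> F\<close>])
    fix W
    assume W: "valuation_ring W" "k \<subseteq> W" "s \<in> W"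
    note RW = valuation_ring_subring[OF W(1)]
    have "polys b \<subseteq> W" for b
      using polys_subset adjoin_subset[OF RW W(2,3)] by blast
    then have "poly_over W (smult 1 Q)" "poly_over W (smult 1 Q')"
      using Q_polys Q'_polys by (auto simp: poly_over_iff[OF RW])
    moreover have "1 * ((u' y - u y) / ((if u y \<notin> W then u y else 1) * (if u' y \<notin> W then u' y else 1))) \<in> W" for y
    proof -
      define a where "a = (if u y \<notin> W then u y else 1)"
      define b where "b = (if u' y \<notin> W then u' y else 1)"
      have "inverse a \<in> W" "u y * inverse a \<in> W" "inverse b \<in> W" "u' y * inverse b \<in> W"
        using valuation_ring_inverse[OF W(1)] subring_one[OF RW] subring_zero[OF RW]
        by (cases "u y = 0"; cases "u' y = 0"; auto simp: a_def b_def)+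
      moreover have "(u' y - u y) / (a * b) = (u' y * inverse b) * inverse a - (u y * inverse a) * inverse b"
        by (simp add: divide_inverse algebra_simps)
      ultimately show ?thesis
        using RW by (simp add: a_def b_def subring_diff subring_mult)
    qed
    ultimately have "1 * 1 * 1 ^ degree P * B \<in> W"
      using W(1,2) by (intro place) auto
    then show "B \<in> W"
      by simp
  qed
  then obtain b where b: "poly_over k b" "B = poly b s"
    by (auto simp: adjoin_def)
  have "B \<noteq> 0"
    using Q(2) Q'(2) vals(2) by (auto simp: B_def prod_list_zero_iff)
  then have exB: "exact B (int (degree b))"
    using b(2) exact_poly[OF b(1)] by (cases "b = 0") auto

  have scale: "poly_over V (smult (s powi (- int n)) p)" if "\<And>i. coeff p i \<in> polys n" for p n
    using that polys_subset_D by (fastforce simp: poly_over_iff[OF V_ring] D_def mult.commute)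
  \<comment> \<open>At infinity, the first two powers of \<open>s\<close> scale \<open>Q\<close> and
    \<open>Q'\<close> into \<open>V\<close>, and \<open>\<rho> = s\<close> records the zero at each
    root of \<open>P\<close>.\<close>
  have "s powi (- int G) * s powi (- int (q * G)) * s ^ degree P * B \<in> V"
  proof (rule place[OF V(1,2) scale[OF Q_polys] scale[OF Q'_polys]])
    fix y
    assume y: "y \<in> set ys"
    show "s * ((u' y - u y) / ((if u y \<notin> V then u y else 1) * (if u' y \<notin> V then u' y else 1))) \<in> V"
    proof (cases "u y \<in> V")
      case True
      then show ?thesis
        using vals[OF y] by simp
    next
      case False
      have "u' y \<noteq> 0"
        using vals(4)[OF y False] subring_zero[OF V_ring] by auto
      then have "s * ((u' y - u y) / (u y * u' y)) = s * inverse (u y) - s * inverse (u' y)"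
        using vals(1)[OF y] by (simp add: field_simps)
      then show ?thesis
        using False vals[OF y] V_ring by (simp add: subring_diff)
    qed
  qed
  moreover have "s powi (- int G) * s powi (- int (q * G)) * s ^ degree P =
      s powi (- int G + - int (q * G) + int (degree P))"
    using s_nonzero by (simp only: power_int_add power_int_of_nat simp_thms)
  moreover have "- int G + - int (q * G) + int (degree P) = - (int ((q + 1) * G) - int (degree P))"
    by (simp add: algebra_simps)
  ultimately have "B * s powi (- (int ((q + 1) * G) - int (degree P))) \<in> V"
    by (simp only: mult.commute)
  then have "B \<in> D (int ((q + 1) * G) - int (degree P))"
    by (simp add: D_def)
  \<comment> \<open>\<open>B\<close> is a nonzero polynomial in \<open>s\<close>, so the right-hand
    side cannot be negative.\<close>
  then have "int (degree b) \<le> int ((q + 1) * G) - int (degree P)"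
    by (rule exact_le[OF exB])
  then have "degree P \<le> (q + 1) * G"
    by linarith
  also have "\<dots> \<le> (q + 1) * card I"
    using \<beta>\<mu> unfolding G_def by (rule mult_le_mono2)
  finally show ?thesis .
qed

end

subsection \<open>The ambient field as a ring record\<close>

lemma field_ambient: "Ring.field (\<K> :: 'a::field ring)"
  by (rule field_from_type_algebra)

lemma ambient_simps [simp]:
  "carrier (\<K> :: 'a::field ring) = UNIV" "\<zero>\<^bsub>\<K>\<^esub> = (0::'a)" "\<one>\<^bsub>\<K>\<^esub> = (1::'a)"
  "x \<otimes>\<^bsub>\<K>\<^esub> y = (x * y::'a)" "x \<oplus>\<^bsub>\<K>\<^esub> y = (x + y::'a)"
  by (auto simp: ring_of_type_algebra_def)

lemma ambient_pow [simp]: "x [^]\<^bsub>\<K>\<^esub> n = (x ^ n :: 'a::field)" for n :: nat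
proof -
  interpret Ring.field "\<K> :: 'a ring"
    by (rule field_ambient)
  show ?thesis
    by (induction n) auto
qed

lemma ambient_a_inv [simp]: "\<ominus>\<^bsub>\<K>\<^esub> x = (- x :: 'a::field)"
proof -
  interpret Ring.field "\<K> :: 'a ring"
    by (rule field_ambient)
  show ?thesis
    using minus_equality[of "- x" x] by simp
qed

lemma ambient_m_inv: "x \<noteq> 0 \<Longrightarrow> inv\<^bsub>\<K>\<^esub> x = (inverse x :: 'a::field)"
proof -
  interpret Ring.field "\<K> :: 'a ring"
    by (rule field_ambient)
  assume "x \<noteq> 0"
  then show ?thesis
    using comm_inv_char[of x "inverse x"] by simp
qed

lemma is_subfield_if_subfield:
  fixes F :: "'a::field set"
  assumes F: "subfield F \<K>"
  shows "is_subfield F"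
proof -
  interpret Ring.field "\<K> :: 'a ring"
    by (rule field_ambient)
  note R = subringE[OF subfieldE(1)[OF F]]
  have "inverse x \<in> F" if "x \<in> F" for x
  proof (cases "x = 0")
    case False
    then show ?thesis
      using subfield_m_inv(1)[OF F, of x] that by (simp add: ambient_m_inv)
  qed (use that in simp)
  moreover have "x - y \<in> F" if "x \<in> F" "y \<in> F" for x y
    using R(7)[OF that(1) R(5)[OF that(2)]] by simp
  ultimately show ?thesis
    using R(3,6) by (simp add: is_subfield_def is_subring_def)
qed

text \<open>Polynomials over a ring record are coefficient lists with the leading coefficient first,
  hence the \<open>rev\<close>.\<close>

lemma eval_ambient: "ring.eval \<K> p x = poly (Poly (rev p)) (x :: 'a::field)"
proof -
  interpret Ring.field "\<K> :: 'a ring"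
    by (rule field_ambient)
  show ?thesis
    by (induction p) (auto simp: Poly_append poly_monom add.commute)
qed

lemma poly_carrier_ambient:
  fixes F :: "'a::field set"
  shows "p \<in> carrier (univ_poly \<K> F) \<longleftrightarrow> p = [] \<or> set p \<subseteq> F \<and> hd p \<noteq> 0"
  by (simp add: univ_poly_def polynomial_def)

lemma rev_coeffs_carrier:
  fixes F :: "'a::field set"
  shows "poly_over F p \<Longrightarrow> rev (coeffs p) \<in> carrier (univ_poly \<K> F)"
  by (cases "p = 0") (auto simp: poly_carrier_ambient poly_over_def hd_rev last_coeffs_eq_coeff_degree)

lemma transcendental_ambient:
  fixes F :: "'a::field set"
  assumes F: "subfield F \<K>"
  shows "ring.transcendental \<K> F x \<longleftrightarrow> \<not> algebraic_over F x"
proof -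
  interpret Ring.field "\<K> :: 'a ring"
    by (rule field_ambient)
  note R = subfield_subring[OF is_subfield_if_subfield[OF F]]
  have "transcendental F x" if "\<not> algebraic_over F x"
  proof (rule ccontr)
    assume "\<not> transcendental F x"
    then obtain p where p: "p \<in> carrier (univ_poly \<K> F)" "p \<noteq> []" "eval p x = 0"
      using algebraicE[OF subfieldE(1)[OF F], of x] by (auto simp: over_def)
    have "poly_over F (Poly (rev p))"
      using p(1,2) R nth_mem[of _ "rev p"]
      by (auto simp: poly_carrier_ambient poly_over_iff coeff_Poly_eq nth_default_def subring_zero)
    moreover have "Poly (rev p) \<noteq> 0"
    proof
      assume "Poly (rev p) = 0"
      then have "\<exists>n. rev p = replicate n 0"
        by (simp add: Poly_eq_0)
      then have "hd p = 0"
        using p(2) by (metis hd_replicate rev_replicate rev_rev_ident replicate_0)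
      then show False
        using p by (simp add: poly_carrier_ambient)
    qed
    ultimately show False
      using that p(3) by (auto simp: algebraic_over_def eval_ambient)
  qed
  moreover have "\<not> algebraic_over F x" if t: "transcendental F x"
  proof
    assume "algebraic_over F x"
    then obtain g where g: "poly_over F g" "g \<noteq> 0" "poly g x = 0"
      by (auto simp: algebraic_over_def)
    then show False
      using eval_transcendental[OF _ rev_coeffs_carrier[OF g(1)]] t
      by (simp add: over_def eval_ambient)
  qed
  ultimately show ?thesis
    by blast
qed

lemma algebraically_closed_ambient:
  assumes "algebraic_closure \<K> (K :: 'a::field set)"
  shows "algebraically_closed_type TYPE('a)"
proof -
  interpret algebraic_closure "\<K> :: 'a ring" K
    by (rule assms)
  show ?thesis
    unfolding algebraically_closed_type_def
  proof (intro allI impI)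
    fix p :: "'a poly"
    assume p: "degree p > 0"
    define P where "P = rev (coeffs p)"
    have P: "P \<in> carrier (poly_ring \<K>)"
      unfolding P_def using rev_coeffs_carrier[of UNIV p] by (simp add: poly_over_def)
    have "Polynomials.degree P = degree p"
      by (simp add: P_def degree_eq_length_coeffs)
    moreover have "splitted P"
      using roots_over_carrier[OF P] .
    ultimately have "roots P \<noteq> {#}"
      using p by (auto simp: splitted_def)
    then obtain x where "x \<in># roots P"
      by blast
    then have "eval P x = 0"
      using roots_mem_iff_is_root[OF P] by (simp add: is_root_def)
    then show "\<exists>z. poly p z = 0"
      by (auto simp: eval_ambient P_def)
  qed
qed

lemma lin_span_image: 
  assumes "is_subring F" "finite I"
  shows "lin_span F I v \<subseteq> lin_span F (v ` I) (\<lambda>x. x)"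
proof
  fix x
  assume "x \<in> lin_span F I v"
  then show "x \<in> lin_span F (v ` I) (\<lambda>x. x)"
    using assms lin_span_base[of F "v ` I" _ "\<lambda>x. x"]
    by (intro lin_span_trans[of F I v "v ` I" "\<lambda>x. x" x]) auto
qed

text \<open>\<open>combine\<close> stops at the end of the shorter list, so missing coefficients
  count as \<open>0\<close>, which therefore must lie in \<open>F\<close>.\<close>

lemma combine_ambient:
  "set cs \<subseteq> F \<Longrightarrow> 0 \<in> F \<Longrightarrow> \<exists>c. (\<forall>i<length vs. c i \<in> F) \<and>
    ring.combine \<K> cs vs = (\<Sum>i<length vs. c i * (vs ! i :: 'a::field))"
proof -
  interpret Ring.field "\<K> :: 'a ring"
    by (rule field_ambient)
  show "set cs \<subseteq> F \<Longrightarrow> 0 \<in> F \<Longrightarrow> ?thesis"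
  proof (induction cs vs rule: combine.induct)
    case (1 b cs v vs)
    then obtain c where c: "\<forall>i<length vs. c i \<in> F" "combine cs vs = (\<Sum>i<length vs. c i * vs ! i)"
      by auto
    show ?case
    proof (intro exI[of _ "case_nat b c"] conjI allI impI)
      show "case_nat b c i \<in> F" if "i < length (v # vs)" for i
        using that c(1) 1 by (cases i) auto
      show "combine (b # cs) (v # vs) = (\<Sum>i<length (v # vs). case_nat b c i * (v # vs) ! i)"
        by (simp add: c(2) sum.lessThan_Suc_shift del: sum.lessThan_Suc)
    qed
  next
    case ("2_1" vs)
    then show ?case
      by (intro exI[of _ "\<lambda>_. 0"]) auto
  next
    case ("2_2" cs)
    then show ?case
      by simp
  qed
qed

lemma extension_of_degree_span:
  fixes F L :: "'a::field set"
  assumes "extension_of_degree n F L"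
  obtains w where "L \<subseteq> lin_span F {..<n} w"
proof -
  interpret Ring.field "\<K> :: 'a ring"
    by (rule field_ambient)
  have F: "subfield F \<K>" and dim: "dimension n F L"
    using assms by (auto simp: extension_of_degree_def)
  obtain vs where vs: "length vs = n" "Span F vs = L"
    using exists_base[OF F dim] by auto
  have "L \<subseteq> lin_span F {..<n} (\<lambda>i. vs ! i)"
  proof
    fix x
    assume "x \<in> L"
    then obtain cs where "x = combine cs vs" "set cs \<subseteq> F"
      using vs(2) Span_eq_combine_set[OF F, of vs] by auto
    then show "x \<in> lin_span F {..<n} (\<lambda>i. vs ! i)"
      using combine_ambient[of cs F vs] vs(1) subring_zero[OF subfield_subring[OF is_subfield_if_subfield[OF F]]]
      by (auto intro: lin_spanI)
  qed
  then show ?thesis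
    by (rule that)
qed

lemma generate_field_subset_fraction_field:
  fixes F :: "'a::field set"
  assumes F: "is_subring F"
  shows "generate_field \<K> (insert t F) \<subseteq> fraction_field F t"
proof
  fix x
  assume "x \<in> generate_field \<K> (insert t F)"
  note S = subfield_fraction_field[OF F, of t]
  from \<open>x \<in> generate_field \<K> (insert t F)\<close> show "x \<in> fraction_field F t"
  proof induction
    case one
    then show ?case
      using subring_one[OF subfield_subring[OF S]] by simp
  next
    case (incl h)
    then show ?case
      using self_in_fraction_field[OF F] subset_fraction_field[OF F] by blast
  qed (use S in \<open>auto simp: ambient_m_inv
      intro: subring_uminus subring_add subring_mult subfield_inverse subfield_subring\<close>)
qed

lemma algebraic_finite_span:
  fixes F :: "'a::field set"
  assumes F: "is_subfield F" and S: "finite S" "\<And>x. x \<in> S \<Longrightarrow> algebraic_over F x"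
  shows "\<exists>E B. is_subfield E \<and> F \<subseteq> E \<and> S \<subseteq> E \<and> finite B \<and> E \<subseteq> lin_span F B (\<lambda>x. x)"
  using S
proof (induction S rule: finite_induct)
  case empty
  have "F \<subseteq> lin_span F {1} (\<lambda>x. x)"
  proof
    fix x
    assume "x \<in> F"
    then show "x \<in> lin_span F {1} (\<lambda>x. x)"
      by (intro lin_spanI[of _ "\<lambda>_. x"]) auto
  qed
  then show ?case
    using F by blast
next
  case (insert x S)
  then obtain E B where E: "is_subfield E" "F \<subseteq> E" "S \<subseteq> E" and B: "finite B" "E \<subseteq> lin_span F B (\<lambda>x. x)"
    by auto
  have alg: "algebraic_over E x"
    using insert E algebraic_over_mono by blast
  obtain p where p: "min_poly E x p"
    using min_poly_exists[OF E(1) alg] .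
  define I where "I = {..<degree p} \<times> B"
  define v where "v = (\<lambda>(i, b). b * x ^ i)"
  have "adjoin E x \<subseteq> lin_span F I v"
    unfolding adjoin_eq_lin_span[OF E(1) p] I_def v_def
    using lin_span_tower[OF subfield_subring[OF F] B(1) B(2)] by blast
  also have "\<dots> \<subseteq> lin_span F (v ` I) (\<lambda>x. x)"
    using subfield_subring[OF F] B(1) by (intro lin_span_image) (auto simp: I_def)
  finally have "adjoin E x \<subseteq> lin_span F (v ` I) (\<lambda>x. x)" .
  moreover have "finite (v ` I)"
    using B by (simp add: I_def)
  moreover have "F \<subseteq> adjoin E x" "insert x S \<subseteq> adjoin E x"
    using E subset_adjoin[OF subfield_subring[OF E(1)]] self_in_adjoin[OF subfield_subring[OF E(1)]] by blast+
  moreover have "is_subfield (adjoin E x)"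
    using E(1) alg by (rule subfield_adjoin)
  ultimately show ?case
    by blast
qed

text \<open>The coefficients of an equation for \<open>y\<close> lie in a subfield of finite degree
  over \<open>F\<close>, so the powers of \<open>y\<close> lie in a finite-dimensional
  space.\<close>

lemma algebraic_over_trans:
  fixes F :: "'a::field set"
  assumes F: "is_subfield F" and y: "algebraic_over {x. algebraic_over F x} y"
  shows "algebraic_over F y"
proof -
  obtain g where g: "poly_over {x. algebraic_over F x} g" "g \<noteq> 0" "poly g y = 0"
    using y by (auto simp: algebraic_over_def)
  have "\<exists>E B. is_subfield E \<and> F \<subseteq> E \<and> set (coeffs g) \<subseteq> E \<and> finite B \<and> E \<subseteq> lin_span F B (\<lambda>x. x)"
    using g(1) by (intro algebraic_finite_span[OF F]) (auto simp: poly_over_def)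
  then obtain E B where E: "is_subfield E" "set (coeffs g) \<subseteq> E"
    and B: "finite B" "E \<subseteq> lin_span F B (\<lambda>x. x)"
    by blast
  have "algebraic_over E y"
    using E(2) g by (auto simp: algebraic_over_def poly_over_def)
  then obtain p where p: "min_poly E y p"
    using min_poly_exists[OF E(1)] by blast
  show ?thesis
  proof (rule algebraic_if_powers_in_span[OF F])
    have "y ^ i \<in> adjoin E y" for i
      using subfield_subring[OF E(1)] by (intro subring_power subring_adjoin self_in_adjoin)
    then show "y ^ i \<in> lin_span F ({..<degree p} \<times> B) (\<lambda>(i, b). b * y ^ i)" for i
      using lin_span_tower[OF subfield_subring[OF F] B(1) B(2)] adjoin_eq_lin_span[OF E(1) p] by blast
  qed (use B in simp)
qed

lemma algebraic_elements_eq: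
  fixes F :: "'a::field set"
  shows "subfield F \<K> \<Longrightarrow> algebraic_elements F = {x. algebraic_over F x}"
  by (simp add: algebraic_elements_def transcendental_ambient)

lemma subfield_algebraic_elements:
  fixes F :: "'a::field set"
  assumes F: "subfield F \<K>"
  shows "is_subfield (algebraic_elements F)"
proof -
  interpret Ring.field "\<K> :: 'a ring"
    by (rule field_ambient)
  have "{x \<in> carrier \<K>. (algebraic over F) x} = algebraic_elements F"
    by (simp add: algebraic_elements_def over_def)
  then show ?thesis
    using subfield_of_algebraics[OF F] is_subfield_if_subfield by simp
qed

lemma subset_algebraic_elements:
  fixes F :: "'a::field set"
  assumes F: "subfield F \<K>"
  shows "F \<subseteq> algebraic_elements F"
proof
  fix x
  assume "x \<in> F"
  then show "x \<in> algebraic_elements F"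
    using subfield_subring[OF is_subfield_if_subfield[OF F]] unfolding algebraic_elements_eq[OF F]
    by (auto simp: algebraic_over_def intro!: exI[of _ "[:- x, 1:]"] poly_over_linear)
qed

subsection \<open>Frobenius exponents\<close>

text \<open>The maps \<open>x \<mapsto> x ^ (p ^ n)\<close> on the finite set \<open>Fq\<close>
  cannot all be different. As \<open>p\<close>-th powers are injective, two equal ones with
  \<open>a < b\<close> show that \<open>p ^ (b - a)\<close> fixes \<open>Fq\<close>.\<close>

lemma frobenius_exponent:
  fixes Fq :: "'a::field set"
  assumes Fq: "is_subfield Fq" "finite Fq"
  obtains q where "q \<ge> 2" "\<And>x y :: 'a. (x - y) ^ q = x ^ q - y ^ q" "\<And>c. c \<in> Fq \<Longrightarrow> c ^ q = c"
proof -
  note R = subfield_subring[OF Fq(1)]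
  define p where "p = CHAR('a)"
  have "of_nat n \<in> Fq" for n
    using R by (induction n) (auto intro: subring_zero subring_one subring_add)
  then have "range (of_nat :: nat \<Rightarrow> 'a) \<subseteq> Fq"
    by auto
  then have "\<not> inj (of_nat :: nat \<Rightarrow> 'a)"
    using Fq(2) finite_subset range_inj_infinite by blast
  then obtain a b where "(of_nat a :: 'a) = of_nat b" "a < b"
    by (metis injI linorder_neqE_nat)
  then have "(of_nat (b - a) :: 'a) = 0" "b - a > 0"
    by (simp_all add: of_nat_diff)
  then have "p > 0"
    unfolding p_def CHAR_pos_iff by blast
  then have p: "prime p"
    unfolding p_def by (intro prime_CHAR_semidom)
  have frob: "(x - y) ^ (p ^ n) = x ^ (p ^ n) - y ^ (p ^ n)" for x y :: 'a and n
  proof -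
    have "((x - y) + y) ^ (p ^ n) = (x - y) ^ (p ^ n) + y ^ (p ^ n)"
      using freshmans_dream'[of "p ^ n" n "x - y" y] p unfolding p_def by simp
    then show ?thesis
      by simp
  qed
  define \<phi> where "\<phi> = (\<lambda>n. restrict (\<lambda>x. x ^ (p ^ n)) Fq)"
  have "range \<phi> \<subseteq> Fq \<rightarrow>\<^sub>E Fq"
    using R by (auto simp: \<phi>_def intro: subring_power)
  then have "\<not> inj \<phi>"
    using Fq(2) finite_PiE[of Fq "\<lambda>_. Fq"] finite_subset range_inj_infinite by blast
  then obtain a b where ab: "\<phi> a = \<phi> b" "a < b"
    by (metis injI linorder_neqE_nat)
  have "c ^ (p ^ (b - a)) = c" if "c \<in> Fq" for c
  proof -
    have "c ^ (p ^ a) = c ^ (p ^ b)"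
      using fun_cong[OF ab(1), of c] that by (simp add: \<phi>_def)
    also have "\<dots> = (c ^ (p ^ (b - a))) ^ (p ^ a)"
      using ab(2) by (simp flip: power_mult power_add)
    finally have "(c ^ (p ^ (b - a)) - c) ^ (p ^ a) = 0"
      by (simp add: frob)
    then show ?thesis
      by simp
  qed
  moreover have "p ^ 1 \<le> p ^ (b - a)"
    using ab(2) p by (intro power_increasing) (use \<open>p > 0\<close> in auto)
  then have "p ^ (b - a) \<ge> 2"
    using prime_ge_2_nat[OF p] by simp
  ultimately show ?thesis
    using that[of "p ^ (b - a)"] frob by blast
qed

subsection \<open>Polynomials as rational functions\<close>

text \<open>Numerator and denominator come from an arbitrary choice of lowest terms, which is unique
  up to the constant \<open>c\<close>.\<close>

lemma rat_of_poly:
  fixes p :: "'a::field poly"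
  obtains c where "c \<noteq> 0" "rat_num (Fract p 1) = smult c p" "rat_den (Fract p 1) = [:c:]"
proof -
  define n where "n = rat_num (Fract p 1)"
  define r where "r = rat_den (Fract p 1)"
  have "lowest_terms (Fract p 1) (n, r)"
    using someI_ex[OF lowest_terms_exists[of "Fract p 1"]] by (simp add: n_def r_def rat_num_def rat_den_def)
  then have nr: "r \<noteq> 0" "coprime n r" "Fract p 1 = Fract n r"
    by (auto simp: lowest_terms_def)
  then have eq: "n = p * r"
    by (simp add: eq_fract)
  then have "r dvd 1"
    using nr(2) by (metis coprime_common_divisor dvd_refl dvd_triv_right)
  then obtain c where "r = [:c:]"
    using nr(1) is_unit_iff_degree degree_eq_zeroE by metis
  then show ?thesis
    using that[of c] nr eq unfolding n_def r_def by auto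
qed

lemma rat_degree_poly: "rat_degree (Fract p 1) = degree (p :: 'a::field poly)"
proof -
  obtain c where "c \<noteq> 0" "rat_num (Fract p 1) = smult c p" "rat_den (Fract p 1) = [:c:]"
    by (rule rat_of_poly)
  then show ?thesis
    by (simp add: rat_degree_def)
qed

lemma rat_map_poly: "rat_map (Fract p 1) (Affine x) = Affine (poly (p :: 'a::field poly) x)"
proof -
  obtain c where "c \<noteq> 0" "rat_num (Fract p 1) = smult c p" "rat_den (Fract p 1) = [:c:]"
    by (rule rat_of_poly)
  then show ?thesis
    by simp
qed

lemma rat_map_poly_funpow: "(rat_map (Fract p 1) ^^ n) (Affine x) = Affine ((poly p ^^ n) x)"
  for p :: "'a::field poly"
  by (induction n) (simp_all add: rat_map_poly del: rat_map.simps)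

lemma PrePer_poly:
  "PrePer (Fract p 1) L \<subseteq> insert Infinity (Affine ` {x \<in> L. finite (range (\<lambda>n. (poly p ^^ n) x))})"
proof
  fix y
  assume y: "y \<in> PrePer (Fract p 1) L"
  show "y \<in> insert Infinity (Affine ` {x \<in> L. finite (range (\<lambda>n. (poly p ^^ n) x))})"
  proof (cases y)
    case (Affine x)
    have "finite (Affine ` range (\<lambda>n. (poly p ^^ n) x))"
      using y by (simp add: Affine PrePer_def rat_map_poly_funpow image_image)
    then have "finite (range (\<lambda>n. (poly p ^^ n) x))"
      by (rule finite_imageD) (simp add: inj_on_def)
    then show ?thesis
      using y by (auto simp: Affine PrePer_def proj_points_def)
  qed simp
qed

text \<open>If \<open>a = b * p\<close> with \<open>a\<close> and \<open>b\<close> over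
  \<open>L\<close>, then division with remainder over \<open>L\<close> must return \<open>p\<close>
  as the quotient.\<close>

lemma rat_over_poly:
  assumes L: "is_subfield L" and f: "rat_over L (Fract p 1)"
  shows "poly_over L p"
proof -
  obtain a b where ab: "poly_over L a" "poly_over L b" "b \<noteq> 0" "Fract p 1 = Fract a b"
    using f by (auto simp: rat_over_def)
  then have eq: "a = b * p"
    by (simp add: eq_fract mult.commute)
  obtain h r where hr: "poly_over L h" "a = b * h + r" "r = 0 \<or> degree r < degree b"
    using poly_over_division[OF L ab(2,3,1)] by blast
  have r: "r = b * (p - h)"
    using eq hr(2) by (simp add: algebra_simps)
  have "p - h = 0"
  proof (rule ccontr)
    assume "p - h \<noteq> 0"
    then have "r \<noteq> 0" "degree r = degree b + degree (p - h)"
      using ab(3) unfolding r by (auto simp: degree_mult_eq)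
    then show False
      using hr(3) by simp
  qed
  then show ?thesis
    using hr(1) by simp
qed

lemma poly_rat_const_var: "poly (map_poly rat_const p) (Fract [:0, 1:] 1) = Fract p 1"
  for p :: "'a::field poly"
proof (induction p)
  case 0
  then show ?case
    by (simp add: Zero_fract_def)
next
  case (pCons a p)
  have "rat_const 0 = (0 :: 'a poly fract)"
    by (simp add: rat_const_def Zero_fract_def)
  then have "poly (map_poly rat_const (pCons a p)) (Fract [:0, 1:] 1) =
      rat_const a + Fract [:0, 1:] 1 * Fract p 1"
    using pCons by (simp add: map_poly_pCons)
  also have "\<dots> = Fract (pCons a p) 1"
    by (simp add: rat_const_def)
  finally show ?case .
qed

text \<open>Conjugation by the identity. It shows that parameters algebraic over \<open>k\<close>
  are excluded from the family.\<close>

lemma PGL2_conjugate_refl_poly: "PGL2_conjugate (Fract p 1) (Fract p 1)"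
  for p :: "'a::field poly"
proof -
  have const: "rat_const (0 :: 'a) = (0 :: 'a poly fract)" "rat_const c \<noteq> 0 \<longleftrightarrow> c \<noteq> 0" for c :: 'a
    by (auto simp: rat_const_def Zero_fract_def eq_fract)
  have mo: "moebius 1 0 0 1 = (Fract [:0, 1:] 1 :: 'a poly fract)"
    by (simp add: moebius_def one_pCons)
  obtain c where c: "c \<noteq> 0" "rat_num (Fract p 1) = smult c p" "rat_den (Fract p 1) = [:c:]"
    by (rule rat_of_poly)
  obtain b :: 'a where b: "b \<noteq> 0" "rat_num (Fract [:0, 1:] 1) = smult b [:0, 1:]"
    "rat_den (Fract [:0, 1:] 1) = [:b:]"
    by (rule rat_of_poly)
  have "rat_comp (Fract p 1) (moebius 1 0 0 1) = Fract (smult c p) 1 / Fract [:c:] 1"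
    unfolding rat_comp_def mo c poly_rat_const_var ..
  also have "\<dots> = Fract p 1"
    using c(1) by (simp add: eq_fract)
  finally have 1: "rat_comp (Fract p 1) (moebius 1 0 0 1) = Fract p 1" .
  have "rat_comp (moebius 1 0 0 1) (Fract p 1) = rat_const b * Fract p 1 / rat_const b"
    unfolding rat_comp_def mo b using b(1) by (simp add: map_poly_pCons const(1) mult.commute)
  also have "\<dots> = Fract p 1"
    using const(2)[of b] b(1) by simp
  finally have 2: "rat_comp (moebius 1 0 0 1) (Fract p 1) = Fract p 1" .
  show ?thesis
    unfolding PGL2_conjugate_def using 1 2
    by (intro exI[of _ 1] exI[of _ 0] exI[of _ 0] exI[of _ 1]) simp
qed

lemma map_poly_eval_mult: "map_poly (\<lambda>c. poly c s) (p * r) = map_poly (\<lambda>c. poly c s) p * map_poly (\<lambda>c. poly c s) r"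
  for s :: "'a::comm_ring_1"
  by (intro poly_eqI) (simp add: coeff_map_poly coeff_mult poly_sum)

lemma map_poly_eval_prod_linear:
  "map_poly (\<lambda>c. poly c s) (\<Prod>i\<in>I. [:- \<alpha> i, 1:]) = (\<Prod>i\<in>I. [:- poly (\<alpha> i) s, 1:])"
  for s :: "'a::comm_ring_1"
proof (induction I rule: infinite_finite_induct)
  case (insert i I)
  have "map_poly (\<lambda>c. poly c s) [:- \<alpha> i, 1:] = [:- poly (\<alpha> i) s, 1:]"
    by (simp add: map_poly_pCons)
  then show ?case
    unfolding prod.insert[OF insert.hyps] map_poly_eval_mult insert.IH by (rule arg_cong)
qed (simp_all add: map_poly_1)

lemma monic_prod_linear_set: "lead_coeff (\<Prod>i\<in>I. [:- a i, 1:]) = (1 :: 'a::idom)"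
  by (simp add: lead_coeff_prod)

lemma degree_prod_linear_set: "degree (\<Prod>i\<in>I. [:- a i, 1 :: 'a::idom:]) = card I"
  by (subst degree_prod_eq_sum_degree) auto

text \<open>If all coefficients were constant, \<open>\<alpha> i\<close> would be a root of a
  nonzero polynomial \<open>C\<close> over the field, which is impossible for a polynomial of
  positive degree.\<close>

lemma nonconstant_coeff:
  fixes \<alpha> :: "'i \<Rightarrow> 'a::field poly"
  assumes I: "finite I" "i \<in> I" and deg: "degree (\<alpha> i) > 0"
  obtains j where "degree (coeff (\<Prod>i\<in>I. [:- \<alpha> i, 1:]) j) > 0"
proof (rule ccontr)
  assume contra: "\<not> thesis"
  define f where "f = (\<Prod>i\<in>I. [:- \<alpha> i, 1:])"
  have const: "degree (coeff f j) = 0" for j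
    using contra that unfolding f_def by blast
  define C where "C = map_poly (\<lambda>p. coeff p 0) f"
  have "[:coeff C j:] = coeff f j" for j
    using const[of j] by (auto simp: C_def coeff_map_poly elim: degree_eq_zeroE)
  then have fC: "f = map_poly (\<lambda>c. [:c:]) C"
    by (intro poly_eqI) (simp add: coeff_map_poly)
  have "poly f (\<alpha> i) = 0"
    using I by (auto simp: f_def poly_prod prod_zero_iff)
  then have "pcompose C (\<alpha> i) = 0"
    by (simp add: pcompose_altdef fC)
  then have "C = 0"
    using deg by (simp add: pcompose_eq_0_iff)
  then have "f = 0"
    by (simp add: fC)
  then show False
    using monic_prod_linear_set[of \<alpha> I] by (simp add: f_def)
qed

lemma finite_bounded_polys:
  fixes A :: "'b::zero set"
  assumes "finite A"
  shows "finite {p. degree p \<le> n \<and> (\<forall>i. coeff p i \<in> A)}"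
proof (rule finite_subset)
  show "{p. degree p \<le> n \<and> (\<forall>i. coeff p i \<in> A)} \<subseteq> Poly ` {xs. set xs \<subseteq> A \<and> length xs \<le> Suc n}"
  proof
    fix p
    assume p: "p \<in> {p. degree p \<le> n \<and> (\<forall>i. coeff p i \<in> A)}"
    then have "set (coeffs p) \<subseteq> A" "length (coeffs p) \<le> Suc n"
      by (auto simp: coeffs_def)
    then show "p \<in> Poly ` {xs. set xs \<subseteq> A \<and> length xs \<le> Suc n}"
      by (intro image_eqI[of _ _ "coeffs p"]) auto
  qed
  show "finite (Poly ` {xs. set xs \<subseteq> A \<and> length xs \<le> Suc n})"
    using assms by (intro finite_imageI finite_lists_length_le)
qed

subsection \<open>Counting preperiodic points\<close>

lemma finite_orbit_iff:
  fixes f :: "'a \<Rightarrow> 'a"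
  shows "finite (range (\<lambda>n. (f ^^ n) x)) \<longleftrightarrow> (\<exists>a b. a < b \<and> (f ^^ a) x = (f ^^ b) x)"
proof
  assume "finite (range (\<lambda>n. (f ^^ n) x))"
  then have "\<not> inj (\<lambda>n. (f ^^ n) x)"
    using range_inj_infinite by blast
  then obtain a b where "(f ^^ a) x = (f ^^ b) x" "a \<noteq> b"
    unfolding inj_def by blast
  then show "\<exists>a b. a < b \<and> (f ^^ a) x = (f ^^ b) x"
    by (cases "a < b") (blast, metis linorder_neqE_nat)
next
  assume "\<exists>a b. a < b \<and> (f ^^ a) x = (f ^^ b) x"
  then obtain a b where ab: "a < b" "(f ^^ a) x = (f ^^ b) x"
    by blast
  have "(f ^^ n) x \<in> (\<lambda>n. (f ^^ n) x) ` {..<b}" for n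
  proof (induction n rule: less_induct)
    case (less n)
    show ?case
    proof (cases "n < b")
      case False
      have "(f ^^ n) x = (f ^^ (n - b)) ((f ^^ b) x)"
        using False by (metis comp_apply funpow_add le_add_diff_inverse2 not_le)
      also have "\<dots> = (f ^^ (n - b + a)) x"
        by (simp add: funpow_add flip: ab(2))
      finally show ?thesis
        using less.IH[of "n - b + a"] ab(1) False by simp
    qed auto
  qed
  then have "range (\<lambda>n. (f ^^ n) x) \<subseteq> (\<lambda>n. (f ^^ n) x) ` {..<b}"
    by blast
  then show "finite (range (\<lambda>n. (f ^^ n) x))"
    by (rule finite_subset) simp
qed

context frobenius_place
begin

text \<open>All roots of \<open>P\<close> are preperiodic with \<open>x\<close>. They are integral
  over \<open>k[s]\<close>, approximable, and of order at most \<open>M\<close> at infinity;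
  accordingly the coefficients of \<open>P\<close> lie in \<open>k[s]\<close>, have their constants
  in \<open>Fq\<close>, and have bounded degree in \<open>s\<close>.\<close>

lemma min_poly_preperiodic:
  fixes \<alpha> :: "'i \<Rightarrow> 'a poly" and M :: nat
  assumes J: "finite J" "card J > 1"
    and \<alpha>: "\<And>j. j \<in> J \<Longrightarrow> poly_over Fq (\<alpha> j)" "\<And>j. j \<in> J \<Longrightarrow> degree (\<alpha> j) \<le> M" "inj_on \<alpha> J"
    and ineq: "\<And>i j. i \<in> J \<Longrightarrow> j \<in> J \<Longrightarrow> i \<noteq> j \<Longrightarrow>
      degree (\<alpha> i - \<alpha> j) + (\<Sum>l\<in>J - {j}. degree (\<alpha> l - \<alpha> j)) > M"
    and fin: "finite (range (\<lambda>n. (poly (\<Prod>j\<in>J. [:- poly (\<alpha> j) s, 1:]) ^^ n) x))"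
  obtains P where "min_poly F x P" "\<And>y. poly P y = 0 \<Longrightarrow> y \<in> approximable"
    "\<And>i. \<exists>g. poly_over Fq g \<and> degree g \<le> M * degree P \<and> coeff P i = poly g s"
proof -
  define f where "f = (\<Prod>j\<in>J. [:- poly (\<alpha> j) s, 1:])"
  have f_eval: "poly f z = (\<Prod>j\<in>J. z - poly (\<alpha> j) s)" for z
    by (simp add: f_def poly_prod)
  have f_monic: "lead_coeff f = 1" and f_deg: "degree f = card J"
    unfolding f_def by (rule monic_prod_linear_set, rule degree_prod_linear_set)
  define A where "A = adjoin Fq s"
  have A: "is_subring A" "A \<subseteq> fraction_field Fq s" "A \<subseteq> F" "A \<subseteq> adjoin k s"
    using subring_adjoin[OF Fq_ring] adjoin_subset_fraction_field[OF Fq_ring] Fqs_subset_F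
      Fq(2) by (auto simp: A_def adjoin_def intro: poly_over_mono)
  have \<alpha>A: "poly (\<alpha> j) s \<in> A" if "j \<in> J" for j
    using \<alpha>(1) that by (auto simp: A_def intro: adjoinI)
  have fA: "poly_over A f"
    unfolding f_def using \<alpha>A A(1) by (intro poly_over_prod poly_over_linear)

  have preper: "y \<in> approximable \<and> y \<in> D (int M)"
    if y: "finite (range (\<lambda>n. (poly f ^^ n) y))" for y
  proof -
    have "poly f = (\<lambda>z. \<Prod>j\<in>J. z - poly (\<alpha> j) s)"
      by (simp add: fun_eq_iff f_eval)
    note fin' = y[unfolded this]
    have deg: "poly (\<alpha> j) s \<in> D (int M)" if j: "j \<in> J" for j
      using polys_subset_D[of M] \<alpha>(1,2)[OF j] Fq(2)
      by (auto simp: polys_def intro: poly_over_mono)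
    have ex: "exact (poly (\<alpha> i) s - poly (\<alpha> j) s) (int (degree (\<alpha> i - \<alpha> j)))"
      if "i \<in> J" "j \<in> J" "i \<noteq> j" for i j
      using exact_poly[of "\<alpha> i - \<alpha> j"] that \<alpha>(1) inj_onD[OF \<alpha>(3)] Fq k_ring
      by (auto intro: poly_over_diff poly_over_mono)
    have ineq': "int (degree (\<alpha> i - \<alpha> j)) + (\<Sum>l\<in>J - {j}. int (degree (\<alpha> l - \<alpha> j))) > int M"
      if "i \<in> J" "j \<in> J" "i \<noteq> j" for i j
      using ineq[OF that] by (simp flip: of_nat_sum of_nat_add)
    have mem: "poly (\<alpha> j) s \<in> fraction_field Fq s" if "j \<in> J" for j
      using \<alpha>A[OF that] A(2) by blast
    show ?thesis
      using preperiodic_approximable[OF J, of "int M" "\<lambda>j. poly (\<alpha> j) s"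
          "\<lambda>i j. int (degree (\<alpha> i - \<alpha> j))" y] mem deg ex ineq' fin' by simp
  qed

  define it where "it = (\<lambda>n. (pcompose f ^^ n) [:0, 1:])"
  have it_eval: "poly (it n) z = (poly f ^^ n) z" for n z
    by (induction n) (auto simp: it_def poly_pcompose)
  have it: "poly_over A (it n) \<and> degree (it n) = card J ^ n \<and> lead_coeff (it n) = 1" for n
  proof (induction n)
    case 0
    then show ?case
      using A(1) by (auto simp: it_def intro!: poly_over_pCons poly_over_0 subring_zero subring_one)
  next
    case (Suc n)
    have eq: "it (Suc n) = pcompose f (it n)"
      by (simp add: it_def)
    have "degree (it n) > 0"
      using Suc J by simp
    moreover have "lead_coeff (it n) = 1"
      using Suc by blast
    ultimately have "lead_coeff (it (Suc n)) = 1"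
      using f_monic by (simp only: eq lead_coeff_comp power_one mult_1)
    moreover have "degree (it (Suc n)) = card J ^ Suc n"
      unfolding eq using Suc by (simp add: degree_pcompose f_deg)
    moreover have "poly_over A (it (Suc n))"
      unfolding eq using Suc fA A(1) by (blast intro: poly_over_pcompose)
    ultimately show ?case
      by blast
  qed
  obtain a b where ab: "a < b" "(poly f ^^ a) x = (poly f ^^ b) x"
    using fin unfolding finite_orbit_iff f_def by blast
  \<comment> \<open>Monic, because the degrees of the two iterates differ. It turns preperiodicity
    into an integral equation that all conjugates of \<open>x\<close> satisfy.\<close>
  define h where "h = it b - it a"
  have "degree (it a) < degree (it b)"
    using it ab(1) J by simp
  then have "degree h = degree (it b)" "coeff h (degree (it b)) = lead_coeff (it b)"
    using degree_add_eq_left[of "- it a" "it b"] by (simp_all add: h_def coeff_eq_0)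
  moreover have "lead_coeff (it b) = 1"
    using it by blast
  ultimately have "lead_coeff h = 1"
    by (simp only:)
  moreover have "poly_over A h"
    unfolding h_def using it A(1) by (blast intro: poly_over_diff)
  ultimately have h: "poly_over A h" "lead_coeff h = 1"
    by blast+
  have hx: "poly h x = 0"
    using ab(2) by (simp add: h_def it_eval)
  have hF: "poly_over F h"
    using h(1) A(3) by (rule poly_over_mono[rotated])
  have "h \<noteq> 0"
    using h(2) by auto
  then obtain P where P: "min_poly F x P"
    using min_poly_exists[OF F, of x] hF hx by (auto simp: algebraic_over_def)
  obtain h' where h': "h = P * h'"
    using min_poly_dvd[OF F P hF hx] .
  have root: "y \<in> approximable \<and> y \<in> D (int M)" and root_h: "poly h y = 0" if y: "poly P y = 0" for y
  proof -
    show "poly h y = 0"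
      using y by (simp add: h')
    then have "(poly f ^^ a) y = (poly f ^^ b) y"
      by (simp add: h_def it_eval)
    then have "finite (range (\<lambda>n. (poly f ^^ n) y))"
      unfolding finite_orbit_iff using ab(1) by blast
    then show "y \<in> approximable \<and> y \<in> D (int M)"
      by (rule preper)
  qed
  obtain ys where ys: "P = (\<Prod>y\<leftarrow>ys. [:- y, 1:])" "length ys = degree P"
    using monic_splits[OF ac min_poly_monic[OF F P]] .
  have ys_root: "poly P y = 0" if "y \<in> set ys" for y
    using that unfolding ys(1) poly_prod_linear by (auto simp: prod_list_zero_iff)
  have coeff_approx: "coeff P i \<in> approximable" for i
  proof (rule poly_over_coeff[OF subring_approximable])
    show "poly_over approximable P"
      unfolding ys(1) using ys_root root subring_approximable
      by (intro poly_over_prod_list) (auto intro!: poly_over_linear)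
  qed
  have coeff_int: "coeff P i \<in> adjoin k s" for i
  proof (rule integral_imp_poly)
    show "coeff P i \<in> F"
      using min_poly_over[OF F P] F_ring by (intro poly_over_coeff)
    fix W
    assume W: "valuation_ring W" "k \<subseteq> W" "s \<in> W"
    note RW = valuation_ring_subring[OF W(1)]
    have "adjoin k s \<subseteq> W"
      using adjoin_subset[OF RW W(2,3)] .
    then have "poly_over W h"
      using h(1) A(4) poly_over_mono by blast
    then have "y \<in> W" if "y \<in> set ys" for y
      using valuation_ring_integrally_closed[OF W(1) _ h(2)] root_h[OF ys_root[OF that]] by blast
    then have "poly_over W P"
      unfolding ys(1) using RW by (intro poly_over_prod_list) (auto intro!: poly_over_linear)
    then show "coeff P i \<in> W"
      using RW by (intro poly_over_coeff)
  qed
  have coeff_D: "coeff (\<Prod>y\<leftarrow>zs. [:- y, 1:]) i \<in> D (int (M * length zs))"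
    if "\<And>y. y \<in> set zs \<Longrightarrow> y \<in> D (int M)" for zs i
    using that
  proof (induction zs arbitrary: i)
    case Nil
    then show ?case
      using k_subset_D[OF subring_one[OF k_ring]] k_subset_D[OF subring_zero[OF k_ring]] by (simp add: of_bool_def)
  next
    case (Cons z zs)
    let ?p = "\<Prod>y\<leftarrow>zs. [:- y, 1:]"
    have IH: "coeff ?p j \<in> D (int (M * length zs))" for j
      using Cons by simp
    then have 1: "coeff ?p j \<in> D (int (M * length (z # zs)))" for j
      by (rule D_mono[rotated]) simp
    have "z * coeff ?p i \<in> D (int M + int (M * length zs))"
      using Cons.prems IH by (intro D_mult) auto
    then have 2: "z * coeff ?p i \<in> D (int (M * length (z # zs)))"
      by (simp add: algebra_simps)
    have "coeff (\<Prod>y\<leftarrow>z # zs. [:- y, 1:]) i = (case i of 0 \<Rightarrow> 0 | Suc j \<Rightarrow> coeff ?p j) - z * coeff ?p i"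
      by (simp add: coeff_pCons split: nat.split)
    then show ?case
      using 1 2 by (auto intro!: D_diff D_uminus split: nat.split)
  qed
  have "\<exists>g. poly_over Fq g \<and> degree g \<le> M * degree P \<and> coeff P i = poly g s" for i
  proof -
    obtain g where g: "poly_over k g" "coeff P i = poly g s"
      using coeff_int[of i] by (auto simp: adjoin_def)
    have "poly_over Fq g"
      using approximable_poly_over[OF g(1)] coeff_approx[of i] g(2) by simp
    moreover have "poly g s \<in> D (int (M * degree P))"
      using coeff_D[of ys i] root[OF ys_root] ys g(2) by simp
    then have "degree g \<le> M * degree P"
      using exact_le[OF exact_poly[OF g(1)], of "int (M * degree P)"]
      by (cases "g = 0") (auto simp del: of_nat_mult)
    ultimately show ?thesis
      using g(2) by blast
  qed
  then show ?thesis
    using that P root by blast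
qed

end

section \<open>Finitely many candidates for the minimal polynomial\<close>

definition bounded_families :: "'a::field set \<Rightarrow> nat \<Rightarrow> nat \<Rightarrow> 'a poly poly set"
  where "bounded_families A a b = {p. degree p \<le> b \<and> (\<forall>i. degree (coeff p i) \<le> a \<and> poly_over A (coeff p i))}"

lemma finite_bounded_families:
  assumes A: "is_subring A" "finite A"
  shows "finite (bounded_families A a b)"
proof -
  define P where "P = {p. degree p \<le> a \<and> (\<forall>i. coeff p i \<in> A)}"
  have "finite P"
    unfolding P_def using A(2) by (rule finite_bounded_polys)
  then have "finite {p. degree p \<le> b \<and> (\<forall>i. coeff p i \<in> P)}"
    by (rule finite_bounded_polys)
  moreover have "bounded_families A a b = {p. degree p \<le> b \<and> (\<forall>i. coeff p i \<in> P)}"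
    unfolding bounded_families_def P_def poly_over_iff[OF A(1)] by (simp only: mem_Collect_eq)
  ultimately show ?thesis
    by simp
qed

lemma card_roots_of_families:
  fixes G :: "'a::field poly poly set"
  assumes G: "finite G" "\<And>p. p \<in> G \<Longrightarrow> degree p \<le> b"
    and S: "\<And>x. x \<in> S \<Longrightarrow> \<exists>p\<in>G. map_poly (\<lambda>g. poly g s) p \<noteq> 0 \<and> poly (map_poly (\<lambda>g. poly g s) p) x = 0"
  shows "finite S" "card S \<le> card G * b"
proof -
  define Z where "Z = (\<lambda>p. {x. map_poly (\<lambda>g. poly g s) p \<noteq> 0 \<and> poly (map_poly (\<lambda>g. poly g s) p) x = 0})"
  have Z: "finite (Z p) \<and> card (Z p) \<le> b" if p: "p \<in> G" for p
  proof (cases "map_poly (\<lambda>g. poly g s) p = 0")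
    case False
    then have "finite (Z p)" "card (Z p) \<le> degree (map_poly (\<lambda>g. poly g s) p)"
      using poly_roots_finite[OF False] card_poly_roots_bound[OF False] by (simp_all add: Z_def)
    moreover have "degree (map_poly (\<lambda>g. poly g s) p) \<le> degree p"
      by (rule degree_le) (simp add: coeff_map_poly coeff_eq_0)
    ultimately show ?thesis
      using G(2)[OF p] by simp
  qed (simp add: Z_def)
  have sub: "S \<subseteq> (\<Union>p\<in>G. Z p)"
    using S by (force simp: Z_def)
  moreover have fin: "finite (\<Union>p\<in>G. Z p)"
    using G(1) Z by blast
  ultimately show "finite S"
    by (rule finite_subset)
  have "card S \<le> card (\<Union>p\<in>G. Z p)"
    using fin sub by (rule card_mono)
  also have "\<dots> \<le> (\<Sum>p\<in>G. card (Z p))"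
    using G(1) by (rule card_UN_le)
  also have "\<dots> \<le> card G * b"
    using Z sum_bounded_above[of G "\<lambda>p. card (Z p)" b] by simp
  finally show "card S \<le> card G * b" .
qed

text \<open>\<open>s\<close> need not lie in \<open>L\<close>, so the tower has a third step
  \<open>L(s)\<close> over \<open>L\<close>, whose degree is bounded by the equation
  \<open>h\<close>.\<close>

lemma powers_in_tower_span:
  fixes F K L :: "'a::field set"
  assumes F: "is_subring F" and K: "is_subring K" and L: "is_subfield L"
    and span: "K \<subseteq> lin_span F {..<n} v" "L \<subseteq> lin_span K {..<m} w"
    and s: "poly_over L h" "h \<noteq> 0" "poly h s = 0" and x: "x \<in> L"
  obtains I :: "((nat \<times> nat) \<times> nat) set" and u
  where "finite I" "card I \<le> degree h * (m * n)" "\<And>i j. s ^ i * x ^ j \<in> lin_span F I u"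
proof -
  obtain p where p: "min_poly L s p"
    using min_poly_exists[OF L] s by (auto simp: algebraic_over_def)
  have deg: "degree p \<le> degree h"
    using min_poly_least[OF L p] s by blast
  define I where "I = ({..<degree p} \<times> {..<m}) \<times> {..<n}"
  have "s ^ i * x ^ j \<in> adjoin L s" for i j
    using subfield_subring[OF L] subset_adjoin[of L s] x
    by (intro subring_mult subring_power subring_adjoin self_in_adjoin) auto
  then have "s ^ i * x ^ j \<in> lin_span L {..<degree p} (\<lambda>i. s ^ i)" for i j
    by (simp add: adjoin_eq_lin_span[OF L p])
  then have "s ^ i * x ^ j \<in> lin_span K ({..<degree p} \<times> {..<m}) (\<lambda>(i, j). w j * s ^ i)" for i j
    using span(2) by (intro lin_span_tower[OF K]) auto
  then have "s ^ i * x ^ j \<in> lin_span F I (\<lambda>(i, j). v j * (case i of (i, j) \<Rightarrow> w j * s ^ i))" for i j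
    unfolding I_def using span(1) by (intro lin_span_tower[OF F]) auto
  moreover have "card I \<le> degree h * (m * n)"
    using deg by (simp add: I_def mult.assoc mult_le_mono1)
  moreover have "finite I"
    by (simp add: I_def)
  ultimately show ?thesis
    using that by blast
qed

theorem theorem1p1:
  fixes Fq k K :: "'a::field set"
    and d :: nat
    and \<alpha> :: "nat \<Rightarrow> 'a poly"
  assumes "subfield Fq \<K>" and "finite Fq"
    and "d > 1"
    and "\<And>i. i \<in> {1..d} \<Longrightarrow> poly_over Fq (\<alpha> i)"
    and "inj_on \<alpha> {1..d}"
    and "\<And>i j. i \<in> {1..d} \<Longrightarrow> j \<in> {1..d} \<Longrightarrow> i \<noteq> j \<Longrightarrow>
      degree (\<alpha> i - \<alpha> j) + (\<Sum>l\<in>{1..d} - {j}. degree (\<alpha> l - \<alpha> j))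
        > Max ((\<lambda>l. degree (\<alpha> l)) ` {1..d})"
    and "subfield k \<K>" and "Fq \<subseteq> k"
    and "function_field_over k K"
    and "algebraic_closure \<K> K"
  shows "SUBP_family k K (\<Prod>i\<in>{1..d}. [:- \<alpha> i, 1:])"
proof -
  define J where "J = {1..d}"
  define M where "M = Max ((\<lambda>l. degree (\<alpha> l)) ` J)"
  define fam where "fam = (\<Prod>i\<in>J. [:- \<alpha> i, 1:])"
  \<comment> \<open>The field of constants is enlarged to its algebraic closure; \<open>t\<close>
    remains transcendental over it.\<close>
  define kk where "kk = algebraic_elements k"
  have ac: "algebraically_closed_type TYPE('a)"
    using assms(10) by (rule algebraically_closed_ambient)
  have Fq: "is_subfield Fq" and k: "is_subfield k"
    using assms(1,7) is_subfield_if_subfield by blast+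
  have kk: "is_subfield kk" and k_kk: "k \<subseteq> kk"
    unfolding kk_def using assms(7) subfield_algebraic_elements subset_algebraic_elements by blast+
  have kk_eq: "kk = {x. algebraic_over k x}"
    unfolding kk_def using assms(7) by (rule algebraic_elements_eq)
  have kk_closed: "y \<in> kk" if "algebraic_over kk y" for y
    using algebraic_over_trans[OF k] that unfolding kk_eq by blast
  have J: "finite J" "card J > 1" "card J = d"
    using assms(3) by (auto simp: J_def)
  have \<alpha>: "poly_over Fq (\<alpha> j)" "degree (\<alpha> j) \<le> M" if "j \<in> J" for j
    using assms(4) that J(1) by (auto simp: J_def M_def)
  have ineq: "degree (\<alpha> i - \<alpha> j) + (\<Sum>l\<in>J - {j}. degree (\<alpha> l - \<alpha> j)) > M"
    if "i \<in> J" "j \<in> J" "i \<noteq> j" for i j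
    using assms(6) that unfolding J_def M_def by blast
  have inj: "inj_on \<alpha> J"
    using assms(5) by (simp add: J_def)
  have \<alpha>_kk: "poly_over kk (\<alpha> j)" if "j \<in> J" for j
    using \<alpha>(1)[OF that] assms(8) k_kk poly_over_mono by blast

  obtain q where q: "q \<ge> 2" "\<And>x y :: 'a. (x - y) ^ q = x ^ q - y ^ q" "\<And>c. c \<in> Fq \<Longrightarrow> c ^ q = c"
    using frobenius_exponent[OF Fq assms(2)] by blast

  \<comment> \<open>If all \<open>\<alpha> j\<close> were constant, the left side of the inequality
    on degrees would be \<open>0\<close>.\<close>
  obtain i0 where i0: "i0 \<in> J" "degree (\<alpha> i0) > 0"
  proof (rule ccontr)
    assume contra: "\<not> thesis"
    then have zero: "degree (\<alpha> j) = 0" if "j \<in> J" for j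
      using that \<open>\<And>i0. i0 \<in> J \<Longrightarrow> 0 < degree (\<alpha> i0) \<Longrightarrow> thesis\<close> by blast
    have diff: "degree (\<alpha> i - \<alpha> j) = 0" if "i \<in> J" "j \<in> J" for i j
      using degree_diff_le[of "\<alpha> i" 0 "\<alpha> j"] zero that by simp
    have "1 \<in> J" "2 \<in> J"
      using assms(3) by (auto simp: J_def)
    then show False
      using ineq[of 1 2] diff by simp
  qed
  obtain j0 where j0: "degree (coeff fam j0) > 0"
    using nonconstant_coeff[of J i0 \<alpha>, OF J(1) i0] unfolding fam_def by blast
  \<comment> \<open>A coefficient that depends on the parameter. If \<open>f\<^sub>s\<close> is
    defined over \<open>L\<close>, its value at \<open>s\<close> lies in \<open>L\<close>, and this
    bounds the degree of \<open>s\<close> over \<open>L\<close>.\<close>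
  define h0 where "h0 = coeff fam j0"
  have h0_Fq: "poly_over Fq h0"
  proof -
    have "\<forall>j. poly_over Fq (coeff (\<Prod>i\<in>I. [:- \<alpha> i, 1:]) j)" if "I \<subseteq> J" for I
      using finite_subset[OF that J(1)] that
    proof (induction I rule: finite_induct)
      case empty
      then show ?case
        using subfield_subring[OF Fq] by (auto intro: poly_over_0 poly_over_1 simp: coeff_1)
    next
      case (insert i I)
      have "poly_over Fq (coeff (pCons 0 p) j)" if "\<And>j. poly_over Fq (coeff p j)" for p j
        using that subfield_subring[OF Fq] by (auto simp: coeff_pCons poly_over_0 split: nat.split)
      then show ?case
        using insert \<alpha>(1)[of i] subfield_subring[OF Fq]
        by (auto intro!: poly_over_diff poly_over_mult)
    qed
    then show ?thesis
      by (simp add: h0_def fam_def)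
  qed

  obtain t n where t: "t \<in> K" "ring.transcendental \<K> k t"
    and n: "extension_of_degree n (generate_field \<K> (insert t k)) K"
    using assms(9) by (auto simp: function_field_over_def)
  have t_kk: "t \<notin> kk"
    using t(2) transcendental_ambient[OF assms(7)] by (simp add: kk_eq)
  obtain v where v: "K \<subseteq> lin_span (generate_field \<K> (insert t k)) {..<n} v"
    using extension_of_degree_span[OF n] .
  define KT where "KT = fraction_field kk t"
  have KT: "is_subfield KT"
    unfolding KT_def using kk by (intro subfield_fraction_field subfield_subring)
  have "generate_field \<K> (insert t k) \<subseteq> KT"
    using generate_field_subset_fraction_field[OF subfield_subring[OF k], of t]
      fraction_field_mono[OF k_kk, of t] by (auto simp: KT_def)
  then have KvT: "K \<subseteq> lin_span KT {..<n} v"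
    using v lin_span_mono by blast
  have K: "is_subfield K"
    using assms(9) is_subfield_if_subfield by (auto simp: function_field_over_def)

  have spec: "specialize fam s = Fract (\<Prod>j\<in>J. [:- poly (\<alpha> j) s, 1:]) 1" for s
    unfolding specialize_def fam_def map_poly_eval_prod_linear ..
  have spec_degree: "rat_degree (specialize fam s) = d" for s
    unfolding spec rat_degree_poly degree_prod_linear_set J(3) ..
  \<comment> \<open>For \<open>s\<close> in \<open>kk\<close> the polynomial
    \<open>f\<^sub>s\<close> itself has coefficients in \<open>kk\<close>, so every remaining
    parameter is transcendental over \<open>kk\<close>.\<close>
  have isotrivial: "\<exists>g. rat_over kk g \<and> PGL2_conjugate (specialize fam s) g" if s: "s \<in> kk" for s
  proof -
    have "poly_over kk (\<Prod>j\<in>J. [:- poly (\<alpha> j) s, 1:])"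
      using \<alpha>_kk s subfield_subring[OF kk]
      by (intro poly_over_prod poly_over_linear poly_in_subring) auto
    then have "rat_over kk (specialize fam s)"
      unfolding spec rat_over_def using poly_over_1[OF subfield_subring[OF kk]] by (metis one_neq_zero)
    then show ?thesis
      unfolding spec using PGL2_conjugate_refl_poly by blast
  qed

  have bound: "\<exists>B. \<forall>L f. extension_of_degree D K L \<longrightarrow>
      f \<in> {specialize fam s |s. \<not> (\<exists>g. rat_over kk g \<and> PGL2_conjugate (specialize fam s) g)} \<longrightarrow>
      rat_over L f \<longrightarrow> finite (PrePer f L) \<and> card (PrePer f L) \<le> B" for D
  proof -
    \<comment> \<open>The gonality bound; the three factors bound the degrees of \<open>L(s)\<close>
      over \<open>L\<close>, of \<open>L\<close> over \<open>K\<close>, and of \<open>K\<close> over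
      \<open>k(t)\<close>.\<close>
    define N where "N = (q + 1) * (degree h0 * (D * n))"
    define \<F> where "\<F> = bounded_families Fq (M * N) N"
    have \<F>: "finite \<F>"
      unfolding \<F>_def using subfield_subring[OF Fq] assms(2) by (rule finite_bounded_families)
    \<comment> \<open>The summand \<open>1\<close> accounts for the point at infinity.\<close>
    have "finite (PrePer f L) \<and> card (PrePer f L) \<le> card \<F> * N + 1"
      if L: "extension_of_degree D K L"
        and f: "f \<in> {specialize fam s |s. \<not> (\<exists>g. rat_over kk g \<and> PGL2_conjugate (specialize fam s) g)}"
        and fL: "rat_over L f" for L f
    proof -
      obtain s where s: "f = specialize fam s" "s \<notin> kk"
        using f isotrivial by blast
      define p where "p = (\<Prod>j\<in>J. [:- poly (\<alpha> j) s, 1:])"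
      have fp: "f = Fract p 1"
        unfolding s(1) spec p_def ..
      have L_field: "is_subfield L"
        using L is_subfield_if_subfield by (auto simp: extension_of_degree_def)
      have K_L: "K \<subseteq> L"
        using L by (auto simp: extension_of_degree_def)
      have k_L: "k \<subseteq> L"
        using assms(9) K_L by (auto simp: function_field_over_def)
      have pL: "poly_over L p"
        using rat_over_poly[OF L_field] fL unfolding fp .
      obtain w where w: "L \<subseteq> lin_span K {..<D} w"
        using extension_of_degree_span[OF L] .
      interpret function_field kk s
        by unfold_locales (use ac kk kk_closed s in auto)
      obtain V where V: "valuation_ring V" "kk \<subseteq> V" "s \<notin> V"
        by (rule infinite_place_exists)
      interpret frobenius_place kk s V Fq q
        by unfold_locales (use V Fq assms(8) k_kk q in auto)

      \<comment> \<open>\<open>h0\<close> has positive degree, so subtracting a constant preserves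
        its leading coefficient and \<open>h\<close> is nonzero.\<close>
      define h where "h = h0 - [:coeff p j0:]"
      have h: "poly_over L h" "h \<noteq> 0" "poly h s = 0" "degree h \<le> degree h0"
      proof -
        have "poly_over L h0"
          using h0_Fq assms(8) k_L poly_over_mono by blast
        moreover have "coeff p j0 \<in> L"
          using pL subfield_subring[OF L_field] by (intro poly_over_coeff)
        ultimately show "poly_over L h"
          unfolding h_def using subfield_subring[OF L_field] by (intro poly_over_diff poly_over_const)
        have "coeff h (degree h0) = lead_coeff h0"
          using j0 by (simp add: h_def h0_def coeff_pCons split: nat.split)
        then show "h \<noteq> 0"
          using j0 by (auto simp: h0_def)
        have "p = map_poly (\<lambda>c. poly c s) fam"
          unfolding p_def fam_def map_poly_eval_prod_linear ..
        then show "poly h s = 0"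
          by (simp add: h_def h0_def coeff_map_poly)
        show "degree h \<le> degree h0"
          unfolding h_def by (intro degree_diff_le) auto
      qed

      define S where "S = {x \<in> L. finite (range (\<lambda>n. (poly p ^^ n) x))}"
      have "\<exists>g\<in>\<F>. map_poly (\<lambda>c. poly c s) g \<noteq> 0 \<and> poly (map_poly (\<lambda>c. poly c s) g) x = 0"
        if x: "x \<in> S" for x
      proof -
        have fin: "finite (range (\<lambda>n. (poly (\<Prod>j\<in>J. [:- poly (\<alpha> j) s, 1:]) ^^ n) x))" and xL: "x \<in> L"
          using x by (auto simp: S_def p_def)
        obtain P where P: "min_poly F x P" "\<And>y. poly P y = 0 \<Longrightarrow> y \<in> approximable"
          "\<And>i. \<exists>g. poly_over Fq g \<and> degree g \<le> M * degree P \<and> coeff P i = poly g s"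
          using min_poly_preperiodic[OF J(1,2) \<alpha>(1) \<alpha>(2) inj ineq fin] by blast
        obtain \<gamma> where \<gamma>: "\<And>i. poly_over Fq (\<gamma> i)" "\<And>i. degree (\<gamma> i) \<le> M * degree P"
          "\<And>i. coeff P i = poly (\<gamma> i) s"
          using P(3) by metis
        have P_coeffs: "poly_over (adjoin Fq s) P"
          unfolding poly_over_iff[OF subring_adjoin[OF Fq_ring]] \<gamma>(3)
          using \<gamma>(1) by (blast intro: adjoinI)
        obtain I :: "((nat \<times> nat) \<times> nat) set" and u where I: "finite I" "card I \<le> degree h * (D * n)"
          and span: "\<And>i j. s ^ i * x ^ j \<in> lin_span KT I u"
          using powers_in_tower_span[OF subfield_subring[OF KT] subfield_subring[OF K] L_field
              KvT w h(1-3) xL] by blast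
        have "degree P \<le> (q + 1) * card I"
          using degree_bound[OF P(1,2) P_coeffs t_kk I(1) span[unfolded KT_def]] .
        also have "\<dots> \<le> (q + 1) * (degree h * (D * n))"
          using I(2) by (rule mult_le_mono2)
        also have "\<dots> \<le> N"
          unfolding N_def using h(4) by (intro mult_le_mono2 mult_le_mono1)
        finally have PN: "degree P \<le> N" .
        \<comment> \<open>\<open>P\<close> as a polynomial in two variables over \<open>Fq\<close>;
          specializing the inner variable to \<open>s\<close> gives back \<open>P\<close>.\<close>
        define g where "g = (\<Sum>i\<le>degree P. monom (\<gamma> i) i)"
        have coeff_g: "coeff g i = (if i \<le> degree P then \<gamma> i else 0)" for i
          by (simp add: g_def coeff_sum)
        have "degree g \<le> degree P"
          by (rule degree_le) (simp add: coeff_g)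
        moreover have "degree (coeff g i) \<le> M * N \<and> poly_over Fq (coeff g i)" for i
          using \<gamma>(1)[of i] order_trans[OF \<gamma>(2)[of i] mult_le_mono2[OF PN]] poly_over_0[OF Fq_ring]
          by (simp add: coeff_g)
        ultimately have "g \<in> \<F>"
          using PN by (simp add: \<F>_def bounded_families_def)
        moreover have "map_poly (\<lambda>c. poly c s) g = P"
          using \<gamma>(3) by (intro poly_eqI) (simp add: coeff_map_poly coeff_g coeff_eq_0 flip: \<gamma>(3))
        ultimately show ?thesis
          using min_poly_root[OF F P(1)] min_poly_nonzero[OF F P(1)] by (intro bexI[of _ g]) simp_all
      qed
      then have S: "finite S" "card S \<le> card \<F> * N"
        using card_roots_of_families[OF \<F>, of N S s] by (auto simp: \<F>_def bounded_families_def)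
      have "finite (insert Infinity (Affine ` S))"
        using S by simp
      moreover have "card (insert Infinity (Affine ` S)) \<le> card \<F> * N + 1"
        using S card_image_le[of S Affine] by (simp add: card_insert_if)
      moreover have "PrePer f L \<subseteq> insert Infinity (Affine ` S)"
        unfolding fp S_def by (rule PrePer_poly)
      ultimately show ?thesis
        by (meson card_mono finite_subset order_trans)
    qed
    then show ?thesis
      by blast
  qed
  show ?thesis
    unfolding SUBP_family_def SUBP_def fam_def[symmetric, unfolded J_def] kk_def[symmetric]
    using bound spec_degree assms(3) by blast
qed

end
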